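(* For every $n\ge 3$, with respect to the extended $S_{n+1}$-action there is an isomorphism of $S_{n+1}$-modules $$H^1(M(d\mathscr{A}_{n-1});\mathbb{C})\cong V_{(n-1,2)}.$$ In particular, there is an isomorphism of $S_n$-modules $$H^1(M(d\mathscr{A}_{n-1});\mathbb{C})\cong V_{(n-1,1)}\oplus V_{(n-2,2)},$$ where for $n=3$ the term $V_{(n-2,2)}$ is understood to be $0$.
   Context: $\mathscr{A}_{n-1}$ is the essential braid arrangement, i.e. the arrangement of the hyperplanes $z_i=z_j$ ($1\le i<j\le n$) in $\mathbb{C}^n/\langle(1,\dots,1)\rangle$, with complement $M(\mathscr{A}_{n-1})$. Its deconing $d\mathscr{A}_{n-1}$ is an affine arrangement in $\mathbb{C}^{n-2}$ whose complement satisfies $M(d\mathscr{A}_{n-1})\cong M(\mathscr{A}_{n-1})/\mathbb{C}^*$ ($\mathbb{C}^*$ acting by scalar multiplication); here "$d$" is just part of the notation. Thus $M(d\mathscr{A}_{n-1})$ is the space of $n$-tuples of distinct points $(z_1,\dots,z_n)$ of $\mathbb{C}$ modulo translations and multiplication by nonzero scalars. $S_n$ acts on it by permuting $z_1,\dots,z_n$, hence on $H^*(M(d\mathscr{A}_{n-1});\mathbb{C})$. Extended action: $M(d\mathscr{A}_{n-1})$ is identified with the moduli space $\mathcal{M}_{0,n+1}$ of $n+1$ distinct marked points on $\mathbb{P}^1(\mathbb{C})$ modulo $\mathrm{PGL}_2(\mathbb{C})$, by sending the class of $(z_1,\dots,z_n)$ to the class of $(\infty,z_1,\dots,z_n)$,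 with marked points labelled $0,1,\dots,n$. The group $S_{n+1}$ of permutations of $\{0,1,\dots,n\}$ acts by permuting marked points, hence on $H^*(M(d\mathscr{A}_{n-1});\mathbb{C})$; restricted to the stabilizer $S_n$ of $0$ this is the action above. For a partition $\lambda$ of $m$, $V_\lambda$ denotes the irreducible complex representation of $S_m$ indexed by $\lambda$, with $V_{(m)}$ the trivial representation and $V_{(m-1,1)}$ the standard representation. *)

theory Defs
  imports "HOL-Homology.Homology" "HOL-Combinatorics.Combinatorics"
begin

definition complex_ring :: "complex ring" where
  "complex_ring = \<lparr>carrier = UNIV, monoid.mult = (*), one = 1, zero = 0, add = (+)\<rparr>"

record 'v perm_module = "(complex, 'v) module" +
  act :: "(nat \<Rightarrow> nat) \<Rightarrow> 'v \<Rightarrow> 'v"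

text \<open>Modules over the group of all permutations of a set \<open>A\<close>. Labelling by an arbitrary set
  lets the groups of permutations of \<open>{0..n}\<close> and of \<open>{1..n}\<close> be treated alike, the latter being
  the stabilizer of \<open>0\<close> in the former. The fields \<open>mult\<close> and \<open>one\<close> inherited from the ring record
  are irrelevant.\<close>

locale sym_module = Module.module complex_ring M
  for A :: "nat set" and M :: "('v, 'e) perm_module_scheme" +
  assumes act_closed:
      "\<lbrakk>p permutes A; x \<in> carrier M\<rbrakk> \<Longrightarrow> act M p x \<in> carrier M"
    and act_add:
      "\<lbrakk>p permutes A; x \<in> carrier M; y \<in> carrier M\<rbrakk>
        \<Longrightarrow> act M p (x \<oplus>\<^bsub>M\<^esub> y) = act M p x \<oplus>\<^bsub>M\<^esub> act M p y"
    and act_smult: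
      "\<lbrakk>p permutes A; x \<in> carrier M\<rbrakk>
        \<Longrightarrow> act M p (c \<odot>\<^bsub>M\<^esub> x) = c \<odot>\<^bsub>M\<^esub> act M p x"
    and act_id: "x \<in> carrier M \<Longrightarrow> act M id x = x"
    and act_comp:
      "\<lbrakk>p permutes A; q permutes A; x \<in> carrier M\<rbrakk>
        \<Longrightarrow> act M (p \<circ> q) x = act M p (act M q x)"

definition sym_module_iso ::
    "nat set \<Rightarrow> 'v perm_module \<Rightarrow> 'w perm_module \<Rightarrow> bool" where
  "sym_module_iso A M N \<longleftrightarrow> sym_module A M \<and> sym_module A N \<and>
     (\<exists>f. bij_betw f (carrier M) (carrier N) \<and>
          (\<forall>x\<in>carrier M. \<forall>y\<in>carrier M. f (x \<oplus>\<^bsub>M\<^esub> y) = f x \<oplus>\<^bsub>N\<^esub> f y) \<and>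
          (\<forall>c. \<forall>x\<in>carrier M. f (c \<odot>\<^bsub>M\<^esub> x) = c \<odot>\<^bsub>N\<^esub> f x) \<and>
          (\<forall>p. p permutes A \<longrightarrow> (\<forall>x\<in>carrier M. f (act M p x) = act N p (f x))))"

definition direct_sum :: "'v perm_module \<Rightarrow> 'w perm_module \<Rightarrow> ('v \<times> 'w) perm_module" where
  "direct_sum M N =
     \<lparr>carrier = carrier M \<times> carrier N, monoid.mult = undefined, one = undefined,
      zero = (\<zero>\<^bsub>M\<^esub>, \<zero>\<^bsub>N\<^esub>),
      add = (\<lambda>x y. (fst x \<oplus>\<^bsub>M\<^esub> fst y, snd x \<oplus>\<^bsub>N\<^esub> snd y)),
      smult = (\<lambda>c x. (c \<odot>\<^bsub>M\<^esub> fst x, c \<odot>\<^bsub>N\<^esub> snd x)),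
      act = (\<lambda>p x. (act M p (fst x), act N p (snd x)))\<rparr>"

text \<open>The irreducible representation indexed by a partition is realised as its Specht module: the
  span of the polytabloids in the permutation module on tabloids. With this convention \<open>[m]\<close> gives
  the trivial and \<open>[m - 1, 1]\<close> the standard representation.\<close>

definition cells :: "nat list \<Rightarrow> (nat \<times> nat) set" where
  "cells la = {(i, j). i < length la \<and> j < la ! i}"

definition tableaux :: "nat list \<Rightarrow> nat set \<Rightarrow> (nat \<times> nat \<Rightarrow> nat) set" where
  "tableaux la A = {t. bij_betw t (cells la) A}"

text \<open>A tabloid (a tableau up to permutations within rows) is encoded by the sequence of the
  sets of entries of its rows.\<close>

definition tabloid :: "nat list \<Rightarrow> (nat \<times> nat \<Rightarrow> nat) \<Rightarrow> (nat \<Rightarrow> nat set)" where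
  "tabloid la t = (\<lambda>i. t ` {c \<in> cells la. fst c = i})"

definition column_group :: "nat list \<Rightarrow> nat set \<Rightarrow> (nat \<times> nat \<Rightarrow> nat) \<Rightarrow> (nat \<Rightarrow> nat) set" where
  "column_group la A t =
     {p. p permutes A \<and> (\<forall>c\<in>cells la. \<exists>c'\<in>cells la. snd c' = snd c \<and> p (t c) = t c')}"

definition polytabloid ::
    "nat list \<Rightarrow> nat set \<Rightarrow> (nat \<times> nat \<Rightarrow> nat) \<Rightarrow> (nat \<Rightarrow> nat set) \<Rightarrow> complex" where
  "polytabloid la A t =
     (\<lambda>T. \<Sum>p\<in>column_group la A t. if T = tabloid la (p \<circ> t) then of_int (sign p) else 0)"

text \<open>Functions on tabloids, with permutation \<open>p\<close> sending the indicator of a tabloid \<open>T\<close> to the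
  indicator of \<open>\<lambda>i. p ` T i\<close>.\<close>

definition tabloid_module ::
    "((nat \<Rightarrow> nat set) \<Rightarrow> complex) set \<Rightarrow> ((nat \<Rightarrow> nat set) \<Rightarrow> complex) perm_module" where
  "tabloid_module W =
     \<lparr>carrier = W, monoid.mult = undefined, one = undefined,
      zero = (\<lambda>T. 0), add = (\<lambda>f g T. f T + g T), smult = (\<lambda>c f T. c * f T),
      act = (\<lambda>p f T. f (\<lambda>i. inv_into UNIV p ` T i))\<rparr>"

definition specht :: "nat list \<Rightarrow> nat set \<Rightarrow> ((nat \<Rightarrow> nat set) \<Rightarrow> complex) perm_module" where
  "specht la A = tabloid_module
     {\<lambda>T. \<Sum>t\<in>F. c t * polytabloid la A t T |F c. finite F \<and> F \<subseteq> tableaux la A}"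

definition zero_module :: "((nat \<Rightarrow> nat set) \<Rightarrow> complex) perm_module" where
  "zero_module = tabloid_module {\<lambda>T. 0}"

text \<open>A cochain is a function on singular simplices, extended by \<open>0\<close> to all other functions.\<close>

definition cochains :: "nat \<Rightarrow> 'a topology \<Rightarrow> (((nat \<Rightarrow> real) \<Rightarrow> 'a) \<Rightarrow> complex) set" where
  "cochains k X = {u. \<forall>s. \<not> singular_simplex k X s \<longrightarrow> u s = 0}"

definition coboundary ::
    "nat \<Rightarrow> 'a topology \<Rightarrow> (((nat \<Rightarrow> real) \<Rightarrow> 'a) \<Rightarrow> complex) \<Rightarrow> ((nat \<Rightarrow> real) \<Rightarrow> 'a) \<Rightarrow> complex" where
  "coboundary k X u =
     (\<lambda>s. if singular_simplex (Suc k) X s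
          then \<Sum>i\<le>Suc k. (- 1) ^ i * u (singular_face (Suc k) i s) else 0)"

definition cocycles :: "nat \<Rightarrow> 'a topology \<Rightarrow> (((nat \<Rightarrow> real) \<Rightarrow> 'a) \<Rightarrow> complex) set" where
  "cocycles k X = {u \<in> cochains k X. coboundary k X u = (\<lambda>s. 0)}"

definition coboundaries :: "nat \<Rightarrow> 'a topology \<Rightarrow> (((nat \<Rightarrow> real) \<Rightarrow> 'a) \<Rightarrow> complex) set" where
  "coboundaries k X =
     (if k = 0 then {\<lambda>s. 0} else coboundary (k - 1) X ` cochains (k - 1) X)"

definition cohomology_class ::
    "nat \<Rightarrow> 'a topology \<Rightarrow> (((nat \<Rightarrow> real) \<Rightarrow> 'a) \<Rightarrow> complex)
      \<Rightarrow> (((nat \<Rightarrow> real) \<Rightarrow> 'a) \<Rightarrow> complex) set" where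
  "cohomology_class k X u = {(\<lambda>s. u s + b s) |b. b \<in> coboundaries k X}"

definition cochain_pullback ::
    "nat \<Rightarrow> 'a topology \<Rightarrow> ('a \<Rightarrow> 'a) \<Rightarrow> (((nat \<Rightarrow> real) \<Rightarrow> 'a) \<Rightarrow> complex)
      \<Rightarrow> ((nat \<Rightarrow> real) \<Rightarrow> 'a) \<Rightarrow> complex" where
  "cochain_pullback k X g u =
     (\<lambda>s. if singular_simplex k X s then u (simplex_map k g s) else 0)"

text \<open>For a left action \<open>g\<close> of permutations on the space \<open>X\<close>, the permutation \<open>p\<close> acts on cohomology
  by pulling back along \<open>g (inv_into UNIV p)\<close>, which is again a left action. Operations on cosets are
  written as unions over all representatives.\<close>

definition cohomology_module ::
    "nat \<Rightarrow> 'a topology \<Rightarrow> ((nat \<Rightarrow> nat) \<Rightarrow> 'a \<Rightarrow> 'a)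
      \<Rightarrow> (((nat \<Rightarrow> real) \<Rightarrow> 'a) \<Rightarrow> complex) set perm_module" where
  "cohomology_module k X g =
     \<lparr>carrier = cohomology_class k X ` cocycles k X, monoid.mult = undefined, one = undefined,
      zero = cohomology_class k X (\<lambda>s. 0),
      add = (\<lambda>U V. \<Union>u\<in>U. \<Union>v\<in>V. cohomology_class k X (\<lambda>s. u s + v s)),
      smult = (\<lambda>c U. \<Union>u\<in>U. cohomology_class k X (\<lambda>s. c * u s)),
      act = (\<lambda>p U. \<Union>u\<in>U. cohomology_class k X (cochain_pullback k X (g (inv_into UNIV p)) u))\<rparr>"

definition quotient_topology :: "'a topology \<Rightarrow> ('a \<Rightarrow> 'b) \<Rightarrow> 'b topology" where
  "quotient_topology X q =
     topology (\<lambda>U. U \<subseteq> q ` topspace X \<and> openin X {x \<in> topspace X. q x \<in> U})"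

lemma openin_quotient_topology:
  "openin (quotient_topology X q) U \<longleftrightarrow>
     U \<subseteq> q ` topspace X \<and> openin X {x \<in> topspace X. q x \<in> U}"
proof -
  have "istopology (\<lambda>U. U \<subseteq> q ` topspace X \<and> openin X {x \<in> topspace X. q x \<in> U})"
    unfolding istopology_def
  proof (intro conjI allI impI; (elim conjE)?)
    fix S T
    assume "openin X {x \<in> topspace X. q x \<in> S}" "openin X {x \<in> topspace X. q x \<in> T}"
    moreover have "{x \<in> topspace X. q x \<in> S \<inter> T} =
        {x \<in> topspace X. q x \<in> S} \<inter> {x \<in> topspace X. q x \<in> T}" by blast
    ultimately show "openin X {x \<in> topspace X. q x \<in> S \<inter> T}" by (simp only: openin_Int)
  next
    fix K
    assume K: "\<forall>S\<in>K. S \<subseteq> q ` topspace X \<and> openin X {x \<in> topspace X. q x \<in> S}"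
    have "{x \<in> topspace X. q x \<in> \<Union>K} = (\<Union>S\<in>K. {x \<in> topspace X. q x \<in> S})" by blast
    with K show "openin X {x \<in> topspace X. q x \<in> \<Union>K}" by auto
  qed blast+
  then show ?thesis by (simp add: quotient_topology_def)
qed

lemma topspace_quotient_topology: "topspace (quotient_topology X q) = q ` topspace X"
proof -
  have "{x \<in> topspace X. q x \<in> q ` topspace X} = topspace X" by blast
  then have "openin (quotient_topology X q) (q ` topspace X)"
    by (simp add: openin_quotient_topology)
  moreover have "topspace (quotient_topology X q) \<subseteq> q ` topspace X"
    using openin_topspace[of "quotient_topology X q"] unfolding openin_quotient_topology by blast
  ultimately show ?thesis by (simp add: openin_subset subset_antisym)
qed

lemma quotient_map_quotient_topology: "quotient_map X (quotient_topology X q) q"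
  by (auto simp: quotient_map_def topspace_quotient_topology openin_quotient_topology)

definition config_space :: "nat \<Rightarrow> (nat \<Rightarrow> complex) topology" where
  "config_space n =
     subtopology (product_topology (\<lambda>_. euclidean) {1..n}) {z. inj_on z {1..n}}"

definition affine_class :: "nat \<Rightarrow> (nat \<Rightarrow> complex) \<Rightarrow> (nat \<Rightarrow> complex) set" where
  "affine_class n z = {restrict (\<lambda>i. a * z i + b) {1..n} |a b. a \<noteq> 0}"

text \<open>The complement of the deconing of the essential braid arrangement in dimension \<open>n - 1\<close>, as the
  space of \<open>n\<close>-tuples of distinct complex numbers modulo translations and nonzero scalars.\<close>

definition dA_complement :: "nat \<Rightarrow> (nat \<Rightarrow> complex) set topology" where
  "dA_complement n = quotient_topology (config_space n) (affine_class n)"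

text \<open>The point labelled \<open>i\<close> gets the new label \<open>p i\<close>, a left action.\<close>

definition permute_points :: "nat set \<Rightarrow> (nat \<Rightarrow> nat) \<Rightarrow> (nat \<Rightarrow> 'a) set \<Rightarrow> (nat \<Rightarrow> 'a) set" where
  "permute_points A p P = (\<lambda>z. restrict (z \<circ> inv_into UNIV p) A) ` P"

text \<open>The complex projective line is \<open>complex option\<close>, with \<open>None\<close> the point at infinity.\<close>

fun moebius :: "complex \<Rightarrow> complex \<Rightarrow> complex \<Rightarrow> complex \<Rightarrow> complex option \<Rightarrow> complex option" where
  "moebius a b c d None = (if c = 0 then None else Some (a / c))"
| "moebius a b c d (Some z) =
     (if c * z + d = 0 then None else Some ((a * z + b) / (c * z + d)))"

definition PGL2 :: "(complex option \<Rightarrow> complex option) set" where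
  "PGL2 = {moebius a b c d |a b c d. a * d - b * c \<noteq> 0}"

definition moduli_class :: "nat \<Rightarrow> (nat \<Rightarrow> complex option) \<Rightarrow> (nat \<Rightarrow> complex option) set" where
  "moduli_class n x = {restrict (m \<circ> x) {0..n} |m. m \<in> PGL2}"

text \<open>The points of the moduli space of \<open>n + 1\<close> distinct points, labelled \<open>0, \<dots>, n\<close>, on the projective
  line; its topology is not needed.\<close>

definition moduli_space :: "nat \<Rightarrow> (nat \<Rightarrow> complex option) set set" where
  "moduli_space n = moduli_class n ` {x \<in> extensional {0..n}. inj_on x {0..n}}"

definition add_infinity :: "nat \<Rightarrow> (nat \<Rightarrow> complex) \<Rightarrow> nat \<Rightarrow> complex option" where
  "add_infinity n z = restrict (\<lambda>i. if i = 0 then None else Some (z i)) {0..n}"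

definition to_moduli :: "nat \<Rightarrow> (nat \<Rightarrow> complex) set \<Rightarrow> (nat \<Rightarrow> complex option) set" where
  "to_moduli n P = (\<Union>z\<in>P. moduli_class n (add_infinity n z))"

lemma moebius_comp:
  assumes "a*d - b* c \<noteq> 0" "a'*d' - b'* c' \<noteq> 0"
  shows "moebius a b c d (moebius a' b' c' d' w) =
    moebius (a*a'+b* c') (a*b'+b*d') (c*a'+d* c') (c*b'+d*d') w"
proof (cases w)
  case None
  show ?thesis
  proof (cases "c' = 0")
    case True
    then have "a' \<noteq> 0" using assms by auto
    with True None show ?thesis by auto
  next
    case False
    have 1: "c*a'+d* c' = (c*(a'/c')+d)* c'" "a*a'+b* c' = (a*(a'/c')+b)* c'" using False by (simp_all add: field_simps)
    show ?thesis unfolding 1 using None False by (simp)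
  qed
next
  case (Some z)
  show ?thesis
  proof (cases "c'*z + d' = 0")
    case True
    have nz: "a'*z+b' \<noteq> 0"
    proof
      assume "a'*z+b' = 0"
      have "a'*d'-b'* c' = a' * (c'*z+d') - c' * (a'*z+b')" by (simp add: algebra_simps)
      then show False using \<open>a'*z+b' = 0\<close> True assms by simp
    qed
    have 1: "(c*a'+d* c')*z + (c*b'+d*d') = c * (a'*z+b')"
    proof -
      have "(c*a'+d* c')*z + (c*b'+d*d') = c * (a'*z+b') + d*(c'*z+d')" by (simp add: algebra_simps)
      with True show ?thesis by simp
    qed
    have 2: "(a*a'+b* c')*z + (a*b'+b*d') = a * (a'*z+b')"
    proof -
      have "(a*a'+b* c')*z + (a*b'+b*d') = a * (a'*z+b') + b*(c'*z+d')" by (simp add: algebra_simps)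
      with True show ?thesis by simp
    qed
    show ?thesis using Some True nz by (simp add: 1 2)
  next
    case False
    have 1: "(c*a'+d* c')*z + (c*b'+d*d') = (c * ((a'*z+b')/(c'*z+d')) + d) * (c'*z+d')"
      using False by (simp add: field_simps)
    have 2: "(a*a'+b* c')*z + (a*b'+b*d') = (a * ((a'*z+b')/(c'*z+d')) + b) * (c'*z+d')"
      using False by (simp add: field_simps)
    show ?thesis using Some False by (simp add: 1 2)
  qed
qed

lemma PGL2_comp: "m \<in> PGL2 \<Longrightarrow> m' \<in> PGL2 \<Longrightarrow> m \<circ> m' \<in> PGL2"
proof -
  assume "m \<in> PGL2" "m' \<in> PGL2"
  then obtain a b c d a' b' c' d' where m: "m = moebius a b c d" "a*d-b* c \<noteq> 0"
    "m' = moebius a' b' c' d'" "a'*d'-b'* c' \<noteq> 0" unfolding PGL2_def by auto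
  have "(a*a'+b* c')*(c*b'+d*d') - (a*b'+b*d')*(c*a'+d* c') = (a*d-b* c)*(a'*d'-b'* c')"
    by (simp add: algebra_simps)
  then have "(a*a'+b* c')*(c*b'+d*d') - (a*b'+b*d')*(c*a'+d* c') \<noteq> 0" using m by simp
  moreover have "m \<circ> m' = moebius (a*a'+b* c') (a*b'+b*d') (c*a'+d* c') (c*b'+d*d')"
    unfolding m(1,3) by (rule ext) (simp only: comp_apply moebius_comp[OF m(2,4)])
  ultimately show ?thesis unfolding PGL2_def by blast
qed

lemma moebius_id: "k \<noteq> 0 \<Longrightarrow> moebius k 0 0 k = id"
proof
  fix w assume "k \<noteq> 0" then show "moebius k 0 0 k w = id w" by (cases w) auto
qed

lemma PGL2I: "a * d - b * c \<noteq> 0 \<Longrightarrow> moebius a b c d \<in> PGL2" unfolding PGL2_def by blast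

lemma id_PGL2: "id \<in> PGL2" using PGL2I[of 1 1 0 0] moebius_id[of 1] by simp

lemma PGL2_inv: assumes "m \<in> PGL2" shows "\<exists>m'\<in>PGL2. m' \<circ> m = id"
proof -
  obtain a b c d where m: "m = moebius a b c d" "a*d-b* c \<noteq> 0" using assms unfolding PGL2_def by auto
  have nz: "d*a - (-b)*(-c) \<noteq> 0" using m by (simp add: mult.commute)
  have "moebius d (-b) (-c) a (m w) = w" for w
  proof -
    have "moebius d (-b) (-c) a (m w) = moebius (d*a-b* c) 0 0 (d*a-b* c) w"
      unfolding m(1) by (subst moebius_comp[OF nz m(2)]) (simp add: algebra_simps)
    then show ?thesis using nz moebius_id[of "d*a-b* c"] by simp
  qed
  moreover have "moebius d (-b) (-c) a \<in> PGL2" unfolding PGL2_def using nz by blast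
  ultimately show ?thesis by (intro bexI[of _ "moebius d (-b) (-c) a"]) auto
qed

lemma moduli_class_step: "m \<in> PGL2 \<Longrightarrow> moduli_class n (restrict (m \<circ> x) {0..n}) = moduli_class n x"
proof -
  assume m: "m \<in> PGL2"
  obtain m' where m': "m' \<in> PGL2" "m' \<circ> m = id" using PGL2_inv[OF m] by auto
  have r: "restrict (k \<circ> restrict (m \<circ> x) {0..n}) {0..n} = restrict ((k \<circ> m) \<circ> x) {0..n}" for k
    by (auto simp: fun_eq_iff restrict_def)
  show ?thesis
  proof
    show "moduli_class n (restrict (m \<circ> x) {0..n}) \<subseteq> moduli_class n x"
      unfolding moduli_class_def r using PGL2_comp[OF _ m] by blast
    show "moduli_class n x \<subseteq> moduli_class n (restrict (m \<circ> x) {0..n})"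
    proof
      fix y assume "y \<in> moduli_class n x"
      then obtain k where k: "k \<in> PGL2" "y = restrict (k \<circ> x) {0..n}" unfolding moduli_class_def by auto
      have "y = restrict (((k \<circ> m') \<circ> m) \<circ> x) {0..n}" using k m' by (simp add: comp_assoc)
      then show "y \<in> moduli_class n (restrict (m \<circ> x) {0..n})"
        unfolding moduli_class_def r using PGL2_comp[OF k(1) m'(1)] by blast
    qed
  qed
qed

lemma in_moduli_class: "x \<in> extensional {0..n} \<Longrightarrow> x \<in> moduli_class n x"
  unfolding moduli_class_def by (intro CollectI exI[of _ id] conjI id_PGL2) (simp add: extensional_restrict)

lemma add_infinity_affine: assumes "a \<noteq> 0"
  shows "add_infinity n (restrict (\<lambda>i. a * z i + b) {1..n}) = restrict (moebius a b 0 1 \<circ> add_infinity n z) {0..n}"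
  by (rule ext) (auto simp: add_infinity_def restrict_def)

lemma affine_PGL2: "a \<noteq> 0 \<Longrightarrow> moebius a b 0 1 \<in> PGL2"
  by (rule PGL2I) simp

lemma to_moduli_class: "to_moduli n (affine_class n z) = moduli_class n (add_infinity n z)"
proof -
  have "moduli_class n (add_infinity n w) = moduli_class n (add_infinity n z)" if w: "w \<in> affine_class n z" for w
  proof -
    obtain a b where ab: "a \<noteq> 0" "w = restrict (\<lambda>i. a * z i + b) {1..n}" using w unfolding affine_class_def by auto
    show ?thesis unfolding ab(2) add_infinity_affine[OF ab(1)] by (rule moduli_class_step[OF affine_PGL2[OF ab(1)]])
  qed
  moreover have "affine_class n z \<noteq> {}" unfolding affine_class_def by (auto intro: exI[of _ 1])
  ultimately show ?thesis unfolding to_moduli_def by auto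
qed

lemma affine_class_eq: assumes "a \<noteq> 0"
  shows "affine_class n (restrict (\<lambda>i. a * z i + b) {1..n}) = affine_class n z" (is "?L = ?R")
proof
  have r: "restrict (\<lambda>i. p * restrict (\<lambda>i. a * z i + b) {1..n} i + q) {1..n} = restrict (\<lambda>i. (p*a) * z i + (p*b+q)) {1..n}" for p q
    by (rule ext) (auto simp: restrict_def algebra_simps)
  show "?L \<subseteq> ?R" unfolding affine_class_def r using assms by (fastforce)
  show "?R \<subseteq> ?L"
  proof
    fix y assume "y \<in> ?R"
    then obtain p q where p: "p \<noteq> 0" "y = restrict (\<lambda>i. p * z i + q) {1..n}" unfolding affine_class_def by auto
    have "y = restrict (\<lambda>i. ((p/a)*a) * z i + ((p/a)*b+(q - p/a*b))) {1..n}" using p assms by simp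
    then show "y \<in> ?L" unfolding affine_class_def r using p assms
      by (intro CollectI exI[of _ "p/a"] exI[of _ "q - p/a*b"] conjI) auto
  qed
qed

lemma topspace_config: "topspace (config_space n) = {z \<in> extensional {1..n}. inj_on z {1..n}}"
  unfolding config_space_def by (auto simp: PiE_def)

lemma bij_betw_to_moduli: "bij_betw (to_moduli n) (topspace (dA_complement n)) (moduli_space n)"
proof -
  have ts: "topspace (dA_complement n) = affine_class n ` {z \<in> extensional {1..n}. inj_on z {1..n}}"
    by (simp add: dA_complement_def topspace_quotient_topology topspace_config)
  show ?thesis
  proof (rule bij_betw_imageI)
    show "inj_on (to_moduli n) (topspace (dA_complement n))"
      unfolding ts
    proof (rule inj_onI, elim imageE CollectE conjE, simp only: to_moduli_class)
      fix z w :: "nat \<Rightarrow> complex"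
      assume z: "z \<in> extensional {1..n}" and w: "w \<in> extensional {1..n}"
        and eq: "moduli_class n (add_infinity n z) = moduli_class n (add_infinity n w)"
      have "add_infinity n w \<in> moduli_class n (add_infinity n z)"
        unfolding eq by (rule in_moduli_class) (simp add: add_infinity_def)
      then obtain m where m: "m \<in> PGL2" "add_infinity n w = restrict (m \<circ> add_infinity n z) {0..n}"
        unfolding moduli_class_def by auto
      obtain a b c d where abcd: "m = moebius a b c d" "a*d-b* c \<noteq> 0" using m unfolding PGL2_def by auto
      have "add_infinity n w 0 = m (add_infinity n z 0)" unfolding m(2) by simp
      then have c: "c = 0" by (auto simp: add_infinity_def abcd split: if_splits)
      then have ad: "a \<noteq> 0" "d \<noteq> 0" using abcd by auto
      have wi: "w i = (a/d) * z i + b/d" if "i \<in> {1..n}" for i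
      proof -
        have "add_infinity n w i = m (add_infinity n z i)" unfolding m(2) using that by simp
        then show ?thesis using that c ad by (auto simp: add_infinity_def abcd add_divide_distrib)
      qed
      have "w = restrict (\<lambda>i. (a/d) * z i + b/d) {1..n}"
        by (rule extensionalityI[OF w]) (auto simp: wi)
      then show "affine_class n z = affine_class n w" using affine_class_eq[of "a/d" n z "b/d"] ad by simp
    qed
  next
    show "to_moduli n ` topspace (dA_complement n) = moduli_space n"
    proof
      have "add_infinity n z \<in> {x \<in> extensional {0..n}. inj_on x {0..n}}"
        if "inj_on z {1..n}" for z
      proof -
        have "i = j" if "i \<in> {0..n}" "j \<in> {0..n}" "add_infinity n z i = add_infinity n z j" for i j
          using that inj_onD[OF \<open>inj_on z {1..n}\<close>, of i j]
          by (cases "i = 0"; cases "j = 0") (simp_all add: add_infinity_def)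
        then have "inj_on (add_infinity n z) {0..n}" by (rule inj_onI)
        then show ?thesis by (simp add: add_infinity_def)
      qed
      then show "to_moduli n ` topspace (dA_complement n) \<subseteq> moduli_space n"
        unfolding ts moduli_space_def image_image to_moduli_class by fast
    next
      show "moduli_space n \<subseteq> to_moduli n ` topspace (dA_complement n)"
      proof
        fix K assume "K \<in> moduli_space n"
        then obtain x where x: "x \<in> extensional {0..n}" "inj_on x {0..n}" "K = moduli_class n x"
          unfolding moduli_space_def by auto
        obtain m where m: "m \<in> PGL2" "m (x 0) = None"
        proof (cases "x 0")
          case None with that[OF id_PGL2] show ?thesis by simp
        next
          case (Some s)
          have "moebius 0 1 1 (-s) \<in> PGL2" by (rule PGL2I) simp
          moreover have "moebius 0 1 1 (-s) (x 0) = None" using Some by simp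
          ultimately show ?thesis by (rule that)
        qed
        obtain m' where m': "m' \<circ> m = id" using PGL2_inv[OF m(1)] by (elim bexE)
        have injm: "inj m" proof (rule injI)
          fix u v assume "m u = m v"
          then have "(m' \<circ> m) u = (m' \<circ> m) v" by simp
          then show "u = v" unfolding m' by simp
        qed
        have ne: "m (x i) \<noteq> None" if "i \<in> {1..n}" for i
        proof
          assume "m (x i) = None"
          then have "x i = x 0" using injD[OF injm, of "x i" "x 0"] m(2) by simp
          then show False using inj_onD[OF x(2), of i 0] that by simp
        qed
        define z where "z = restrict (\<lambda>i. the (m (x i))) {1..n}"
        have "inj_on z {1..n}"
        proof (rule inj_onI)
          fix i j assume ij: "i \<in> {1..n}" "j \<in> {1..n}" "z i = z j"
          obtain u v where uv: "m (x i) = Some u" "m (x j) = Some v"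
            using ne[OF ij(1)] ne[OF ij(2)] by blast
          then have "m (x i) = m (x j)" using ij by (simp add: z_def)
          then have "x i = x j" by (rule injD[OF injm])
          then show "i = j" using inj_onD[OF x(2), of i j] ij by simp
        qed
        moreover have "add_infinity n z = restrict (m \<circ> x) {0..n}"
        proof
          fix i
          show "add_infinity n z i = restrict (m \<circ> x) {0..n} i"
          proof (cases "i \<in> {1..n}")
            case True
            with ne[of i] obtain u where "m (x i) = Some u" by blast
            with True show ?thesis by (simp add: add_infinity_def z_def)
          next
            case False
            with m(2) show ?thesis by (cases "i = 0") (simp_all add: add_infinity_def)
          qed
        qed
        then have "to_moduli n (affine_class n z) = K"
          by (simp add: to_moduli_class moduli_class_step[OF m(1)] x(3))
        moreover have "z \<in> extensional {1..n}" by (simp add: z_def)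
        ultimately show "K \<in> to_moduli n ` topspace (dA_complement n)"
          unfolding ts by blast
      qed
    qed
  qed
qed

text \<open>The action of permutations of the marked points, transported along the bijection
  \<open>to_moduli\<close>.\<close>

definition extended_action ::
    "nat \<Rightarrow> (nat \<Rightarrow> nat) \<Rightarrow> (nat \<Rightarrow> complex) set \<Rightarrow> (nat \<Rightarrow> complex) set" where
  "extended_action n p P =
     inv_into (topspace (dA_complement n)) (to_moduli n) (permute_points {0..n} p (to_moduli n P))"

end

theory Submission
  imports Defs "HOL-Analysis.Analysis"
begin

text \<open>A point of the space determines homogeneous brackets \<open>[i, j]\<close> of the marked points \<open>0, \<dots>, n\<close>, up to
  rescaling the homogeneous coordinates of each point. For a function \<open>a\<close> on the edges of the complete
  graph on \<open>{0..n}\<close> whose vertex sums all vanish, \<open>\<Sum> a {i, j} dlog [i, j]\<close> is therefore a well-defined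
  cocycle, and it depends on \<open>a\<close> equivariantly. That every class arises in this way is a statement about
  hyperplane complements: modulo multiples of the logarithmic differentials, the hyperplanes are filled in
  one at a time, the monodromy around each being the only obstruction, and what remains is exact because a
  normed space is simply connected. Uniqueness of \<open>a\<close> is seen by letting one point run around another.
  Finally the edge functions with vanishing vertex sums are spanned by alternating 4-cycles, which are
  the polytabloids of shape \<open>[n - 1, 2]\<close>, and restricting them to the edges inside \<open>{1..n}\<close>, with
  a correction by the edges at \<open>0\<close>, splits off the standard representation.\<close>

subsection \<open>One-dimensional cocycles and their primitives\<close>

text \<open>A singular cocycle is an arbitrary function on edges, so it can only be compared with
  others piece by piece. Gluing works because a complex hyperplane does not disconnect: for open
  convex \<open>S\<close> the set \<open>D \<inter> S\<close> is path connected, hence primitives on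
  it are unique up to one constant. Exactness is therefore asked of \<open>D \<inter> S\<close>,
  where \<open>S\<close> may cross hyperplanes, and pieces are glued along convex sets. This is also
  why intersections of hyperplanes bring no further obstruction. A point on several hyperplanes is
  reached when the last of them is filled in; near it the cocycle is by then locally exact off that
  last one. So only the complement of a single hyperplane matters, and the monodromy is constant
  along the connected part of the hyperplane under consideration. One coefficient per pair of points
  is one too many on the quotient space, where \<open>ratio 1 2\<close> is constant. Using this
  freedom to make the coefficients add up to 0 is exactly what permits the extension to vertex 0
  with all vertex sums 0.\<close>

definition edge_point :: "real \<Rightarrow> nat \<Rightarrow> real" where
  "edge_point t = (\<lambda>i. if i = 0 then 1 - t else if i = 1 then t else 0)"

text \<open>Only simplices of \<open>X\<close> are constrained, so that the same \<open>u\<close>,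
  without truncation, is a cocycle on every subspace.\<close>

definition cocycle1 :: "'a topology \<Rightarrow> (((nat \<Rightarrow> real) \<Rightarrow> 'a) \<Rightarrow> complex) \<Rightarrow> bool" where
  "cocycle1 X u \<longleftrightarrow> (\<forall>s. singular_simplex 2 X s \<longrightarrow>
     u (singular_face 2 0 s) - u (singular_face 2 1 s) + u (singular_face 2 2 s) = 0)"

text \<open>Says that \<open>u\<close> is the coboundary of \<open>g\<close> on the edges of
  \<open>X\<close>. Since 0-simplices correspond to points, \<open>g\<close> is a function of
  points, and continuity is not asked of it.\<close>

definition primitive ::
    "'a topology \<Rightarrow> (((nat \<Rightarrow> real) \<Rightarrow> 'a) \<Rightarrow> complex) \<Rightarrow> ('a \<Rightarrow> complex) \<Rightarrow> bool" where
  "primitive X u g \<longleftrightarrow>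
     (\<forall>s. singular_simplex 1 X s \<longrightarrow> u s = g (s (edge_point 1)) - g (s (edge_point 0)))"

definition segment_simplex :: "real \<Rightarrow> real \<Rightarrow> (nat \<Rightarrow> real) \<Rightarrow> real" where
  "segment_simplex a b = restrict (\<lambda>x. (1 - x 1) * a + x 1 * b) (standard_simplex 1)"

lemma edge_point_in_simplex: "t \<in> {0..1} \<Longrightarrow> edge_point t \<in> standard_simplex 1"
  by (auto simp: edge_point_def standard_simplex_def)

lemma in_simplex_edge_point:
  assumes "x \<in> standard_simplex 1" shows "x = edge_point (x 1)" "x 1 \<in> {0..1}"
proof -
  have "x i = edge_point (x 1) i" for i
    using assms by (cases "i \<le> 1") (auto simp: edge_point_def standard_simplex_def le_Suc_eq)
  then show "x = edge_point (x 1)" by blast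
  show "x 1 \<in> {0..1}" using assms by (auto simp: standard_simplex_def)
qed

lemma edge_point_simps [simp]:
  "edge_point 0 = (\<lambda>i. if i = 0 then 1 else 0)"
  "edge_point 1 = (\<lambda>i. if i = 1 then 1 else 0)"
  "edge_point t (Suc 0) = t" "edge_point t 1 = t"
  by (auto simp: edge_point_def)

lemma continuous_map_edge_point:
  "continuous_map (top_of_set {0..1}) (subtopology (powertop_real UNIV) (standard_simplex 1)) edge_point"
proof -
  have "continuous_map (top_of_set {0..1}) euclideanreal (\<lambda>t. edge_point t i)" for i
    unfolding edge_point_def by (cases "i = 0"; cases "i = 1") (auto intro!: continuous_intros)
  then show ?thesis
    using edge_point_in_simplex
    by (auto simp: continuous_map_in_subtopology continuous_map_componentwise_UNIV)
qed

lemma continuous_map_simplex_coord: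
  "continuous_map (subtopology (powertop_real UNIV) (standard_simplex 1)) (top_of_set {0..1}) (\<lambda>x. x 1)"
  using in_simplex_edge_point
  by (auto simp: continuous_map_in_subtopology intro!: continuous_map_from_subtopology
      continuous_map_product_projection)

lemma singular_simplex_of_path:
  assumes "continuous_map (top_of_set {0..1}) X p"
  shows "singular_simplex 1 X (restrict (\<lambda>x. p (x 1)) (standard_simplex 1))"
  using continuous_map_compose[OF continuous_map_simplex_coord assms]
  by (simp add: singular_simplex_def comp_def)

lemma singular_simplex_path:
  assumes "singular_simplex 1 X s"
  shows "continuous_map (top_of_set {0..1}) X (\<lambda>t. s (edge_point t))"
  using continuous_map_compose[OF continuous_map_edge_point] assms
  by (fastforce simp: singular_simplex_def comp_def)

lemma restrict_path_eq:
  assumes "singular_simplex 1 X s"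
  shows "restrict (\<lambda>x. s (edge_point (x 1))) (standard_simplex 1) = s"
proof
  fix x show "restrict (\<lambda>x. s (edge_point (x 1))) (standard_simplex 1) x = s x"
  proof (cases "x \<in> standard_simplex 1")
    case True
    then show ?thesis using in_simplex_edge_point(1)[OF True] by simp
  next
    case False
    then show ?thesis using assms by (simp add: singular_simplex_def extensional_def)
  qed
qed

lemma singular_simplex_in_topspace:
  assumes "singular_simplex 1 X s" "t \<in> {0..1}"
  shows "s (edge_point t) \<in> topspace X"
  using singular_simplex_path[OF assms(1)] assms(2) by (auto simp: continuous_map_def)

lemma singular_face_edge:
  assumes "x \<in> standard_simplex 1" "k \<le> 2"
  shows "singular_face 2 k s x = s (simplical_face k x)"
  using assms by (simp add: singular_face_def numeral_2_eq_2)

lemma singular_simplex_face2: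
  "singular_simplex 2 X s \<Longrightarrow> k \<le> 2 \<Longrightarrow> singular_simplex 1 X (singular_face 2 k s)"
  using singular_simplex_singular_face[of 2 X s k] by simp

lemma simplex_map_face2:
  assumes "k \<le> 2"
  shows "singular_face 2 k (simplex_map 2 f s) = simplex_map 1 f (singular_face 2 k s)"
  using singular_face_simplex_map[of 2 k f s] assms
  by (auto simp: simplex_map_def singular_face_def restrict_def fun_eq_iff)

lemma cocycle1_pullback:
  assumes "cocycle1 X u" "continuous_map Y X f"
  shows "cocycle1 Y (\<lambda>s. u (simplex_map 1 f s))"
  unfolding cocycle1_def
proof (intro allI impI)
  fix s assume "singular_simplex 2 Y s"
  then have "singular_simplex 2 X (simplex_map 2 f s)"
    using assms(2) singular_simplex_simplex_map by blast
  with assms(1) have "u (singular_face 2 0 (simplex_map 2 f s)) - u (singular_face 2 1 (simplex_map 2 f s))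
      + u (singular_face 2 2 (simplex_map 2 f s)) = 0"
    unfolding cocycle1_def by blast
  then show "u (simplex_map 1 f (singular_face 2 0 s)) - u (simplex_map 1 f (singular_face 2 1 s)) +
           u (simplex_map 1 f (singular_face 2 2 s)) = 0"
    using simplex_map_face2[of 0 f s] simplex_map_face2[of 1 f s] simplex_map_face2[of 2 f s] by simp
qed

lemma cocycle1_diff:
  "cocycle1 X u \<Longrightarrow> cocycle1 X v \<Longrightarrow> cocycle1 X (\<lambda>s. u s - c * v s)"
proof -
  assume u: "cocycle1 X u" and v: "cocycle1 X v"
  have "(u0 - c * v0) - (u1 - c * v1) + (u2 - c * v2) = (u0 - u1 + u2) - c * (v0 - v1 + v2)"
    for u0 u1 u2 v0 v1 v2 :: complex
    by (simp add: algebra_simps)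
  with u v show ?thesis by (simp only: cocycle1_def) simp
qed

lemma cocycle1_subtopology: "cocycle1 X u \<Longrightarrow> cocycle1 (subtopology X S) u"
  by (simp add: cocycle1_def singular_simplex_subtopology)

lemma primitive_subset:
  "primitive (subtopology X S) u g \<Longrightarrow> T \<subseteq> S \<Longrightarrow> primitive (subtopology X T) u g"
  unfolding primitive_def by (meson singular_simplex_mono)

lemma primitive_diff:
  "primitive X u g \<Longrightarrow> primitive X v h \<Longrightarrow> primitive X (\<lambda>s. u s - c * v s) (\<lambda>x. g x - c * h x)"
  by (simp add: primitive_def right_diff_distrib del: edge_point_simps)

lemma primitive_add_const:
  "primitive X u g \<Longrightarrow> primitive X u (\<lambda>x. g x + c)"
  unfolding primitive_def by simp

lemma primitive_cong:
  assumes "primitive X u g" "\<And>x. x \<in> topspace X \<Longrightarrow> g x = h x"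
  shows "primitive X u h"
  using assms singular_simplex_in_topspace[of X _ 0] singular_simplex_in_topspace[of X _ 1]
  unfolding primitive_def by simp

subsubsection \<open>Evaluation on chains\<close>

text \<open>Pairing of complex cochains with the integral chains of singular homology; through it
  homotopy invariance of homology acts on cochains.\<close>

definition eval_chain :: "('s \<Rightarrow> complex) \<Rightarrow> ('s \<Rightarrow>\<^sub>0 int) \<Rightarrow> complex" where
  "eval_chain u c = (\<Sum>s\<in>Poly_Mapping.keys c. of_int (Poly_Mapping.lookup c s) * u s)"

lemma eval_chain_superset:
  assumes "finite K" "Poly_Mapping.keys c \<subseteq> K"
  shows "eval_chain u c = (\<Sum>s\<in>K. of_int (Poly_Mapping.lookup c s) * u s)"
  unfolding eval_chain_def using assms
  by (intro sum.mono_neutral_left) (auto simp: in_keys_iff)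

lemma eval_chain_add: "eval_chain u (a + b) = eval_chain u a + eval_chain u b"
proof -
  let ?K = "Poly_Mapping.keys a \<union> Poly_Mapping.keys b"
  have "Poly_Mapping.keys (a + b) \<subseteq> ?K" by (rule keys_add)
  then show ?thesis
    using eval_chain_superset[of ?K "a + b" u] eval_chain_superset[of ?K a u]
      eval_chain_superset[of ?K b u]
    by (simp add: lookup_add distrib_right sum.distrib)
qed

lemma eval_chain_of [simp]: "eval_chain u (frag_of s) = u s"
  by (simp add: eval_chain_def)

lemma eval_chain_zero [simp]: "eval_chain u 0 = 0"
  by (simp add: eval_chain_def)

lemma eval_chain_minus: "eval_chain u (- a) = - eval_chain u a"
  using eval_chain_add[of u a "- a"] by (simp add: add_eq_0_iff)

lemma eval_chain_diff: "eval_chain u (a - b) = eval_chain u a - eval_chain u b"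
  using eval_chain_add[of u a "- b"] by (simp add: eval_chain_minus)

lemma eval_chain_boundary:
  assumes u: "cocycle1 X u" and d: "singular_chain 2 X d"
  shows "eval_chain u (chain_boundary 2 d) = 0"
  using d[unfolded singular_chain_def]
proof (induction d rule: frag_induction)
  case zero
  then show ?case by simp
next
  case (one s)
  then have s: "singular_simplex 2 X s" by simp
  have "chain_boundary 2 (frag_of s) = frag_of (singular_face 2 0 s) - frag_of (singular_face 2 1 s)
      + frag_of (singular_face 2 2 s)"
    by (simp add: chain_boundary_of numeral_2_eq_2 frag_cmul_minus_one)
  then show ?case using u s by (simp add: eval_chain_add eval_chain_diff cocycle1_def)
next
  case (diff a b)
  then show ?case by (simp add: chain_boundary_diff eval_chain_diff)
qed

lemma chain_boundary_edge:
  "chain_boundary 1 (frag_of s) =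
     frag_of (restrict (\<lambda>x. s (edge_point 1)) (standard_simplex 0)) -
     frag_of (restrict (\<lambda>x. s (edge_point 0)) (standard_simplex 0))"
proof -
  have "singular_face 1 0 s = restrict (\<lambda>x. s (edge_point 1)) (standard_simplex 0)"
    by (auto simp: singular_face_def standard_simplex_0 simplical_face_def restrict_def fun_eq_iff
        intro!: arg_cong[of _ _ s])
  moreover have "singular_face 1 1 s = restrict (\<lambda>x. s (edge_point 0)) (standard_simplex 0)"
    by (auto simp: singular_face_def standard_simplex_0 simplical_face_def restrict_def fun_eq_iff
        intro!: arg_cong[of _ _ s])
  ultimately show ?thesis
    by (simp add: chain_boundary_of frag_cmul_minus_one)
qed

text \<open>All three faces of the constant triangle equal the constant edge, so the cocycle
  relation reads u - u + u = 0.\<close>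

lemma cocycle1_const:
  assumes "cocycle1 X u" "a \<in> topspace X"
  shows "u (restrict (\<lambda>x. a) (standard_simplex 1)) = 0"
proof -
  let ?s = "restrict (\<lambda>x. a) (standard_simplex 2)" and ?e = "restrict (\<lambda>x. a) (standard_simplex 1)"
  have s: "singular_simplex 2 X ?s"
    using assms(2) by (auto simp: singular_simplex_def)
  have "singular_face 2 k ?s = ?e" if "k \<le> 2" for k
    using that simplical_face_in_standard_simplex[of 2 k]
    by (auto simp: singular_face_def restrict_def fun_eq_iff)
  from this[of 0] this[of 1] this[of 2] have "singular_face 2 0 ?s = ?e" "singular_face 2 1 ?s = ?e"
      "singular_face 2 2 ?s = ?e" by simp_all
  moreover have "u (singular_face 2 0 ?s) - u (singular_face 2 1 ?s) + u (singular_face 2 2 ?s) = 0"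
    using assms(1) s unfolding cocycle1_def by blast
  ultimately show ?thesis by (simp only:) simp
qed

text \<open>The identity is homotopic to a constant map, so a cycle is homologous to its image under
  that map, which is a combination of constant edges. Cocycles vanish on boundaries and on constant
  edges.\<close>

lemma eval_chain_cycle_contractible:
  assumes X: "contractible_space X" and u: "cocycle1 X u"
    and c: "singular_chain 1 X c" "chain_boundary 1 c = 0"
  shows "eval_chain u c = 0"
proof (cases "X = trivial_topology")
  case True
  then have "c = 0" using c(1) by (simp add: singular_chain_empty)
  then show ?thesis by simp
next
  case False
  then have "topspace X \<noteq> {}" by simp
  then obtain a where a: "a \<in> topspace X" by blast
  then have hom: "homotopic_with (\<lambda>x. True) X X id (\<lambda>x. a)"
    using X[unfolded contractible_space_alt] by (rule bspec[rotated])
  have cyc: "singular_relcycle 1 X {} c" using c singular_cycle by blast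
  have "homologous_rel 1 X {} (chain_map 1 id c) (chain_map 1 (\<lambda>x. a) c)"
    using homotopic_imp_homologous_rel_chain_maps[of "{}" "{}" X X id "\<lambda>x. a" 1 c] hom cyc
    by (simp add: homotopic_with_mono)
  then obtain d where d: "singular_chain 2 X d"
      "chain_boundary 2 d = chain_map 1 id c - chain_map 1 (\<lambda>x. a) c"
    unfolding homologous_rel_def singular_boundary by (auto simp: numeral_2_eq_2)
  have "eval_chain u (chain_map 1 (\<lambda>x. a) c') = 0" for c' :: "'a chain"
  proof (rule frag_induction[of c' UNIV])
    fix s :: "(nat \<Rightarrow> real) \<Rightarrow> 'a"
    have "simplex_map 1 (\<lambda>x. a) s = restrict (\<lambda>x. a) (standard_simplex 1)"
      by (auto simp: simplex_map_def)
    then show "eval_chain u (chain_map 1 (\<lambda>x. a) (frag_of s)) = 0"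
      using cocycle1_const[OF u a] by simp
  qed (simp_all add: chain_map_diff eval_chain_diff)
  moreover have "chain_map 1 id c = c"
    using chain_map_id_gen[OF c(1), of id] by simp
  ultimately show ?thesis
    using eval_chain_boundary[OF u d(1)] d(2) by (simp add: eval_chain_diff)
qed

text \<open>Integration from a base point: the primitive at \<open>x\<close> is the value of
  \<open>u\<close> on a chosen path \<open>p x\<close> from \<open>a\<close> to \<open>x\<close>.
  The path to the start of an edge \<open>s\<close>, then \<open>s\<close>, then the path to its end
  taken backwards, form a cycle, on which \<open>u\<close> vanishes.\<close>

theorem primitive_on_contractible:
  assumes X: "contractible_space X" and u: "cocycle1 X u"
  shows "\<exists>g. primitive X u g"
proof (cases "X = trivial_topology")
  case True
  then have "primitive X u (\<lambda>x. 0)" by (simp add: primitive_def singular_simplex_empty)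
  then show ?thesis by blast
next
  case False
  then have "topspace X \<noteq> {}" by simp
  then obtain a where a: "a \<in> topspace X" by blast
  have "\<exists>s. singular_simplex 1 X s \<and> s (edge_point 0) = a \<and> s (edge_point 1) = x"
    if x: "x \<in> topspace X" for x
  proof -
    have "path_connected_space X" using X contractible_imp_path_connected_space by blast
    then obtain p where "pathin X p" "p 0 = a" "p 1 = x"
      using a x unfolding path_connected_space_def by blast
    then show ?thesis
      using singular_simplex_of_path[of X p] edge_point_in_simplex[of 0] edge_point_in_simplex[of 1]
      by (intro exI[of _ "restrict (\<lambda>x. p (x 1)) (standard_simplex 1)"])
        (auto simp: pathin_def)
  qed
  then obtain p where p: "\<And>x. x \<in> topspace X \<Longrightarrow>
      singular_simplex 1 X (p x) \<and> p x (edge_point 0) = a \<and> p x (edge_point 1) = x"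
    by metis
  have "u s = u (p (s (edge_point 1))) - u (p (s (edge_point 0)))" if s: "singular_simplex 1 X s" for s
  proof -
    define x y where "x = s (edge_point 0)" and "y = s (edge_point 1)"
    have xy: "x \<in> topspace X" "y \<in> topspace X"
      using singular_simplex_in_topspace[OF s, of 0] singular_simplex_in_topspace[OF s, of 1]
      by (auto simp: x_def y_def)
    let ?c = "frag_of s + frag_of (p x) - frag_of (p y)"
    have "singular_chain 1 X ?c"
      using s p xy by (simp add: singular_chain_add singular_chain_diff singular_chain_of)
    moreover have "chain_boundary 1 ?c = 0"
      unfolding chain_boundary_diff chain_boundary_add chain_boundary_edge
      using p[OF xy(1)] p[OF xy(2)] by (simp only: x_def[symmetric] y_def[symmetric]) simp
    ultimately have "eval_chain u ?c = 0" by (rule eval_chain_cycle_contractible[OF X u])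
    then show ?thesis
      by (simp add: eval_chain_add eval_chain_diff x_def y_def eq_diff_eq del: edge_point_simps)
  qed
  then have "primitive X u (\<lambda>x. u (p x))" by (simp only: primitive_def) blast
  then show ?thesis by blast
qed

lemma continuous_map_segment:
  fixes a b :: real
  assumes "a \<in> {0..1}" "b \<in> {0..1}"
  shows "continuous_map (top_of_set {0..1}) (top_of_set {0..1}) (\<lambda>t. (1 - t) * a + t * b)"
proof -
  have "(1 - t) * a + t * b \<in> {0..1}" if "t \<in> {0..1}" for t
    using convexD[of "{0..1}" a b "1 - t" t] assms that by (simp del: atLeastAtMost_iff)  simp
  then show ?thesis
    by (auto simp: image_subset_iff intro!: continuous_intros)
qed

text \<open>An edge may leave each of the sets \<open>N\<close>. Pulled back along the edge,
  \<open>u\<close> has a primitive \<open>h\<close> on the contractible interval; locality makes the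
  difference of \<open>h\<close> and the pulled-back \<open>g\<close> locally constant, hence
  constant.\<close>

theorem primitive_local:
  assumes u: "cocycle1 X u"
    and loc: "\<And>x. x \<in> topspace X \<Longrightarrow> \<exists>N. openin X N \<and> x \<in> N \<and> primitive (subtopology X N) u g"
  shows "primitive X u g"
  unfolding primitive_def
proof (intro allI impI)
  fix s assume s: "singular_simplex 1 X s"
  define p where "p = (\<lambda>t. s (edge_point t))"
  have p: "continuous_map (top_of_set {0..1}) X p"
    unfolding p_def by (rule singular_simplex_path[OF s])
  have "contractible_space (top_of_set {0..1::real})"
    using convex_imp_contractible[OF convex_real_interval(5)[of 0 1]]
    by (simp only: contractible_space_top_of_set)
  then obtain h where h: "primitive (top_of_set {0..1}) (\<lambda>s. u (simplex_map 1 p s)) h"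
    using primitive_on_contractible cocycle1_pullback[OF u p] by blast
  have seg: "singular_simplex 1 (top_of_set {0..1}) (segment_simplex a b)" if "a \<in> {0..1}" "b \<in> {0..1}" for a b
    using singular_simplex_of_path[OF continuous_map_segment[OF that]] unfolding segment_simplex_def .
  have seg_h: "u (simplex_map 1 p (segment_simplex a b)) = h b - h a" if "a \<in> {0..1}" "b \<in> {0..1}" for a b
    using h seg[OF that] edge_point_in_simplex[of 0] edge_point_in_simplex[of 1]
    unfolding primitive_def by (simp add: segment_simplex_def)
  have loc_const: "\<exists>e>0. \<forall>t'\<in>{0..1}. dist t' t < e \<longrightarrow> h t - g (p t) = h t' - g (p t')"
    if t: "t \<in> {0..1}" for t
  proof -
    have "p t \<in> topspace X" using p t by (auto simp: continuous_map_def)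
    then obtain N where N: "openin X N" "p t \<in> N" "primitive (subtopology X N) u g"
      using loc by blast
    have "openin (top_of_set {0..1}) {t \<in> {0..1}. p t \<in> N}"
      using p N(1) by (auto simp: continuous_map_def)
    then obtain e where e: "e > 0" "\<And>t'. t' \<in> {0..1} \<Longrightarrow> dist t' t < e \<Longrightarrow> p t' \<in> N"
      using t N(2) unfolding openin_euclidean_subtopology_iff by blast
    have "h t - g (p t) = h t' - g (p t')" if t': "t' \<in> {0..1}" "dist t' t < e" for t'
    proof -
      have mem: "(1 - x) * t + x * t' \<in> {0..1} \<and> dist ((1 - x) * t + x * t') t < e"
        if "x \<in> {0..1}" for x
        using convexD[of "{0..1} \<inter> ball t e" t t' "1 - x" x] that t t' e(1)
        by (simp add: convex_Int dist_commute del: atLeastAtMost_iff) simp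
      have "simplex_map 1 p (segment_simplex t t') ` standard_simplex 1 \<subseteq> N"
        using e(2) mem in_simplex_edge_point(2)
        by (auto simp: simplex_map_def segment_simplex_def)
      moreover have "singular_simplex 1 X (simplex_map 1 p (segment_simplex t t'))"
        by (rule singular_simplex_simplex_map[OF seg[OF t t'(1)] p])
      ultimately have "singular_simplex 1 (subtopology X N) (simplex_map 1 p (segment_simplex t t'))"
        by (simp add: singular_simplex_subtopology)
      then have "u (simplex_map 1 p (segment_simplex t t')) = g (p t') - g (p t)"
        using N(3) edge_point_in_simplex[of 0] edge_point_in_simplex[of 1]
        unfolding primitive_def by (simp add: segment_simplex_def simplex_map_def)
      then have "g (p t') - g (p t) = h t' - h t" using seg_h[OF t t'(1)] by simp
      then show ?thesis by (simp add: algebra_simps)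
    qed
    then show ?thesis using e(1) by blast
  qed
  have "h 0 - g (p 0) = h 1 - g (p 1)"
  proof (rule connected_local_const[where A = "{0..1::real}"])
    show "\<forall>t\<in>{0..1}. \<forall>\<^sub>F t' in at t within {0..1}. h t - g (p t) = h t' - g (p t')"
      using loc_const unfolding eventually_at by blast
  qed auto
  then have "g (p 1) - g (p 0) = h 1 - h 0"
    by (simp add: algebra_simps)
  moreover have "simplex_map 1 p (segment_simplex 0 1) =
      restrict (\<lambda>x. s (edge_point (x 1))) (standard_simplex 1)"
    by (auto simp: simplex_map_def segment_simplex_def p_def restrict_def fun_eq_iff)
  then have "simplex_map 1 p (segment_simplex 0 1) = s"
    by (simp only: restrict_path_eq[OF s])
  ultimately show "u s = g (s (edge_point 1)) - g (s (edge_point 0))"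
    using seg_h[of 0 1] by (simp add: p_def del: edge_point_simps)
qed

subsection \<open>Logarithmic differentials\<close>

text \<open>The integral of dq / q for a merely continuous path: the increment of a continuous
  logarithm. It is meaningful for continuous \<open>q\<close> without zeros, and then
  \<open>THE\<close> is justified by \<open>log_lifts_differ_const\<close>.\<close>

definition log_diff :: "(real \<Rightarrow> complex) \<Rightarrow> complex" where
  "log_diff q =
     (THE d. \<exists>l. continuous_on {0..1} l \<and> (\<forall>t\<in>{0..1}. q t = exp (l t)) \<and> d = l 1 - l 0)"

definition dlog :: "('a \<Rightarrow> complex) \<Rightarrow> ((nat \<Rightarrow> real) \<Rightarrow> 'a) \<Rightarrow> complex" where
  "dlog f s = log_diff (\<lambda>t. f (s (edge_point t)))"

text \<open>The difference of two logarithms takes values in 2 pi i Z, whose points are at least 2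
  pi apart; a continuous function with such a range on a connected set is constant.\<close>

lemma log_lifts_differ_const:
  fixes l l' :: "real \<Rightarrow> complex"
  assumes "continuous_on {0..1} l" "continuous_on {0..1} l'"
    and eq: "\<And>t. t \<in> {0..1} \<Longrightarrow> exp (l t) = exp (l' t)"
  shows "l 1 - l 0 = l' 1 - l' 0"
proof -
  have "(\<lambda>t. l t - l' t) constant_on {0..1}"
  proof (rule continuous_discrete_range_constant)
    show "continuous_on {0..1} (\<lambda>t. l t - l' t)" using assms by (intro continuous_intros)
    have "2 * pi \<le> norm ((l t' - l' t') - (l t - l' t))"
      if t: "t \<in> {0..1}" "t' \<in> {0..1}" and ne: "l t' - l' t' \<noteq> l t - l' t" for t t'
    proof -
      obtain m m' :: int where m: "l t = l' t + of_int (2 * m) * pi * \<i>"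
          "l t' = l' t' + of_int (2 * m') * pi * \<i>"
        using eq[OF t(1)] eq[OF t(2)] unfolding exp_eq by blast
      define k where "k = m' - m"
      have d: "(l t' - l' t') - (l t - l' t) = of_int (2 * k) * pi * \<i>"
        by (simp add: m k_def algebra_simps)
      have "k \<noteq> 0" using ne m by (auto simp: k_def)
      then have "1 \<le> \<bar>real_of_int k\<bar>" by linarith
      then have "2 * pi * 1 \<le> 2 * pi * \<bar>real_of_int k\<bar>"
        by (intro mult_left_mono) auto
      also have "\<dots> = norm (of_int (2 * k) * pi * \<i>)"
        by (simp add: norm_mult)
      finally show ?thesis unfolding d by simp
    qed
    then show "\<exists>e>0. \<forall>y. y \<in> {0..1} \<and> l y - l' y \<noteq> l x - l' x \<longrightarrow> e \<le> cmod (l y - l' y - (l x - l' x))"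
      if "x \<in> {0..1}" for x
      using that by (intro exI[of _ "2 * pi"]) auto
  qed auto
  then obtain c where "\<And>t. t \<in> {0..1} \<Longrightarrow> l t - l' t = c" unfolding constant_on_def by blast
  from this[of 0] this[of 1] have "l 0 - l' 0 = c" "l 1 - l' 1 = c" by auto
  then show ?thesis by (metis add_diff_add diff_add_cancel diff_diff_eq2 right_minus_eq)
qed

lemma log_diff_eq:
  assumes "continuous_on {0..1} l" "\<And>t. t \<in> {0..1} \<Longrightarrow> q t = exp (l t)"
  shows "log_diff q = l 1 - l 0"
  unfolding log_diff_def
proof (rule the_equality)
  show "\<exists>l'. continuous_on {0..1} l' \<and> (\<forall>t\<in>{0..1}. q t = exp (l' t)) \<and> l 1 - l 0 = l' 1 - l' 0"
    using assms by blast
  fix d assume "\<exists>l'. continuous_on {0..1} l' \<and> (\<forall>t\<in>{0..1}. q t = exp (l' t)) \<and> d = l' 1 - l' 0"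
  then obtain l' where l': "continuous_on {0..1} l'" "\<And>t. t \<in> {0..1} \<Longrightarrow> q t = exp (l' t)"
      "d = l' 1 - l' 0" by blast
  show "d = l 1 - l 0"
    unfolding l'(3) using l'(1) assms(1) by (rule log_lifts_differ_const) (metis assms(2) l'(2))
qed

lemma log_lift_exists:
  assumes "continuous_on {0..1::real} q" "\<And>t. t \<in> {0..1} \<Longrightarrow> q t \<noteq> 0"
  obtains l :: "real \<Rightarrow> complex" where "continuous_on {0..1} l" "\<And>t. t \<in> {0..1} \<Longrightarrow> q t = exp (l t)"
  using continuous_logarithm_on_contractible[OF assms(1) convex_imp_contractible assms(2)]
  by (metis convex_real_interval(5))

lemma log_diff_mult:
  assumes "continuous_on {0..1} q" "\<And>t. t \<in> {0..1} \<Longrightarrow> q t \<noteq> 0"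
    and "continuous_on {0..1} r" "\<And>t. t \<in> {0..1} \<Longrightarrow> r t \<noteq> 0"
  shows "log_diff (\<lambda>t. q t * r t) = log_diff q + log_diff r"
proof -
  obtain l where l: "continuous_on {0..1} l" "\<And>t. t \<in> {0..1} \<Longrightarrow> q t = exp (l t)"
    using log_lift_exists[OF assms(1,2)] by blast
  obtain m where m: "continuous_on {0..1} m" "\<And>t. t \<in> {0..1} \<Longrightarrow> r t = exp (m t)"
    using log_lift_exists[OF assms(3,4)] by blast
  have "log_diff (\<lambda>t. q t * r t) = (l 1 + m 1) - (l 0 + m 0)"
    by (rule log_diff_eq) (use l m in \<open>auto simp: exp_add intro!: continuous_intros\<close>)
  then show ?thesis using log_diff_eq[OF l] log_diff_eq[OF m] by simp
qed

lemma log_diff_const: "c \<noteq> 0 \<Longrightarrow> log_diff (\<lambda>t. c) = 0"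
  using log_diff_eq[of "\<lambda>t. Ln c" "\<lambda>t. c"] by (simp del: atLeastAtMost_iff)

lemma log_diff_cong: "(\<And>t. t \<in> {0..1} \<Longrightarrow> q t = r t) \<Longrightarrow> log_diff q = log_diff r"
  unfolding log_diff_def by simp

lemma dlog_simplex_map: "dlog f (simplex_map 1 g s) = dlog (\<lambda>x. f (g x)) s"
  unfolding dlog_def
proof (rule log_diff_cong)
  show "f (simplex_map 1 g s (edge_point t)) = f (g (s (edge_point t)))" if "t \<in> {0..1}" for t
    using edge_point_in_simplex[OF that] by (simp add: simplex_map_def)
qed

lemma continuous_on_along_simplex:
  fixes f :: "'a \<Rightarrow> complex"
  assumes "singular_simplex 1 X s" "continuous_map X euclidean f"
  shows "continuous_on {0..1} (\<lambda>t. f (s (edge_point t)))"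
  using continuous_map_compose[OF singular_simplex_path[OF assms(1)] assms(2)] by (simp add: comp_def)

lemma dlog_cong:
  assumes "singular_simplex 1 X s" "\<And>x. x \<in> topspace X \<Longrightarrow> f x = g x"
  shows "dlog f s = dlog g s"
  unfolding dlog_def using singular_simplex_in_topspace[OF assms(1)] assms(2)
  by (intro log_diff_cong) simp

lemma dlog_mult:
  assumes s: "singular_simplex 1 X s"
    and f: "continuous_map X euclidean f" "\<And>x. x \<in> topspace X \<Longrightarrow> f x \<noteq> 0"
    and g: "continuous_map X euclidean g" "\<And>x. x \<in> topspace X \<Longrightarrow> g x \<noteq> 0"
  shows "dlog (\<lambda>x. f x * g x) s = dlog f s + dlog g s"
  unfolding dlog_def
  using continuous_on_along_simplex[OF s] f g singular_simplex_in_topspace[OF s]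
  by (intro log_diff_mult) auto

lemma dlog_const: "c \<noteq> 0 \<Longrightarrow> dlog (\<lambda>x. c) s = 0"
  by (simp add: dlog_def log_diff_const)

lemma dlog_cmult:
  assumes "singular_simplex 1 X s" "continuous_map X euclidean f"
    "\<And>x. x \<in> topspace X \<Longrightarrow> f x \<noteq> 0" "c \<noteq> 0"
  shows "dlog (\<lambda>x. c * f x) s = dlog f s"
  using dlog_mult[OF assms(1) _ _ assms(2,3), of "\<lambda>x. c"] assms(4) by (simp add: dlog_const)

lemma primitive_dlog:
  assumes "continuous_map X euclidean l" "\<And>x. x \<in> topspace X \<Longrightarrow> f x = exp (l x)"
  shows "primitive X (dlog f) l"
  unfolding primitive_def dlog_def
proof (intro allI impI)
  fix s assume s: "singular_simplex 1 X s"
  show "log_diff (\<lambda>t. f (s (edge_point t))) = l (s (edge_point 1)) - l (s (edge_point 0))"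
    by (rule log_diff_eq)
      (use continuous_on_along_simplex[OF s assms(1)] singular_simplex_in_topspace[OF s] assms(2) in auto)
qed

text \<open>The lift of the logarithm exists on a whole 2-simplex, which is contractible; it is computed
  in the chart \<open>c\<close> of the standard simplex by a triangle in the plane.\<close>

theorem cocycle1_dlog:
  assumes f: "continuous_map X euclidean f" "\<And>x. x \<in> topspace X \<Longrightarrow> f x \<noteq> 0"
  shows "cocycle1 X (dlog f)"
  unfolding cocycle1_def
proof (intro allI impI)
  fix s assume s: "singular_simplex 2 X s"
  define T where "T = {z :: real \<times> real. 0 \<le> fst z \<and> 0 \<le> snd z \<and> fst z + snd z \<le> 1}"
  define c where "c = (\<lambda>(z :: real \<times> real) (i::nat). if i = 0 then 1 - fst z - snd z else if i = 1 then fst z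
    else if i = 2 then snd z else 0)"
  have cT: "c z \<in> standard_simplex 2" if "z \<in> T" for z
    using that by (auto simp: c_def T_def standard_simplex_def numeral_2_eq_2)
  have "continuous_map (top_of_set T) euclideanreal (\<lambda>z. c z i)" for i
    unfolding c_def by (cases "i = 0"; cases "i = 1"; cases "i = 2") (auto intro!: continuous_intros)
  then have "continuous_map (top_of_set T) (subtopology (powertop_real UNIV) (standard_simplex 2)) c"
    using cT by (auto simp: continuous_map_in_subtopology continuous_map_componentwise_UNIV)
  moreover have "continuous_map (subtopology (powertop_real UNIV) (standard_simplex 2)) X s"
    using s by (simp add: singular_simplex_def)
  ultimately have sc: "continuous_map (top_of_set T) X (s \<circ> c)"
    using continuous_map_compose by blast
  have conv: "convex T"
  proof -
    have "T = {z. inner (-1, 0) z \<le> 0} \<inter> {z. inner (0, -1) z \<le> 0} \<inter> {z. inner (1, 1) z \<le> 1}"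
      by (auto simp: T_def inner_prod_def)
    then show ?thesis by (simp add: convex_Int convex_halfspace_le)
  qed
  have "continuous_on T (\<lambda>z. f (s (c z)))"
    using continuous_map_compose[OF sc f(1)] by (simp add: comp_def)
  moreover have "f (s (c z)) \<noteq> 0" if "z \<in> T" for z
    using sc that f(2) by (auto simp: continuous_map_def Pi_iff)
  ultimately obtain l where l: "continuous_on T l" "\<And>z. z \<in> T \<Longrightarrow> f (s (c z)) = exp (l z)"
    using continuous_logarithm_on_contractible[OF _ convex_imp_contractible[OF conv]] by metis
  have face: "dlog f (singular_face 2 k s) = l (p 1) - l (p 0)"
    if k: "k \<le> 2" and p: "continuous_on {0..1} p" "\<And>t. t \<in> {0..1} \<Longrightarrow> p t \<in> T"
      "\<And>t. t \<in> {0..1} \<Longrightarrow> simplical_face k (edge_point t) = c (p t)" for k p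
    unfolding dlog_def
  proof (rule log_diff_eq)
    show "continuous_on {0..1} (\<lambda>t. l (p t))"
      using p(2) by (intro continuous_on_compose2[OF l(1) p(1)]) blast
    show "f (singular_face 2 k s (edge_point t)) = exp (l (p t))" if "t \<in> {0..1}" for t
      using singular_face_edge[OF edge_point_in_simplex[OF that] k, of s] p(2,3)[OF that] l(2) by simp
  qed
  \<comment> \<open>In the chart, these are the sides opposite the vertices 0, 1 and 2. The
    alternating sum of the increments of \<open>l\<close> along them telescopes.\<close>
  define p0 p1 p2 :: "real \<Rightarrow> real \<times> real"
    where "p0 = (\<lambda>t. (1 - t, t))" and "p1 = (\<lambda>t. (0, t))" and "p2 = (\<lambda>t. (t, 0))"
  note defs = p0_def p1_def p2_def
  have c: "simplical_face 0 (edge_point t) = c (p0 t)" "simplical_face 1 (edge_point t) = c (p1 t)"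
      "simplical_face 2 (edge_point t) = c (p2 t)" for t
    by (auto simp: fun_eq_iff simplical_face_def edge_point_def c_def defs)
  have cont: "continuous_on {0..1} p0" "continuous_on {0..1} p1" "continuous_on {0..1} p2"
    unfolding defs by (intro continuous_intros)+
  have inT: "p0 t \<in> T" "p1 t \<in> T" "p2 t \<in> T" if "t \<in> {0..1}" for t
    using that by (auto simp: defs T_def)
  have "dlog f (singular_face 2 0 s) = l (p0 1) - l (p0 0)" by (rule face) (use cont inT c in auto)
  moreover have "dlog f (singular_face 2 1 s) = l (p1 1) - l (p1 0)"
    by (rule face) (use cont inT c in auto)
  moreover have "dlog f (singular_face 2 2 s) = l (p2 1) - l (p2 0)"
    by (rule face) (use cont inT c in auto)
  ultimately show "dlog f (singular_face 2 0 s) - dlog f (singular_face 2 1 s) +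
      dlog f (singular_face 2 2 s) = 0" by (simp add: defs)
qed

subsection \<open>Cocycles on the complement of a hyperplane arrangement\<close>

text \<open>\<open>J\<close> plays the role of multiplication by the imaginary unit.\<close>

locale complex_arrangement =
  fixes A :: "'i set" and \<alpha> :: "'i \<Rightarrow> 'a::real_normed_vector \<Rightarrow> complex" and J :: "'a \<Rightarrow> 'a"
  assumes finite_A: "finite A"
    and linear_form: "i \<in> A \<Longrightarrow> bounded_linear (\<alpha> i)"
    and form_J: "i \<in> A \<Longrightarrow> \<alpha> i (J x) = \<i> * \<alpha> i x"
    and complement_nonempty: "\<exists>x. \<forall>i\<in>A. \<alpha> i x \<noteq> 0"
begin

definition D :: "'a set" where
  "D = {x. \<forall>i\<in>A. \<alpha> i x \<noteq> 0}"

text \<open>The complex line a + z (b - a), with \<open>J\<close> supplying multiplication by i.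
  Unlike a real line it stays connected after removal of finitely many points.\<close>

definition cline :: "'a \<Rightarrow> 'a \<Rightarrow> complex \<Rightarrow> 'a" where
  "cline a b z = a + (Re z *\<^sub>R (b - a) + Im z *\<^sub>R J (b - a))"

text \<open>\<open>S\<close> may meet the hyperplanes: the primitive is asked for on
  \<open>D \<inter> S\<close>, where the cocycle lives.\<close>

definition prim :: "(((nat \<Rightarrow> real) \<Rightarrow> 'a) \<Rightarrow> complex) \<Rightarrow> 'a set \<Rightarrow> ('a \<Rightarrow> complex) \<Rightarrow> bool" where
  "prim u S g \<longleftrightarrow> primitive (top_of_set (D \<inter> S)) u g"

definition exact_on :: "(((nat \<Rightarrow> real) \<Rightarrow> 'a) \<Rightarrow> complex) \<Rightarrow> 'a set \<Rightarrow> bool" where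
  "exact_on u S \<longleftrightarrow> (\<exists>g. prim u S g)"

lemma form_cline:
  assumes "i \<in> A" shows "\<alpha> i (cline a b z) = \<alpha> i a + z * (\<alpha> i b - \<alpha> i a)"
proof -
  interpret bounded_linear "\<alpha> i" by (rule linear_form[OF assms])
  have "\<alpha> i (cline a b z) = \<alpha> i a + (complex_of_real (Re z) + \<i> * complex_of_real (Im z)) * (\<alpha> i b - \<alpha> i a)"
    unfolding cline_def
    by (simp add: add scale form_J[OF assms] diff scaleR_conv_of_real) (simp add: algebra_simps)
  then show ?thesis by (simp only: complex_eq[symmetric])
qed

lemma cline_simps [simp]: "cline a b 0 = a" "cline a b 1 = b"
  by (simp_all add: cline_def)

lemma continuous_cline: "continuous_on UNIV (cline a b)"
  unfolding cline_def by (intro continuous_intros)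

lemma continuous_form: "i \<in> A \<Longrightarrow> continuous_on S (\<alpha> i)"
  using linear_form by (simp add: linear_continuous_on)

text \<open>On the line a form is a polynomial in z of degree at most 1; being nonzero at z = 0 or z
  = 1, it has at most one zero.\<close>

lemma finite_zeros_cline:
  assumes "B \<subseteq> A" "\<And>i. i \<in> B \<Longrightarrow> \<alpha> i a \<noteq> 0 \<or> \<alpha> i b \<noteq> 0"
  shows "finite {z. \<exists>i\<in>B. \<alpha> i (cline a b z) = 0}"
proof -
  have "finite {z. \<alpha> i (cline a b z) = 0}" if i: "i \<in> B" for i
  proof -
    have "{z. \<alpha> i (cline a b z) = 0} \<subseteq> {- \<alpha> i a / (\<alpha> i b - \<alpha> i a)}"
    proof
      fix z assume "z \<in> {z. \<alpha> i (cline a b z) = 0}"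
      then have z: "\<alpha> i a + z * (\<alpha> i b - \<alpha> i a) = 0" using form_cline i assms(1) by auto
      then have "\<alpha> i b - \<alpha> i a \<noteq> 0" using assms(2)[OF i] by auto
      moreover have "z * (\<alpha> i b - \<alpha> i a) = - \<alpha> i a" using z by (simp add: add_eq_0_iff)
      ultimately have "z = - \<alpha> i a / (\<alpha> i b - \<alpha> i a)" by (subst eq_divide_eq) simp
      then show "z \<in> {- \<alpha> i a / (\<alpha> i b - \<alpha> i a)}" by blast
    qed
    then show ?thesis using finite_subset by blast
  qed
  moreover have "{z. \<exists>i\<in>B. \<alpha> i (cline a b z) = 0} = (\<Union>i\<in>B. {z. \<alpha> i (cline a b z) = 0})" by blast
  ultimately show ?thesis using finite_subset[OF assms(1) finite_A] by simp
qed

text \<open>The parameters with value in \<open>S\<close> form an open convex subset of the plane,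
  from which finitely many points are removed.\<close>

lemma path_connected_cline:
  assumes "open S" "convex S" "B \<subseteq> A" "\<And>i. i \<in> B \<Longrightarrow> \<alpha> i a \<noteq> 0"
  shows "path_connected {z. cline a b z \<in> S \<and> (\<forall>i\<in>B. \<alpha> i (cline a b z) \<noteq> 0)}"
proof -
  let ?U = "cline a b -` S"
  have "open ?U" using open_vimage[OF assms(1) continuous_cline] .
  moreover have "convex ?U"
  proof (rule convexI)
    fix x y :: complex and u v :: real
    assume "x \<in> ?U" "y \<in> ?U" and uv: "0 \<le> u" "0 \<le> v" "u + v = 1"
    then have "u *\<^sub>R cline a b x + v *\<^sub>R cline a b y \<in> S" using assms(2) by (auto intro: convexD)
    also have "u *\<^sub>R cline a b x + v *\<^sub>R cline a b y = (u + v) *\<^sub>R a +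
        ((u * Re x + v * Re y) *\<^sub>R (b - a) + (u * Im x + v * Im y) *\<^sub>R J (b - a))"
      unfolding cline_def by (simp add: scaleR_add_left scaleR_add_right)
    also have "\<dots> = cline a b (u *\<^sub>R x + v *\<^sub>R y)" using uv by (simp add: cline_def)
    finally show "u *\<^sub>R x + v *\<^sub>R y \<in> ?U" by simp
  qed
  then have "connected ?U" by (rule convex_connected)
  moreover have "countable {z. \<exists>i\<in>B. \<alpha> i (cline a b z) = 0}"
    using finite_zeros_cline[OF assms(3)] assms(4) by (intro countable_finite) blast
  ultimately have "path_connected (?U - {z. \<exists>i\<in>B. \<alpha> i (cline a b z) = 0})"
    by (intro path_connected_open_diff_countable) auto
  moreover have "?U - {z. \<exists>i\<in>B. \<alpha> i (cline a b z) = 0} =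
      {z. cline a b z \<in> S \<and> (\<forall>i\<in>B. \<alpha> i (cline a b z) \<noteq> 0)}" by auto
  ultimately show ?thesis by simp
qed

lemma joined_in_D:
  assumes S: "open S" "convex S" and ab: "a \<in> D \<inter> S" "b \<in> D \<inter> S"
  shows "\<exists>s. singular_simplex 1 (top_of_set (D \<inter> S)) s \<and> s (edge_point 0) = a \<and> s (edge_point 1) = b"
proof -
  let ?Z = "{z. cline a b z \<in> S \<and> (\<forall>i\<in>A. \<alpha> i (cline a b z) \<noteq> 0)}"
  have "path_connected ?Z"
    using path_connected_cline[OF S subset_refl] ab(1) by (auto simp: D_def)
  moreover have "0 \<in> ?Z" "1 \<in> ?Z" using ab by (auto simp: D_def)
  ultimately obtain p where p: "path p" "path_image p \<subseteq> ?Z" "pathstart p = 0" "pathfinish p = 1"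
    unfolding path_connected_def by blast
  let ?q = "\<lambda>t. cline a b (p t)"
  have "continuous_on {0..1} ?q"
    using continuous_on_compose2[OF continuous_cline] p(1) unfolding path_def by blast
  moreover have "?q t \<in> D \<inter> S" if "t \<in> {0..1}" for t
  proof -
    have "p t \<in> ?Z" using p(2) that unfolding path_image_def by blast
    then show ?thesis by (simp add: D_def)
  qed
  ultimately have "continuous_map (top_of_set {0..1}) (top_of_set (D \<inter> S)) ?q" by auto
  from singular_simplex_of_path[OF this] show ?thesis
    using p(3,4) edge_point_in_simplex[of 0] edge_point_in_simplex[of 1]
    by (intro exI[of _ "restrict (\<lambda>x. ?q (x 1)) (standard_simplex 1)"])
      (auto simp: pathstart_def pathfinish_def)
qed

text \<open>Along a complex line through \<open>a\<close> and \<open>b\<close>, these points are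
  joined by an edge inside \<open>D \<inter> S\<close>, and both primitives have the same increment
  on it.\<close>

lemma prim_unique:
  assumes "open S" "convex S" "prim u S g" "prim u S h" "a \<in> D \<inter> S" "b \<in> D \<inter> S"
  shows "g a - h a = g b - h b"
proof -
  obtain s where s: "singular_simplex 1 (top_of_set (D \<inter> S)) s"
      "s (edge_point 0) = a" "s (edge_point 1) = b"
    using joined_in_D[OF assms(1,2,5,6)] by blast
  then have "g b - g a = h b - h a" using assms(3,4) unfolding prim_def primitive_def by metis
  then show ?thesis by (simp add: algebra_simps)
qed

lemma prim_subset: "prim u S g \<Longrightarrow> T \<subseteq> S \<Longrightarrow> prim u T g"
  unfolding prim_def by (rule primitive_subset) auto

lemma prim_cong: "prim u S g \<Longrightarrow> (\<And>x. x \<in> D \<inter> S \<Longrightarrow> g x = h x) \<Longrightarrow> prim u S h"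
  using primitive_cong[of "top_of_set (D \<inter> S)" u g h] by (simp add: prim_def)

lemma prim_add_const: "prim u S g \<Longrightarrow> prim u S (\<lambda>x. g x + c)"
  unfolding prim_def by (rule primitive_add_const)

lemma prim_diff: "prim u S g \<Longrightarrow> prim v S h \<Longrightarrow> prim (\<lambda>s. u s - c * v s) S (\<lambda>x. g x - c * h x)"
  unfolding prim_def by (rule primitive_diff)

lemma prim_local:
  assumes u: "cocycle1 (top_of_set D) u"
    and loc: "\<And>x. x \<in> D \<inter> S \<Longrightarrow> \<exists>T. open T \<and> x \<in> T \<and> prim u (S \<inter> T) g"
  shows "prim u S g"
  unfolding prim_def
proof (rule primitive_local)
  show "cocycle1 (top_of_set (D \<inter> S)) u"
    using cocycle1_subtopology[OF u, of S] by (simp add: subtopology_subtopology)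
  fix x assume "x \<in> topspace (top_of_set (D \<inter> S))"
  then obtain T where T: "open T" "x \<in> D \<inter> S \<inter> T" "prim u (S \<inter> T) g" using loc by auto
  then have "primitive (subtopology (top_of_set (D \<inter> S)) (D \<inter> S \<inter> T)) u g"
    by (simp add: subtopology_subtopology prim_def Int_assoc Int_left_absorb Int_left_commute)
  then show "\<exists>N. openin (top_of_set (D \<inter> S)) N \<and> x \<in> N \<and>
      primitive (subtopology (top_of_set (D \<inter> S)) N) u g"
    using T(1,2) by (intro exI[of _ "D \<inter> S \<inter> T"]) (simp add: openin_open_Int)
qed

lemma exact_on_subset: "exact_on u S \<Longrightarrow> T \<subseteq> S \<Longrightarrow> exact_on u T"
  unfolding exact_on_def using prim_subset by blast

lemma exact_on_diff: "exact_on u S \<Longrightarrow> exact_on v S \<Longrightarrow> exact_on (\<lambda>s. u s - c * v s) S"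
  unfolding exact_on_def using prim_diff by blast

text \<open>The overlap is convex again, so the two primitives differ there by a single constant,
  which is absorbed into one of them.\<close>

lemma exact_on_Un:
  assumes u: "cocycle1 (top_of_set D) u"
    and S: "open S" "convex S" "exact_on u S" and T: "open T" "convex T" "exact_on u T"
  shows "exact_on u (S \<union> T)"
proof -
  obtain g h where g: "prim u S g" and h: "prim u T h" using S(3) T(3) by (auto simp: exact_on_def)
  have "\<exists>c. \<forall>x\<in>D \<inter> (S \<inter> T). g x = h x + c"
  proof (cases "D \<inter> (S \<inter> T) = {}")
    case False
    then obtain z where z: "z \<in> D \<inter> (S \<inter> T)" by blast
    have "g x = h x + (g z - h z)" if "x \<in> D \<inter> (S \<inter> T)" for x
      using prim_unique[of "S \<inter> T" u g h x z] that z S(1,2) T(1,2) g h prim_subset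
      by (simp add: convex_Int open_Int algebra_simps)
    then show ?thesis by blast
  qed auto
  then obtain c where c: "\<And>x. x \<in> D \<inter> (S \<inter> T) \<Longrightarrow> g x = h x + c" by blast
  let ?f = "\<lambda>x. if x \<in> S then g x else h x + c"
  have fS: "prim u S ?f" by (rule prim_cong[OF g]) auto
  have fT: "prim u T ?f" by (rule prim_cong[OF prim_add_const[OF h]]) (use c in auto)
  have "prim u (S \<union> T) ?f"
  proof (rule prim_local[OF u])
    fix x assume "x \<in> D \<inter> (S \<union> T)"
    then consider "x \<in> S" | "x \<in> T" by blast
    then show "\<exists>N. open N \<and> x \<in> N \<and> prim u ((S \<union> T) \<inter> N) ?f"
    proof cases
      case 1
      then show ?thesis using S(1) prim_subset[OF fS] by blast
    next
      case 2
      then show ?thesis using T(1) prim_subset[OF fT] by blast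
    qed
  qed
  then show ?thesis unfolding exact_on_def by blast
qed

section \<open>Primitives near segments and on convex sets\<close>

definition tube :: "'a \<Rightarrow> 'a \<Rightarrow> real \<Rightarrow> real \<Rightarrow> real \<Rightarrow> 'a set" where
  "tube x y a b r = (\<Union>t\<in>{a..b}. ball (linepath x y t) r)"

lemma open_tube: "open (tube x y a b r)"
  by (auto simp: tube_def)

text \<open>A convex combination of points near the segment is near the same combination of their
  centres. Convexity is what lets adjacent tubes be glued by \<open>exact_on_Un\<close>.\<close>

lemma convex_tube: "convex (tube x y a b r)"
proof (rule convexI)
  fix v w :: 'a and c d :: real
  assume "v \<in> tube x y a b r" "w \<in> tube x y a b r" and lm: "0 \<le> c" "0 \<le> d" "c + d = 1"
  then obtain s t where st: "s \<in> {a..b}" "t \<in> {a..b}"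
      "dist (linepath x y s) v < r" "dist (linepath x y t) w < r"
    by (auto simp: tube_def)
  let ?t = "c * s + d * t"
  have 1: "?t \<in> {a..b}" using convexD[of "{a..b}" s t c d] st lm by simp
  have "linepath x y ?t = c *\<^sub>R linepath x y s + d *\<^sub>R linepath x y t"
  proof -
    have "c *\<^sub>R linepath x y s + d *\<^sub>R linepath x y t = ((c + d) - ?t) *\<^sub>R x + ?t *\<^sub>R y"
      unfolding linepath_def by (simp add: algebra_simps)
    then show ?thesis by (simp add: lm linepath_def)
  qed
  then have "linepath x y ?t - (c *\<^sub>R v + d *\<^sub>R w) =
      c *\<^sub>R (linepath x y s - v) + d *\<^sub>R (linepath x y t - w)"
    by (simp add: algebra_simps)
  also have "\<dots> \<in> ball 0 r"
    using st(3,4) by (intro convexD[OF convex_ball _ _ lm]) (simp_all add: dist_norm norm_minus_commute)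
  finally have "c *\<^sub>R v + d *\<^sub>R w \<in> ball (linepath x y ?t) r"
    by (simp add: dist_norm norm_minus_commute)
  then show "c *\<^sub>R v + d *\<^sub>R w \<in> tube x y a b r"
    unfolding tube_def using 1 by blast
qed

text \<open>Bisection: exactness on some tube holds over all short parameter intervals, and it
  passes from two adjacent intervals to their union with the smaller of the two radii.\<close>

lemma exact_on_tube:
  assumes u: "cocycle1 (top_of_set D) u"
    and loc: "\<And>c. c \<in> closed_segment x y \<Longrightarrow> \<exists>e>0. exact_on u (ball c e)"
  shows "\<exists>r>0. exact_on u (tube x y 0 1 r)"
proof (rule Bolzano[where P = "\<lambda>a b. \<exists>r>0. exact_on u (tube x y a b r)"])
  fix a b c :: real
  assume "\<exists>r>0. exact_on u (tube x y a b r)" "\<exists>r>0. exact_on u (tube x y b c r)"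
    and abc: "a \<le> b" "b \<le> c"
  then obtain r r' where r: "r > 0" "exact_on u (tube x y a b r)"
      "r' > 0" "exact_on u (tube x y b c r')" by blast
  let ?r = "min r r'"
  have "{a..c} = {a..b} \<union> {b..c}" using abc by auto
  then have "tube x y a c ?r = tube x y a b ?r \<union> tube x y b c ?r"
    by (simp add: tube_def UN_Un)
  moreover have "tube x y a b ?r \<subseteq> tube x y a b r" "tube x y b c ?r \<subseteq> tube x y b c r'"
    by (auto simp: tube_def)
  then have "exact_on u (tube x y a b ?r)" "exact_on u (tube x y b c ?r)"
    using r(2,4) exact_on_subset by blast+
  ultimately have "exact_on u (tube x y a c ?r)"
    using exact_on_Un[OF u open_tube convex_tube _ open_tube convex_tube] by simp
  then show "\<exists>r>0. exact_on u (tube x y a c r)" using r(1,3) by (intro exI[of _ ?r]) simp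
next
  fix t :: real assume t: "0 \<le> t" "t \<le> 1"
  have "linepath x y t \<in> closed_segment x y" using t linepath_in_path[of t x y] by simp
  then obtain e where e: "e > 0" "exact_on u (ball (linepath x y t) e)" using loc by blast
  have "isCont (linepath x y) t" by (rule continuous_linepath_at)
  then obtain d where d: "d > 0" "\<And>s. dist s t < d \<Longrightarrow> dist (linepath x y s) (linepath x y t) < e / 2"
    using e(1) half_gt_zero[OF e(1)] unfolding continuous_at_eps_delta by blast
  have "exact_on u (tube x y a b (e / 2))" if ab: "a \<le> t \<and> t \<le> b \<and> b - a < d" for a b
  proof (rule exact_on_subset[OF e(2)], rule subsetI)
    fix z assume "z \<in> tube x y a b (e / 2)"
    then obtain s where s: "s \<in> {a..b}" "dist (linepath x y s) z < e / 2"
      by (auto simp: tube_def)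
    have "dist (linepath x y s) (linepath x y t) < e / 2"
      using d(2)[of s] s(1) ab by (simp add: dist_real_def abs_if)
    then have "dist (linepath x y t) z < e"
      using s(2) dist_triangle[of "linepath x y t" z "linepath x y s"] by (simp add: dist_commute)
    then show "z \<in> ball (linepath x y t) e" by simp
  qed
  then show "\<exists>d>0. \<forall>a b. a \<le> t \<and> t \<le> b \<and> b - a < d \<longrightarrow> (\<exists>r>0. exact_on u (tube x y a b r))"
    using d(1) e(1) by (meson half_gt_zero)
qed simp

text \<open>Integration along straight segments from a base point \<open>a\<close>. On a tube around
  the segment to \<open>y\<close> there is a primitive \<open>G y\<close> that vanishes at
  \<open>a\<close>; the global one takes the value \<open>G y y\<close>. If \<open>y\<close> lies in
  the tube of \<open>x\<close>, then \<open>G x\<close> and \<open>G y\<close> agree at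
  \<open>y\<close>, because the intersection of the two tubes is convex and contains both
  \<open>a\<close> and \<open>y\<close>.\<close>

theorem exact_on_convex:
  assumes u: "cocycle1 (top_of_set D) u" and W: "convex W"
    and loc: "\<And>x. x \<in> W \<Longrightarrow> \<exists>e>0. exact_on u (ball x e)"
  shows "exact_on u W"
proof (cases "D \<inter> W = {}")
  case True
  then have "prim u W (\<lambda>x. 0)"
    by (simp add: prim_def primitive_def singular_simplex_empty)
  then show ?thesis by (auto simp: exact_on_def)
next
  case False
  then obtain a where a: "a \<in> D" "a \<in> W" by blast
  have "\<exists>r>0. \<exists>g. prim u (tube a y 0 1 r) g \<and> g a = 0" if "y \<in> W" for y
  proof -
    have "closed_segment a y \<subseteq> W" using closed_segment_subset[OF a(2) that W] .
    then obtain r where "r > 0" "exact_on u (tube a y 0 1 r)" using exact_on_tube[OF u] loc by blast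
    moreover from this(2) obtain g where "prim u (tube a y 0 1 r) g" by (auto simp: exact_on_def)
    then have "prim u (tube a y 0 1 r) (\<lambda>x. g x + - g a)" by (rule prim_add_const)
    ultimately show ?thesis by (intro exI[of _ r] conjI exI[of _ "\<lambda>x. g x + - g a"]) auto
  qed
  then obtain r G where rG: "\<And>y. y \<in> W \<Longrightarrow> r y > 0 \<and> prim u (tube a y 0 1 (r y)) (G y) \<and> G y a = 0"
    by metis
  have in_tube: "a \<in> tube a y 0 1 (r y)" "y \<in> tube a y 0 1 (r y)" if "y \<in> W" for y
    using rG[OF that] by (auto simp: tube_def linepath_0' linepath_1' intro: bexI[of _ 0] bexI[of _ 1])
  have "prim u W (\<lambda>y. G y y)"
  proof (rule prim_local[OF u])
    fix x assume x: "x \<in> D \<inter> W"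
    let ?T = "tube a x 0 1 (r x)"
    have "prim u (W \<inter> ?T) (\<lambda>y. G y y)"
    proof (rule prim_cong)
      show "prim u (W \<inter> ?T) (G x)" using rG x prim_subset by blast
      fix y assume y: "y \<in> D \<inter> (W \<inter> ?T)"
      let ?S = "tube a y 0 1 (r y) \<inter> ?T"
      have "G y y - G x y = G y a - G x a"
      proof (rule prim_unique[of ?S])
        show "open ?S" "convex ?S" by (simp_all add: open_Int open_tube convex_Int convex_tube)
        show "prim u ?S (G y)" "prim u ?S (G x)" using rG x y prim_subset by blast+
        show "y \<in> D \<inter> ?S" "a \<in> D \<inter> ?S" using in_tube x y a by auto
      qed
      then show "G x y = G y y" using rG x y by simp
    qed
    then show "\<exists>T. open T \<and> x \<in> T \<and> prim u (W \<inter> T) (\<lambda>y. G y y)"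
      using open_tube in_tube(2)[of x] x by (intro exI[of _ ?T]) simp
  qed
  then show ?thesis by (auto simp: exact_on_def)
qed

section \<open>Monodromy around one hyperplane\<close>

text \<open>For j = 0, 1, 2, 3 these are the half-spaces where the form has positive real part,
  positive imaginary part, negative real part, negative imaginary part. They are convex, cover the
  complement of the hyperplane, and consecutive ones overlap in a quadrant.\<close>

definition sector :: "'i \<Rightarrow> nat \<Rightarrow> 'a set" where
  "sector k j = {x. 0 < Re ((- \<i>) ^ j * \<alpha> k x)}"

text \<open>The ambiguity of a primitive that is continued counterclockwise around the hyperplane
  \<open>\<alpha> k = 0\<close>, through the four sectors and back to the first.\<close>

definition monodromy :: "(((nat \<Rightarrow> real) \<Rightarrow> 'a) \<Rightarrow> complex) \<Rightarrow> 'i \<Rightarrow> 'a set \<Rightarrow> complex \<Rightarrow> bool" where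
  "monodromy u k S m \<longleftrightarrow> (\<exists>g. (\<forall>j\<le>4. prim u (S \<inter> sector k j) (g j)) \<and>
     (\<forall>j<4. \<forall>x\<in>D \<inter> (S \<inter> sector k j \<inter> sector k (Suc j)). g (Suc j) x = g j x) \<and>
     (\<forall>x\<in>D \<inter> (S \<inter> sector k 0). g 4 x = g 0 x + m))"

lemma sector_4: "sector k 4 = sector k 0"
  by (simp add: sector_def)

lemma open_sector: "k \<in> A \<Longrightarrow> open (sector k j)"
  unfolding sector_def
  by (intro open_Collect_less continuous_intros continuous_form) auto

lemma sector_nonzero: "x \<in> sector k j \<Longrightarrow> \<alpha> k x \<noteq> 0"
  by (auto simp: sector_def)

lemma convex_sector:
  assumes "k \<in> A" shows "convex (sector k j)"
proof -
  interpret bounded_linear "\<alpha> k" by (rule linear_form[OF assms])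
  have "linear (\<lambda>x. Re ((- \<i>) ^ j * \<alpha> k x))"
    by (rule linearI) (simp_all add: add scale algebra_simps)
  from convex_linear_vimage[OF this convex_real_interval(3), of 0] show ?thesis
    by (simp add: sector_def vimage_def greaterThan_def)
qed

text \<open>On the complex line from \<open>x\<close> to a point off all hyperplanes, only finitely
  many points are outside \<open>D\<close>, whereas the parameters with value in \<open>S\<close>
  form a nonempty open set.\<close>

lemma D_dense:
  assumes "open S" "x \<in> S" shows "D \<inter> S \<noteq> {}"
proof -
  obtain d where d: "\<And>i. i \<in> A \<Longrightarrow> \<alpha> i d \<noteq> 0" using complement_nonempty by blast
  let ?U = "cline x d -` S"
  have "open ?U" using open_vimage[OF assms(1) continuous_cline] .
  moreover have "0 \<in> ?U" using assms by simp
  ultimately have "infinite ?U"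
    using finite_imp_not_open by blast
  moreover have "finite {z. \<exists>i\<in>A. \<alpha> i (cline x d z) = 0}"
    using finite_zeros_cline[of A x d] d by blast
  ultimately obtain z where "z \<in> ?U" "z \<notin> {z. \<exists>i\<in>A. \<alpha> i (cline x d z) = 0}"
    by (meson finite_subset subsetI)
  then show ?thesis by (auto simp: D_def)
qed

lemma sectors_meet:
  assumes k: "k \<in> A" and S: "open S" "x \<in> S" "\<alpha> k x = 0"
  shows "D \<inter> (S \<inter> sector k j \<inter> sector k (Suc j)) \<noteq> {}"
proof -
  interpret bounded_linear "\<alpha> k" by (rule linear_form[OF k])
  obtain v where v: "\<alpha> k v \<noteq> 0" using complement_nonempty k by blast
  \<comment> \<open>The direction is chosen so that the form takes a value on the diagonal of the
    quadrant common to the sectors \<open>j\<close> and \<open>Suc j\<close>; a small positive real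
    multiple of it stays in \<open>S\<close>.\<close>
  define w where "w = cline 0 v ((1 + \<i>) * \<i> ^ j / \<alpha> k v)"
  have w: "\<alpha> k w = (1 + \<i>) * \<i> ^ j" using v by (simp add: w_def form_cline[OF k] zero)
  have "continuous_on UNIV (\<lambda>t::real. x + t *\<^sub>R w)" by (intro continuous_intros)
  from open_vimage[OF S(1) this] have "open ((\<lambda>t. x + t *\<^sub>R w) -` S)" .
  moreover have "0 \<in> (\<lambda>t. x + t *\<^sub>R w) -` S" using S by simp
  ultimately obtain e where e: "e > 0" "ball 0 e \<subseteq> (\<lambda>t. x + t *\<^sub>R w) -` S"
    unfolding open_contains_ball by blast
  define t where "t = e / 2"
  have t: "t > 0" "t \<in> ball 0 e" using e(1) by (auto simp: t_def)
  have power: "(- \<i>) ^ j * \<i> ^ j = 1"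
    by (simp flip: power_mult_distrib)
  have "(- \<i>) ^ j * \<alpha> k (x + t *\<^sub>R w) = complex_of_real t * (1 + \<i>) * ((- \<i>) ^ j * \<i> ^ j)"
    by (simp add: add scale S(3) w scaleR_conv_of_real)
  then have val: "(- \<i>) ^ j * \<alpha> k (x + t *\<^sub>R w) = complex_of_real t * (1 + \<i>)" by (simp add: power)
  then have "(- \<i>) ^ Suc j * \<alpha> k (x + t *\<^sub>R w) = - \<i> * (complex_of_real t * (1 + \<i>))"
    by (simp add: mult.assoc)
  with val have "x + t *\<^sub>R w \<in> sector k j \<inter> sector k (Suc j)"
    unfolding sector_def using t(1) by (simp only: mem_Collect_eq Int_iff) simp
  moreover have "x + t *\<^sub>R w \<in> S" using e(2) t(2) by blast
  ultimately show ?thesis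
    using D_dense[of "S \<inter> sector k j \<inter> sector k (Suc j)"] S(1) open_sector[OF k] by blast
qed

text \<open>Local exactness off the hyperplane gives a primitive on each convex piece
  \<open>S \<inter> sector k j\<close>. Two consecutive ones differ by a constant on their connected
  overlap.\<close>

lemma monodromy_exists:
  assumes u: "cocycle1 (top_of_set D) u" and k: "k \<in> A" and S: "open S" "convex S"
    and loc: "\<And>x. x \<in> S \<Longrightarrow> \<alpha> k x \<noteq> 0 \<Longrightarrow> \<exists>e>0. exact_on u (ball x e)"
  shows "\<exists>m. monodromy u k S m"
proof -
  have opn: "open (S \<inter> sector k j)" and conv: "convex (S \<inter> sector k j)" for j
    using S open_sector[OF k] convex_sector[OF k] by (auto intro: convex_Int)
  have "exact_on u (S \<inter> sector k j)" for j
    by (rule exact_on_convex[OF u conv]) (use loc sector_nonzero in blast)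
  then obtain h where h: "\<And>j. prim u (S \<inter> sector k j) (h j)" unfolding exact_on_def by metis
  have "\<exists>c. \<forall>x\<in>D \<inter> (S \<inter> sector k j \<inter> sector k (Suc j)). h (Suc j) x - h j x = c" for j
  proof -
    let ?T = "S \<inter> sector k j \<inter> sector k (Suc j)"
    have "open ?T" "convex ?T"
      using opn conv open_sector[OF k] convex_sector[OF k] by (auto intro: convex_Int)
    moreover have "prim u ?T (h (Suc j))" by (rule prim_subset[OF h]) auto
    moreover have "prim u ?T (h j)" by (rule prim_subset[OF h]) auto
    ultimately have uniq: "h (Suc j) x - h j x = h (Suc j) y - h j y"
      if "x \<in> D \<inter> ?T" "y \<in> D \<inter> ?T" for x y using that by (rule prim_unique)
    show ?thesis
    proof (cases "D \<inter> ?T = {}")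
      case False
      then obtain y where "y \<in> D \<inter> ?T" by blast
      then show ?thesis using uniq by (intro exI[of _ "h (Suc j) y - h j y"]) blast
    qed auto
  qed
  then obtain c where c: "\<And>j x. x \<in> D \<inter> (S \<inter> sector k j \<inter> sector k (Suc j)) \<Longrightarrow> h (Suc j) x - h j x = c j"
    by metis
  \<comment> \<open>Subtracting the accumulated transition constants makes consecutive primitives
    agree. What remains is the difference of those with index 4 and 0, which belong to the same
    sector: the monodromy.\<close>
  define g where "g = (\<lambda>j x. h j x + - (\<Sum>i<j. c i))"
  have g: "prim u (S \<inter> sector k j) (g j)" for j
    unfolding g_def by (rule prim_add_const[OF h])
  have "\<exists>m. \<forall>x\<in>D \<inter> (S \<inter> sector k 0). g 4 x = g 0 x + m"
  proof (cases "D \<inter> (S \<inter> sector k 0) = {}")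
    case False
    then obtain z where z: "z \<in> D \<inter> (S \<inter> sector k 0)" by blast
    have "g 4 x = g 0 x + (g 4 z - g 0 z)" if "x \<in> D \<inter> (S \<inter> sector k 0)" for x
      using prim_unique[OF opn conv g[of 4, unfolded sector_4] g[of 0] that z]
      by (simp add: algebra_simps)
    then show ?thesis by blast
  qed auto
  then obtain m where m: "\<forall>x\<in>D \<inter> (S \<inter> sector k 0). g 4 x = g 0 x + m" by blast
  have "g (Suc j) x = g j x" if "x \<in> D \<inter> (S \<inter> sector k j \<inter> sector k (Suc j))" for j x
    using c[OF that] by (simp add: g_def algebra_simps)
  then have "monodromy u k S m" unfolding monodromy_def using g m by blast
  then show ?thesis by blast
qed

text \<open>The difference of two systems of primitives is constant on each sector and is passed on
  unchanged through the overlaps, hence is the same before and after a full turn. The point of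
  \<open>S\<close> on the hyperplane ensures that the overlaps are nonempty.\<close>

lemma monodromy_unique:
  assumes k: "k \<in> A" and S: "open S" "convex S" "x \<in> S" "\<alpha> k x = 0"
    and m: "monodromy u k S m" and m': "monodromy u k S m'"
  shows "m = m'"
proof -
  obtain g where g: "\<And>j. j \<le> 4 \<Longrightarrow> prim u (S \<inter> sector k j) (g j)"
    "\<And>j x. j < 4 \<Longrightarrow> x \<in> D \<inter> (S \<inter> sector k j \<inter> sector k (Suc j)) \<Longrightarrow> g (Suc j) x = g j x"
    "\<And>x. x \<in> D \<inter> (S \<inter> sector k 0) \<Longrightarrow> g 4 x = g 0 x + m"
    using m unfolding monodromy_def by blast
  obtain h where h: "\<And>j. j \<le> 4 \<Longrightarrow> prim u (S \<inter> sector k j) (h j)"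
    "\<And>j x. j < 4 \<Longrightarrow> x \<in> D \<inter> (S \<inter> sector k j \<inter> sector k (Suc j)) \<Longrightarrow> h (Suc j) x = h j x"
    "\<And>x. x \<in> D \<inter> (S \<inter> sector k 0) \<Longrightarrow> h 4 x = h 0 x + m'"
    using m' unfolding monodromy_def by blast
  have uniq: "g j a - h j a = g j b - h j b"
    if "j \<le> 4" "a \<in> D \<inter> (S \<inter> sector k j)" "b \<in> D \<inter> (S \<inter> sector k j)" for j a b
    using prim_unique[OF _ _ g(1)[OF that(1)] h(1)[OF that(1)] that(2,3)]
      S open_sector[OF k] convex_sector[OF k] by (simp add: open_Int convex_Int)
  have "\<exists>y. y \<in> D \<inter> (S \<inter> sector k j \<inter> sector k (Suc j))" for j
    using sectors_meet[OF k S(1,3,4)] by blast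
  then obtain y where y: "\<And>j. y j \<in> D \<inter> (S \<inter> sector k j \<inter> sector k (Suc j))" by metis
  have step: "g (Suc j) (y (Suc j)) - h (Suc j) (y (Suc j)) = g j (y j) - h j (y j)" if "j < 4" for j
    using uniq[of "Suc j" "y (Suc j)" "y j"] y[of j] y[of "Suc j"] that g(2)[OF that y] h(2)[OF that y]
    by auto
  have "g 4 (y 4) - h 4 (y 4) = g 0 (y 0) - h 0 (y 0)"
    using step[of 0] step[of 1] step[of 2] step[of 3] by (simp add: eval_nat_numeral)
  moreover have y4: "y 4 \<in> D \<inter> (S \<inter> sector k 0)" using y[of 4] sector_4 by blast
  moreover have "g 0 (y 4) - h 0 (y 4) = g 0 (y 0) - h 0 (y 0)" using uniq[of 0] y4 y[of 0] by blast
  moreover have "m - m' = (g 4 (y 4) - h 4 (y 4)) - (g 0 (y 4) - h 0 (y 4))"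
    using g(3)[OF y4] h(3)[OF y4] by (simp add: algebra_simps)
  ultimately show ?thesis by (simp del: One_nat_def)
qed

lemma monodromy_subset: "monodromy u k S m \<Longrightarrow> T \<subseteq> S \<Longrightarrow> monodromy u k T m"
  unfolding monodromy_def
  by (elim exE, rule_tac x = g in exI) (auto intro: prim_subset)

lemma monodromy_diff:
  assumes "monodromy u k S m" "monodromy v k S m'"
  shows "monodromy (\<lambda>s. u s - c * v s) k S (m - c * m')"
proof -
  obtain g where g: "\<And>j. j \<le> 4 \<Longrightarrow> prim u (S \<inter> sector k j) (g j)"
    "\<And>j x. j < 4 \<Longrightarrow> x \<in> D \<inter> (S \<inter> sector k j \<inter> sector k (Suc j)) \<Longrightarrow> g (Suc j) x = g j x"
    "\<And>x. x \<in> D \<inter> (S \<inter> sector k 0) \<Longrightarrow> g 4 x = g 0 x + m"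
    using assms(1) unfolding monodromy_def by blast
  obtain h where h: "\<And>j. j \<le> 4 \<Longrightarrow> prim v (S \<inter> sector k j) (h j)"
    "\<And>j x. j < 4 \<Longrightarrow> x \<in> D \<inter> (S \<inter> sector k j \<inter> sector k (Suc j)) \<Longrightarrow> h (Suc j) x = h j x"
    "\<And>x. x \<in> D \<inter> (S \<inter> sector k 0) \<Longrightarrow> h 4 x = h 0 x + m'"
    using assms(2) unfolding monodromy_def by blast
  show ?thesis
    unfolding monodromy_def
  proof (intro exI[of _ "\<lambda>j x. g j x - c * h j x"] conjI allI impI ballI)
    show "prim (\<lambda>s. u s - c * v s) (S \<inter> sector k j) (\<lambda>x. g j x - c * h j x)" if "j \<le> 4" for j
      by (rule prim_diff[OF g(1)[OF that] h(1)[OF that]])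
  qed (use g(2,3) h(2,3) in \<open>auto simp: algebra_simps\<close>)
qed

text \<open>Opposite sectors are disjoint, neighbouring primitives agree by continuation, and the
  last agrees with the first because the monodromy is 0; so the four of them form one function,
  which is a primitive locally.\<close>

lemma exact_on_monodromy_zero:
  assumes u: "cocycle1 (top_of_set D) u" and k: "k \<in> A" and m: "monodromy u k S 0"
  shows "exact_on u S"
proof -
  obtain g where g: "\<And>j. j \<le> 4 \<Longrightarrow> prim u (S \<inter> sector k j) (g j)"
    "\<And>j x. j < 4 \<Longrightarrow> x \<in> D \<inter> (S \<inter> sector k j \<inter> sector k (Suc j)) \<Longrightarrow> g (Suc j) x = g j x"
    "\<And>x. x \<in> D \<inter> (S \<inter> sector k 0) \<Longrightarrow> g 4 x = g 0 x"
    using m unfolding monodromy_def add_0_right by blast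
  have sec: "x \<in> sector k 0 \<longleftrightarrow> 0 < Re (\<alpha> k x)" "x \<in> sector k 1 \<longleftrightarrow> 0 < Im (\<alpha> k x)"
    "x \<in> sector k 2 \<longleftrightarrow> Re (\<alpha> k x) < 0" "x \<in> sector k 3 \<longleftrightarrow> Im (\<alpha> k x) < 0" for x
    by (simp_all add: sector_def eval_nat_numeral)
  let ?f = "\<lambda>x. if x \<in> sector k 0 then g 0 x else if x \<in> sector k 1 then g 1 x
    else if x \<in> sector k 2 then g 2 x else g 3 x"
  have f: "g j x = ?f x" if j: "j < 4" and x: "x \<in> D \<inter> (S \<inter> sector k j)" for j x
  proof -
    have a: "g (Suc i) x = g i x" if "i < 4" "x \<in> sector k i" "x \<in> sector k (Suc i)" for i
      using g(2)[OF that(1)] that x by blast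
    have a1: "x \<in> sector k 0 \<Longrightarrow> x \<in> sector k 1 \<Longrightarrow> g 1 x = g 0 x"
      and a2: "x \<in> sector k 1 \<Longrightarrow> x \<in> sector k 2 \<Longrightarrow> g 2 x = g 1 x"
      and a3: "x \<in> sector k 2 \<Longrightarrow> x \<in> sector k 3 \<Longrightarrow> g 3 x = g 2 x"
      and a4: "x \<in> sector k 3 \<Longrightarrow> x \<in> sector k 4 \<Longrightarrow> g 4 x = g 3 x"
      using a[of 0] a[of 1] a[of 2] a[of 3] by (simp_all add: numeral_2_eq_2 numeral_3_eq_3 numeral_eq_Suc)
    have a5: "x \<in> sector k 3 \<Longrightarrow> x \<in> sector k 0 \<Longrightarrow> g 3 x = g 0 x"
      using a4 g(3)[of x] x unfolding sector_4 by (metis IntI IntD1 IntD2)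
    consider "j = 0" | "j = 1" | "j = 2" | "j = 3" using j by linarith
    then show ?thesis
      by cases (use x a1 a2 a3 a5 in \<open>auto simp: sec[unfolded One_nat_def]\<close>)
  qed
  have "prim u S ?f"
  proof (rule prim_local[OF u])
    fix x assume x: "x \<in> D \<inter> S"
    then have "\<alpha> k x \<noteq> 0" using k by (auto simp: D_def)
    then have "Re (\<alpha> k x) \<noteq> 0 \<or> Im (\<alpha> k x) \<noteq> 0" by (auto simp: complex_eq_iff)
    then obtain j where j: "j < 4" "x \<in> sector k j"
    proof -
      consider "0 < Re (\<alpha> k x)" | "0 < Im (\<alpha> k x)" | "Re (\<alpha> k x) < 0" | "Im (\<alpha> k x) < 0"
        using \<open>Re (\<alpha> k x) \<noteq> 0 \<or> Im (\<alpha> k x) \<noteq> 0\<close> by linarith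
      then show ?thesis
        using that[of 0] that[of 1] that[of 2] that[of 3] sec[of x] by cases auto
    qed
    have "prim u (S \<inter> sector k j) ?f"
      using j(1) f by (intro prim_cong[OF g(1)]) auto
    then show "\<exists>T. open T \<and> x \<in> T \<and> prim u (S \<inter> T) ?f"
      using open_sector[OF k] j(2) by blast
  qed
  then show ?thesis by (auto simp: exact_on_def)
qed

lemma exp_half_pi_i: "exp (\<i> * (pi / 2)) = \<i>"
  by (simp add: exp_eq_polar)

text \<open>A quarter turn clockwise takes arguments in (- pi / 2, pi / 2) to (- pi, 0), so the
  branch cut is not crossed.\<close>

lemma Ln_rotate:
  assumes "0 < Re w" shows "Ln (- \<i> * w) = Ln w - \<i> * (pi / 2)"
proof (rule Ln_unique)
  have "w \<noteq> 0" using assms by auto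
  then have "\<bar>Im (Ln w)\<bar> < pi / 2" using assms Re_Ln_pos_lt by blast
  then show "- pi < Im (Ln w - \<i> * (pi / 2))" "Im (Ln w - \<i> * (pi / 2)) \<le> pi" by auto
  show "exp (Ln w - \<i> * (pi / 2)) = - \<i> * w"
    unfolding exp_diff exp_half_pi_i using \<open>w \<noteq> 0\<close> by (simp add: divide_complex_def)
qed

lemma monodromy_dlog:
  assumes k: "k \<in> A" shows "monodromy (dlog (\<alpha> k)) k S (2 * pi * \<i>)"
proof -
  \<comment> \<open>The sector is rotated onto the right half-plane, the principal logarithm is
    taken there, and the angle of \<open>j\<close> quarter turns is added back. Four quarter turns
    make up 2 pi i.\<close>
  define g where "g = (\<lambda>j x. Ln ((- \<i>) ^ j * \<alpha> k x) + of_nat j * (\<i> * (pi / 2)))"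
  have i: "exp (of_nat j * (\<i> * (pi / 2))) = \<i> ^ j" for j
    by (simp only: exp_of_nat_mult exp_half_pi_i)
  have "prim (dlog (\<alpha> k)) (S \<inter> sector k j) (g j)" for j
    unfolding prim_def
  proof (rule primitive_dlog)
    have "continuous_on (D \<inter> (S \<inter> sector k j)) (g j)"
      unfolding g_def
      by (intro continuous_intros continuous_form[OF k])
        (auto simp: sector_def complex_nonpos_Reals_iff)
    then show "continuous_map (top_of_set (D \<inter> (S \<inter> sector k j))) euclidean (g j)" by simp
    fix x assume "x \<in> topspace (top_of_set (D \<inter> (S \<inter> sector k j)))"
    then have nz: "(- \<i>) ^ j * \<alpha> k x \<noteq> 0" using k by (auto simp: D_def)
    have "exp (g j x) = (- \<i>) ^ j * \<alpha> k x * \<i> ^ j"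
      by (simp only: g_def exp_add i exp_Ln[OF nz])
    also have "\<dots> = (- \<i> * \<i>) ^ j * \<alpha> k x" by (simp only: power_mult_distrib mult_ac)
    finally show "\<alpha> k x = exp (g j x)" by simp
  qed
  moreover have "g (Suc j) x = g j x" if "x \<in> sector k j" for j x
  proof -
    have "g (Suc j) x = Ln (- \<i> * ((- \<i>) ^ j * \<alpha> k x)) + of_nat (Suc j) * (\<i> * (pi / 2))"
      by (simp only: g_def power_Suc mult.assoc)
    also have "Ln (- \<i> * ((- \<i>) ^ j * \<alpha> k x)) = Ln ((- \<i>) ^ j * \<alpha> k x) - \<i> * (pi / 2)"
      using that by (intro Ln_rotate) (simp add: sector_def)
    finally show ?thesis by (simp only: g_def of_nat_Suc distrib_right) simp
  qed
  moreover have "g 4 x = g 0 x + 2 * pi * \<i>" for x by (simp add: g_def)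
  ultimately show ?thesis unfolding monodromy_def by (intro exI[of _ g]) blast
qed

section \<open>Filling in the hyperplanes\<close>

lemma exact_on_contractible:
  assumes "cocycle1 (top_of_set (ball x e)) u" shows "exact_on u (ball x e)"
proof -
  have "contractible_space (top_of_set (ball x e))"
    by (simp add: convex_imp_contractible)
  then obtain g where "primitive (top_of_set (ball x e)) u g"
    using primitive_on_contractible assms by blast
  then have "prim u (ball x e) g" unfolding prim_def using primitive_subset by blast
  then show ?thesis by (auto simp: exact_on_def)
qed

lemma ball_avoiding:
  assumes "B \<subseteq> A" "\<And>i. i \<in> B \<Longrightarrow> \<alpha> i x \<noteq> 0"
  shows "\<exists>e>0. \<forall>y\<in>ball x e. \<forall>i\<in>B. \<alpha> i y \<noteq> 0"
proof -
  let ?U = "\<Inter>i\<in>B. \<alpha> i -` (- {0})"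
  have "open ?U"
    using finite_subset[OF assms(1) finite_A] continuous_form[of _ UNIV] assms(1)
    by (auto intro!: open_INT open_vimage)
  moreover have "x \<in> ?U" using assms(2) by auto
  ultimately obtain e where "e > 0" "ball x e \<subseteq> ?U" unfolding open_contains_ball by blast
  then show ?thesis by auto
qed

lemma cocycle1_dlog_form: "k \<in> A \<Longrightarrow> cocycle1 (top_of_set D) (dlog (\<alpha> k))"
  by (rule cocycle1_dlog) (auto simp: D_def continuous_form)

lemma dlog_locally_exact:
  assumes k: "k \<in> A" "\<alpha> k x \<noteq> 0" shows "\<exists>e>0. exact_on (dlog (\<alpha> k)) (ball x e)"
proof -
  obtain e where e: "e > 0" "\<And>y. y \<in> ball x e \<Longrightarrow> \<alpha> k y \<noteq> 0"
    using ball_avoiding[of "{k}" x] k by blast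
  then have "cocycle1 (top_of_set (ball x e)) (dlog (\<alpha> k))"
    by (intro cocycle1_dlog) (auto simp: continuous_form[OF k(1)])
  then show ?thesis using e(1) exact_on_contractible by blast
qed

lemma exact_on_ball_diff:
  assumes "\<exists>e>0. exact_on u (ball x e)" "\<exists>e>0. exact_on v (ball x e)"
  shows "\<exists>e>0. exact_on (\<lambda>s. u s - c * v s) (ball x e)"
proof -
  obtain e e' where "e > 0" "exact_on u (ball x e)" "e' > 0" "exact_on v (ball x e')"
    using assms by blast
  then have "min e e' > 0" "exact_on u (ball x (min e e'))" "exact_on v (ball x (min e e'))"
    by (auto intro: exact_on_subset)
  then show ?thesis using exact_on_diff by blast
qed

text \<open>Monodromies at nearby points of the hyperplane agree by restriction to the intersection
  of two balls. A complex line through two points of the hyperplane stays in it and meets the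
  hyperplanes of \<open>B\<close> in finitely many points only, so local constancy along the line
  gives constancy.\<close>

lemma constant_monodromy:
  assumes u: "cocycle1 (top_of_set D) u" and k: "k \<in> A" and B: "B \<subseteq> A"
    and loc: "\<And>x. \<alpha> k x \<noteq> 0 \<Longrightarrow> (\<And>i. i \<in> B \<Longrightarrow> \<alpha> i x \<noteq> 0) \<Longrightarrow> \<exists>e>0. exact_on u (ball x e)"
  shows "\<exists>m. \<forall>x. \<alpha> k x = 0 \<longrightarrow> (\<forall>i\<in>B. \<alpha> i x \<noteq> 0) \<longrightarrow> (\<exists>e>0. monodromy u k (ball x e) m)"
proof -
  define P where "P = {x. \<alpha> k x = 0 \<and> (\<forall>i\<in>B. \<alpha> i x \<noteq> 0)}"
  have "\<exists>e m. e > 0 \<and> monodromy u k (ball x e) m" if x: "x \<in> P" for x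
  proof -
    obtain e where e: "e > 0" "\<And>y i. y \<in> ball x e \<Longrightarrow> i \<in> B \<Longrightarrow> \<alpha> i y \<noteq> 0"
      using ball_avoiding[OF B, of x] x unfolding P_def by blast
    have "\<exists>m. monodromy u k (ball x e) m"
      by (rule monodromy_exists[OF u k]) (use e(2) loc in auto)
    then show ?thesis using e(1) by blast
  qed
  then obtain e m where em: "\<And>x. x \<in> P \<Longrightarrow> e x > 0 \<and> monodromy u k (ball x (e x)) (m x)" by metis
  have near: "m y = m x" if "x \<in> P" "y \<in> P" "y \<in> ball x (e x)" for x y
  proof (rule monodromy_unique[OF k])
    let ?S = "ball x (e x) \<inter> ball y (e y)"
    show "open ?S" "convex ?S" "y \<in> ?S" using em[OF that(2)] that(3) by (auto intro: convex_Int)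
    show "\<alpha> k y = 0" using that(2) by (simp add: P_def)
    show "monodromy u k ?S (m y)" "monodromy u k ?S (m x)"
      using em that monodromy_subset by blast+
  qed
  have const: "m a = m b" if ab: "a \<in> P" "b \<in> P" for a b
  proof -
    let ?Z = "{z. cline a b z \<in> UNIV \<and> (\<forall>i\<in>B. \<alpha> i (cline a b z) \<noteq> 0)}"
    have "connected ?Z"
      using path_connected_cline[of UNIV B a b] B ab(1) path_connected_imp_connected
      by (auto simp: P_def)
    have inP: "cline a b z \<in> P" if "z \<in> ?Z" for z
      using that ab by (simp add: P_def form_cline[OF k])
    have "m (cline a b 0) = m (cline a b 1)"
    proof (rule connected_local_const[where f = "\<lambda>z. m (cline a b z)", OF \<open>connected ?Z\<close>])
      show "0 \<in> ?Z" "1 \<in> ?Z" using ab by (auto simp: P_def)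
      show "\<forall>z\<in>?Z. \<forall>\<^sub>F w in at z within ?Z. m (cline a b z) = m (cline a b w)"
      proof
        fix z assume z: "z \<in> ?Z"
        have "open (cline a b -` ball (cline a b z) (e (cline a b z)))"
          by (rule open_vimage[OF open_ball continuous_cline])
        moreover have "z \<in> cline a b -` ball (cline a b z) (e (cline a b z))"
          using em[OF inP[OF z]] by simp
        ultimately have "\<forall>\<^sub>F w in at z within ?Z. w \<in> cline a b -` ball (cline a b z) (e (cline a b z))"
          unfolding eventually_at_topological by blast
        moreover have "\<forall>\<^sub>F w in at z within ?Z. w \<in> ?Z"
          by (simp add: eventually_at_filter)
        ultimately show "\<forall>\<^sub>F w in at z within ?Z. m (cline a b z) = m (cline a b w)"
        proof eventually_elim
          case (elim w)
          then show ?case using near[OF inP[OF z] inP[of w]] by simp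
        qed
      qed
    qed
    then show ?thesis by simp
  qed
  have "\<exists>m0. \<forall>x\<in>P. m x = m0" using const by (cases "P = {}") blast+
  then obtain m0 where "\<And>x. x \<in> P \<Longrightarrow> m x = m0" by blast
  then show ?thesis using em unfolding P_def by (intro exI[of _ m0]) blast
qed

lemma cocycle1_sub_forms:
  assumes "cocycle1 (top_of_set D) u" "finite F" "F \<subseteq> A"
  shows "cocycle1 (top_of_set D) (\<lambda>s. u s - (\<Sum>i\<in>F. c i * dlog (\<alpha> i) s))"
  using assms(2,3)
proof (induction F rule: finite_induct)
  case (insert k F)
  then have "cocycle1 (top_of_set D) (\<lambda>s. (u s - (\<Sum>i\<in>F. c i * dlog (\<alpha> i) s)) - c k * dlog (\<alpha> k) s)"
    by (intro cocycle1_diff cocycle1_dlog_form) auto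
  then show ?case using insert by (simp add: algebra_simps)
qed (use assms(1) in simp)

text \<open>The hyperplanes are filled in one at a time: near a point of the hyperplane \<open>\<alpha> k = 0\<close> that lies
  on no hyperplane still missing, the only obstruction to exactness is the monodromy around this
  hyperplane, which a multiple of \<open>dlog (\<alpha> k)\<close> cancels.\<close>

lemma locally_exact_off:
  assumes u: "cocycle1 (top_of_set D) u" and F: "finite F" "F \<subseteq> A"
  shows "\<exists>c. \<forall>x. (\<forall>i\<in>A - F. \<alpha> i x \<noteq> 0) \<longrightarrow>
    (\<exists>e>0. exact_on (\<lambda>s. u s - (\<Sum>i\<in>F. c i * dlog (\<alpha> i) s)) (ball x e))"
  using F
proof (induction F rule: finite_induct)
  case empty
  have "\<exists>e>0. exact_on u (ball x e)" if "\<forall>i\<in>A. \<alpha> i x \<noteq> 0" for x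
  proof -
    have "\<exists>e>0. \<forall>y\<in>ball x e. \<forall>i\<in>A. \<alpha> i y \<noteq> 0" by (rule ball_avoiding) (use that in auto)
    then obtain e where e: "e > 0" "\<And>y i. y \<in> ball x e \<Longrightarrow> i \<in> A \<Longrightarrow> \<alpha> i y \<noteq> 0"
      by blast
    then have "D \<inter> ball x e = ball x e" by (auto simp: D_def)
    then have "cocycle1 (top_of_set (ball x e)) u"
      using cocycle1_subtopology[OF u, of "ball x e"] by (simp add: subtopology_subtopology)
    then show ?thesis using e(1) exact_on_contractible by blast
  qed
  then show ?case by simp
next
  case (insert k F)
  then obtain c where c: "\<forall>x. (\<forall>i\<in>A - F. \<alpha> i x \<noteq> 0) \<longrightarrow>
      (\<exists>e>0. exact_on (\<lambda>s. u s - (\<Sum>i\<in>F. c i * dlog (\<alpha> i) s)) (ball x e))" by auto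
  define v where "v = (\<lambda>s. u s - (\<Sum>i\<in>F. c i * dlog (\<alpha> i) s))"
  have k: "k \<in> A" and v: "cocycle1 (top_of_set D) v"
    using insert cocycle1_sub_forms[OF u] by (auto simp: v_def)
  let ?B = "A - insert k F"
  have "\<exists>e>0. exact_on v (ball x e)" if "\<alpha> k x \<noteq> 0" "\<And>i. i \<in> ?B \<Longrightarrow> \<alpha> i x \<noteq> 0" for x
    unfolding v_def using that by (intro c[rule_format]) blast
  note v_exact = this
  obtain m where m: "\<forall>x. \<alpha> k x = 0 \<longrightarrow> (\<forall>i\<in>?B. \<alpha> i x \<noteq> 0) \<longrightarrow> (\<exists>e>0. monodromy v k (ball x e) m)"
    using constant_monodromy[OF v k Diff_subset v_exact] ..
  \<comment> \<open>\<open>dlog (\<alpha> k)\<close> has monodromy 2 pi i, so this multiple of it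
    has monodromy \<open>m\<close>.\<close>
  define w where "w = (\<lambda>s. v s - (m / (2 * pi * \<i>)) * dlog (\<alpha> k) s)"
  have w: "cocycle1 (top_of_set D) w"
    unfolding w_def by (rule cocycle1_diff[OF v cocycle1_dlog_form[OF k]])
  have "\<exists>e>0. exact_on w (ball x e)" if x: "\<forall>i\<in>?B. \<alpha> i x \<noteq> 0" for x
  proof (cases "\<alpha> k x = 0")
    case True
    then obtain e where e: "e > 0" "monodromy v k (ball x e) m" using m x by auto
    have "monodromy w k (ball x e) (m - (m / (2 * pi * \<i>)) * (2 * pi * \<i>))"
      unfolding w_def by (rule monodromy_diff[OF e(2) monodromy_dlog[OF k]])
    then have "monodromy w k (ball x e) 0" by simp
    then show ?thesis using e(1) exact_on_monodromy_zero[OF w k] by blast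
  next
    case False
    then show ?thesis unfolding w_def
      using x by (intro exact_on_ball_diff v_exact dlog_locally_exact k) auto
  qed
  moreover have "(\<lambda>s. u s - (\<Sum>i\<in>insert k F. (c(k := m / (2 * pi * \<i>))) i * dlog (\<alpha> i) s)) = w"
  proof
    fix s
    have "(\<Sum>i\<in>F. (c(k := m / (2 * pi * \<i>))) i * dlog (\<alpha> i) s) = (\<Sum>i\<in>F. c i * dlog (\<alpha> i) s)"
      using insert(2) by (intro sum.cong) auto
    then show "u s - (\<Sum>i\<in>insert k F. (c(k := m / (2 * pi * \<i>))) i * dlog (\<alpha> i) s) = w s"
      using insert(1,2) by (simp add: w_def v_def)
  qed
  ultimately show ?case by (intro exI[of _ "c(k := m / (2 * pi * \<i>))"]) simp
qed

text \<open>Once all hyperplanes are filled in, the corrected cocycle is exact near every point, and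
  the whole space is convex.\<close>

theorem cocycle_on_complement:
  assumes u: "cocycle1 (top_of_set D) u"
  shows "\<exists>c g. primitive (top_of_set D) (\<lambda>s. u s - (\<Sum>i\<in>A. c i * dlog (\<alpha> i) s)) g"
proof -
  obtain c where "\<And>x. \<exists>e>0. exact_on (\<lambda>s. u s - (\<Sum>i\<in>A. c i * dlog (\<alpha> i) s)) (ball x e)"
    using locally_exact_off[OF u finite_A subset_refl] by auto
  then have "exact_on (\<lambda>s. u s - (\<Sum>i\<in>A. c i * dlog (\<alpha> i) s)) UNIV"
    by (intro exact_on_convex cocycle1_sub_forms[OF u finite_A subset_refl]) auto
  then show ?thesis by (auto simp: exact_on_def prim_def)
qed

end

subsection \<open>The braid arrangement\<close>

text \<open>The ambient normed space of the arrangement is the space of bounded sequences, so that a single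
  type serves for all \<open>n\<close>; the coordinates outside \<open>{1..n}\<close> play no role.\<close>

definition pad :: "nat \<Rightarrow> (nat \<Rightarrow> complex) \<Rightarrow> nat \<Rightarrow>\<^sub>C complex" where
  "pad n z = Bcontfun (\<lambda>i. if i \<in> {1..n} then z i else 0)"

definition times_i :: "(nat \<Rightarrow>\<^sub>C complex) \<Rightarrow> nat \<Rightarrow>\<^sub>C complex" where
  "times_i x = Bcontfun (\<lambda>i. \<i> * apply_bcontfun x i)"

definition pairs :: "nat \<Rightarrow> (nat \<times> nat) set" where
  "pairs n = {(i, j). i \<in> {1..n} \<and> j \<in> {1..n} \<and> i < j}"

definition braid_form :: "nat \<times> nat \<Rightarrow> (nat \<Rightarrow>\<^sub>C complex) \<Rightarrow> complex" where
  "braid_form p x = apply_bcontfun x (fst p) - apply_bcontfun x (snd p)"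

lemma pad_apply: "apply_bcontfun (pad n z) i = (if i \<in> {1..n} then z i else 0)"
proof -
  have "range (\<lambda>i. if i \<in> {1..n} then z i else 0) \<subseteq> insert 0 (z ` {1..n})" by auto
  then have "bounded (range (\<lambda>i. if i \<in> {1..n} then z i else 0))"
    by (rule bounded_subset[rotated]) (simp add: finite_imp_bounded)
  then have "(\<lambda>i. if i \<in> {1..n} then z i else 0) \<in> bcontfun"
    by (simp add: bcontfun_def)
  then show ?thesis unfolding pad_def by (subst Bcontfun_inverse) auto
qed

lemma times_i_apply: "apply_bcontfun (times_i x) i = \<i> * apply_bcontfun x i"
proof -
  have "(\<lambda>i. \<i> * apply_bcontfun x i) \<in> bcontfun"
    by (rule bcontfun_normI[where b = "norm x"]) (auto simp: norm_mult norm_bounded)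
  then show ?thesis unfolding times_i_def by (subst Bcontfun_inverse) auto
qed

lemma bounded_linear_coord: "bounded_linear (\<lambda>x :: nat \<Rightarrow>\<^sub>C complex. apply_bcontfun x i)"
  by (rule bounded_linear_intro[where K = 1]) (auto simp: norm_bounded)

lemma continuous_on_coord: "continuous_on S (\<lambda>x :: nat \<Rightarrow>\<^sub>C complex. apply_bcontfun x i)"
  by (rule linear_continuous_on[OF bounded_linear_coord])

lemma finite_pairs: "finite (pairs n)"
  by (rule finite_subset[of _ "{1..n} \<times> {1..n}"]) (auto simp: pairs_def)

lemma braid_arrangement: "complex_arrangement (pairs n) braid_form times_i"
proof (rule complex_arrangement.intro)
  fix p :: "nat \<times> nat" and x :: "nat \<Rightarrow>\<^sub>C complex"
  show "bounded_linear (braid_form p)"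
    unfolding braid_form_def[abs_def] by (intro bounded_linear_sub bounded_linear_coord)
  show "braid_form p (times_i x) = \<i> * braid_form p x"
    by (simp add: braid_form_def times_i_apply algebra_simps)
next
  show "\<exists>x. \<forall>p\<in>pairs n. braid_form p x \<noteq> 0"
    by (rule exI[of _ "pad n of_nat"]) (auto simp: braid_form_def pad_apply pairs_def)
qed (rule finite_pairs)

definition braid_complement :: "nat \<Rightarrow> (nat \<Rightarrow>\<^sub>C complex) set" where
  "braid_complement n = {x. inj_on (apply_bcontfun x) {1..n}}"

lemma braid_complement_eq: "complex_arrangement.D (pairs n) braid_form = braid_complement n"
proof -
  have "(\<forall>p\<in>pairs n. braid_form p x \<noteq> 0) \<longleftrightarrow> inj_on (apply_bcontfun x) {1..n}" for x
  proof
    assume ne: "\<forall>p\<in>pairs n. braid_form p x \<noteq> 0"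
    show "inj_on (apply_bcontfun x) {1..n}"
    proof (rule inj_onI, rule ccontr)
      fix i j assume ij: "i \<in> {1..n}" "j \<in> {1..n}" "apply_bcontfun x i = apply_bcontfun x j" "i \<noteq> j"
      then have "(i, j) \<in> pairs n \<or> (j, i) \<in> pairs n" by (auto simp: pairs_def)
      then show False using ne ij(3) by (auto simp: braid_form_def)
    qed
  next
    assume "inj_on (apply_bcontfun x) {1..n}"
    then show "\<forall>p\<in>pairs n. braid_form p x \<noteq> 0"
      by (auto simp: braid_form_def pairs_def dest: inj_onD)
  qed
  then show ?thesis
    by (simp add: complex_arrangement.D_def[OF braid_arrangement] braid_complement_def)
qed

lemma cocycle_on_braid_complement:
  "cocycle1 (top_of_set (braid_complement n)) u \<Longrightarrow>
     \<exists>c g. primitive (top_of_set (braid_complement n)) (\<lambda>s. u s - (\<Sum>p\<in>pairs n. c p * dlog (braid_form p) s)) g"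
  using complex_arrangement.cocycle_on_complement[OF braid_arrangement, of n u]
  by (simp add: braid_complement_eq)

section \<open>Normalised coordinates on the quotient\<close>

text \<open>Translations cancel in the differences and scalars in the quotient, so the chosen
  representative does not matter; this makes the defining forms of the arrangement into functions on
  the quotient space.\<close>

definition ratio :: "nat \<Rightarrow> nat \<Rightarrow> (nat \<Rightarrow> complex) set \<Rightarrow> complex" where
  "ratio i j P = (let z = SOME z. z \<in> P in (z i - z j) / (z 1 - z 2))"

text \<open>The representative with z 1 = 0 and z 2 = -1, the choice that turns each
  \<open>ratio i j\<close> into a plain difference of coordinates.\<close>

definition normal_rep :: "nat \<Rightarrow> (nat \<Rightarrow> complex) set \<Rightarrow> nat \<Rightarrow> complex" where
  "normal_rep n P = restrict (\<lambda>i. ratio i 1 P) {1..n}"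

lemma topspace_dA:
  "topspace (dA_complement n) = affine_class n ` {z \<in> extensional {1..n}. inj_on z {1..n}}"
  by (simp add: dA_complement_def topspace_quotient_topology topspace_config)

lemma in_topspace_dA:
  assumes "P \<in> topspace (dA_complement n)"
  obtains z where "z \<in> extensional {1..n}" "inj_on z {1..n}" "P = affine_class n z"
  using assms unfolding topspace_dA by blast

lemma affine_class_in_dA:
  assumes "inj_on z {1..n}" shows "affine_class n z \<in> topspace (dA_complement n)"
proof -
  have "affine_class n z = affine_class n (restrict z {1..n})"
    using affine_class_eq[of 1 n z 0] by simp
  then show ?thesis using assms unfolding topspace_dA
    by (intro image_eqI[of _ _ "restrict z {1..n}"]) auto
qed

lemma ratio_affine_class:
  assumes "i \<in> {1..n}" "j \<in> {1..n}" "n \<ge> 2"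
  shows "ratio i j (affine_class n z) = (z i - z j) / (z 1 - z 2)"
proof -
  define w where "w = (SOME w. w \<in> affine_class n z)"
  have "restrict (\<lambda>i. 1 * z i + 0) {1..n} \<in> affine_class n z"
    unfolding affine_class_def by (intro CollectI exI[of _ 1] exI[of _ 0]) simp
  then have "w \<in> affine_class n z" unfolding w_def
    by (rule someI[where P = "\<lambda>w. w \<in> affine_class n z"])
  then obtain a b where ab: "a \<noteq> 0" "w = restrict (\<lambda>i. a * z i + b) {1..n}"
    unfolding affine_class_def by blast
  have "w i - w j = a * (z i - z j)" "w 1 - w 2 = a * (z 1 - z 2)"
    using assms by (simp_all add: ab(2) algebra_simps)
  then show ?thesis using ab(1) by (simp add: ratio_def w_def[symmetric] Let_def)
qed

lemma normal_rep_props: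
  assumes "P \<in> topspace (dA_complement n)" "n \<ge> 2"
  shows "affine_class n (normal_rep n P) = P" "inj_on (normal_rep n P) {1..n}"
    "\<And>i j. i \<in> {1..n} \<Longrightarrow> j \<in> {1..n} \<Longrightarrow> ratio i j P = normal_rep n P i - normal_rep n P j"
proof -
  obtain z where z: "z \<in> extensional {1..n}" "inj_on z {1..n}" "P = affine_class n z"
    using in_topspace_dA[OF assms(1)] .
  have ne: "z 1 - z 2 \<noteq> 0" using z(2) assms(2) by (auto dest: inj_onD[of z _ 1 2])
  have rep: "normal_rep n P = restrict (\<lambda>i. (1 / (z 1 - z 2)) * z i + (- z 1 / (z 1 - z 2))) {1..n}"
    using ratio_affine_class[of _ n 1 z] assms(2)
    by (auto simp: normal_rep_def z(3) restrict_def fun_eq_iff diff_divide_distrib)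
  have "affine_class n (normal_rep n P) = affine_class n z"
    unfolding rep by (rule affine_class_eq) (use ne in simp)
  then show "affine_class n (normal_rep n P) = P" using z(3) by simp
  show "inj_on (normal_rep n P) {1..n}"
  proof (rule inj_onI)
    fix i j assume ij: "i \<in> {1..n}" "j \<in> {1..n}" "normal_rep n P i = normal_rep n P j"
    then have "(1 / (z 1 - z 2)) * z i = (1 / (z 1 - z 2)) * z j"
      unfolding rep by (simp only: restrict_apply if_True add_right_cancel)
    then have "z i = z j" using ne by simp
    then show "i = j" using inj_onD[OF z(2)] ij by blast
  qed
  show "ratio i j P = normal_rep n P i - normal_rep n P j" if "i \<in> {1..n}" "j \<in> {1..n}" for i j
  proof -
    have "normal_rep n P i - normal_rep n P j = (z i - z j) / (z 1 - z 2)"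
      unfolding rep using that by (simp add: diff_divide_distrib)
    then show ?thesis using ratio_affine_class[OF that assms(2), of z] z(3) by simp
  qed
qed

lemma ratio_nonzero:
  assumes "P \<in> topspace (dA_complement n)" "n \<ge> 2" "i \<in> {1..n}" "j \<in> {1..n}" "i \<noteq> j"
  shows "ratio i j P \<noteq> 0"
  using normal_rep_props[OF assms(1,2)] assms(3-5) by (auto dest: inj_onD)

text \<open>Points of the configuration space are extensional functions: outside
  \<open>{1..n}\<close> their coordinates are constantly \<open>undefined\<close>, hence continuous.
  This embeds the space into all functions, where continuity can be checked by the usual
  rules.\<close>

lemma continuous_map_config:
  assumes "continuous_on {z. inj_on z {1..n}} f"
  shows "continuous_map (config_space n) euclidean f"
proof -
  have "continuous_map (product_topology (\<lambda>_. euclidean) {1..n})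
      (product_topology (\<lambda>_. euclidean :: complex topology) UNIV) (\<lambda>z. z)"
    unfolding continuous_map_componentwise_UNIV
  proof
    fix k :: nat
    show "continuous_map (product_topology (\<lambda>_. euclidean :: complex topology) {1..n}) euclidean (\<lambda>z. z k)"
    proof (cases "k \<in> {1..n}")
      case True
      then show ?thesis by (rule continuous_map_product_projection)
    next
      case False
      have "continuous_map (product_topology (\<lambda>_. euclidean :: complex topology) {1..n}) euclidean (\<lambda>z. undefined)"
        by simp
      then show ?thesis
        by (rule continuous_map_eq) (use False in \<open>auto simp: PiE_def extensional_def\<close>)
    qed
  qed
  then have "continuous_map (config_space n) (top_of_set {z. inj_on z {1..n}}) (\<lambda>z. z)"
    unfolding config_space_def euclidean_product_topology
    by (auto simp: continuous_map_in_subtopology intro: continuous_map_from_subtopology)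
  from continuous_map_compose[OF this, of euclidean f] show ?thesis
    using assms by (simp add: comp_def)
qed

lemma continuous_on_coord_fun [continuous_intros]: "continuous_on S (\<lambda>z :: nat \<Rightarrow> complex. z i)"
  by (rule continuous_on_subset[OF continuous_on_product_coordinates]) simp

lemma continuous_map_from_dA:
  assumes "continuous_map (config_space n) Y (\<lambda>z. f (affine_class n z))"
  shows "continuous_map (dA_complement n) Y f"
  unfolding dA_complement_def
  by (rule continuous_compose_quotient_map[OF quotient_map_quotient_topology])
    (use assms in \<open>simp add: comp_def\<close>)

lemma continuous_map_affine_class:
  "continuous_map (config_space n) (dA_complement n) (affine_class n)"
  unfolding dA_complement_def by (rule quotient_imp_continuous_map[OF quotient_map_quotient_topology])

lemma continuous_map_ratio:
  assumes "i \<in> {1..n}" "j \<in> {1..n}" "n \<ge> 2"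
  shows "continuous_map (dA_complement n) euclidean (ratio i j)"
proof (rule continuous_map_from_dA)
  have "continuous_on {z. inj_on z {1..n}} (\<lambda>z. (z i - z j) / (z 1 - z 2) :: complex)"
    using assms(3) by (intro continuous_intros) (auto dest: inj_onD[of _ _ 1 2])
  then show "continuous_map (config_space n) euclidean (\<lambda>z. ratio i j (affine_class n z))"
    unfolding ratio_affine_class[OF assms] by (rule continuous_map_config)
qed

text \<open>A finite sum of fixed vectors with the coordinates as coefficients: this reduces
  continuity into the supremum norm to continuity of the coordinates.\<close>

lemma pad_sum:
  "pad n z = (\<Sum>i\<in>{1..n}. Re (z i) *\<^sub>R pad n (\<lambda>k. if k = i then 1 else 0) +
     Im (z i) *\<^sub>R pad n (\<lambda>k. if k = i then \<i> else 0))"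
proof (rule bcontfun_eqI)
  fix k
  interpret bounded_linear "\<lambda>x :: nat \<Rightarrow>\<^sub>C complex. apply_bcontfun x k" by (rule bounded_linear_coord)
  have eq: "apply_bcontfun (\<Sum>i\<in>{1..n}. Re (z i) *\<^sub>R pad n (\<lambda>k. if k = i then 1 else 0) +
      Im (z i) *\<^sub>R pad n (\<lambda>k. if k = i then \<i> else 0)) k =
      (\<Sum>i\<in>{1..n}. if k = i then complex_of_real (Re (z i)) + \<i> * complex_of_real (Im (z i)) else 0)"
    unfolding sum
    by (rule sum.cong) (auto simp: add scale pad_apply scaleR_conv_of_real mult.commute)
  show "apply_bcontfun (pad n z) k = apply_bcontfun (\<Sum>i\<in>{1..n}. Re (z i) *\<^sub>R pad n (\<lambda>k. if k = i then 1 else 0) +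
      Im (z i) *\<^sub>R pad n (\<lambda>k. if k = i then \<i> else 0)) k"
    unfolding eq by (simp add: pad_apply complex_eq[symmetric])
qed

definition dA_section :: "nat \<Rightarrow> (nat \<Rightarrow> complex) set \<Rightarrow> nat \<Rightarrow>\<^sub>C complex" where
  "dA_section n P = pad n (normal_rep n P)"

definition dA_projection :: "nat \<Rightarrow> (nat \<Rightarrow>\<^sub>C complex) \<Rightarrow> (nat \<Rightarrow> complex) set" where
  "dA_projection n x = affine_class n (restrict (apply_bcontfun x) {1..n})"

lemma continuous_map_dA_section:
  assumes "n \<ge> 2"
  shows "continuous_map (dA_complement n) (top_of_set (braid_complement n)) (dA_section n)"
proof -
  let ?r = "\<lambda>z i. (z i - z 1) / (z 1 - z 2) :: complex"
  have "continuous_map (dA_complement n) euclidean (dA_section n)"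
  proof (rule continuous_map_from_dA)
    have "continuous_on {z. inj_on z {1..n}} (\<lambda>z. pad n (?r z))"
      unfolding pad_sum[of n "?r _"]
      using assms by (intro continuous_intros) (auto dest: inj_onD[of _ _ 1 2])
    moreover have "dA_section n (affine_class n z) = pad n (?r z)" for z
      using ratio_affine_class[of _ n 1 z] assms
      by (auto simp: dA_section_def normal_rep_def pad_apply intro!: bcontfun_eqI)
    ultimately show "continuous_map (config_space n) euclidean (\<lambda>z. dA_section n (affine_class n z))"
      by (simp add: continuous_map_config)
  qed
  moreover have "dA_section n P \<in> braid_complement n" if "P \<in> topspace (dA_complement n)" for P
  proof -
    have "inj_on (apply_bcontfun (dA_section n P)) {1..n} = inj_on (normal_rep n P) {1..n}"
      by (rule inj_on_cong) (simp add: dA_section_def pad_apply)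
    then show ?thesis using normal_rep_props(2)[OF that assms] by (simp add: braid_complement_def)
  qed
  ultimately show ?thesis by (auto simp: continuous_map_in_subtopology)
qed

lemma continuous_map_dA_projection:
  "continuous_map (top_of_set (braid_complement n)) (dA_complement n) (dA_projection n)"
proof -
  have "continuous_map (top_of_set (braid_complement n)) (config_space n)
      (\<lambda>x. restrict (apply_bcontfun x) {1..n})"
    unfolding config_space_def
    by (auto simp: continuous_map_in_subtopology continuous_map_componentwise continuous_on_coord
        braid_complement_def)
  from continuous_map_compose[OF this continuous_map_affine_class] show ?thesis
    by (simp add: comp_def dA_projection_def[abs_def])
qed

lemma dA_projection_section:
  assumes "P \<in> topspace (dA_complement n)" "n \<ge> 2"
  shows "dA_projection n (dA_section n P) = P"
proof -
  have "restrict (apply_bcontfun (dA_section n P)) {1..n} = normal_rep n P"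
    by (auto simp: dA_section_def pad_apply normal_rep_def fun_eq_iff)
  then show ?thesis using normal_rep_props(1)[OF assms] by (simp add: dA_projection_def)
qed

text \<open>The quotient map from the braid complement has a continuous section, the normalised
  representative. The cocycle is pulled back along the quotient map, decomposed there, and brought
  back along the section, on which the forms become the ratios.\<close>

theorem cocycle_on_dA:
  assumes u: "cocycle1 (dA_complement n) u" and n: "n \<ge> 2"
  shows "\<exists>c g. primitive (dA_complement n) (\<lambda>s. u s - (\<Sum>(i, j)\<in>pairs n. c (i, j) * dlog (ratio i j) s)) g"
proof -
  let ?X = "dA_complement n" and ?q = "dA_projection n" and ?\<sigma> = "dA_section n"
  have "cocycle1 (top_of_set (braid_complement n)) (\<lambda>s. u (simplex_map 1 ?q s))"
    by (rule cocycle1_pullback[OF u continuous_map_dA_projection])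
  then obtain c g where cg: "primitive (top_of_set (braid_complement n))
      (\<lambda>s. u (simplex_map 1 ?q s) - (\<Sum>p\<in>pairs n. c p * dlog (braid_form p) s)) g"
    using cocycle_on_braid_complement by blast
  have "u s - (\<Sum>(i, j)\<in>pairs n. c (i, j) * dlog (ratio i j) s) =
      g (?\<sigma> (s (edge_point 1))) - g (?\<sigma> (s (edge_point 0)))" if s: "singular_simplex 1 ?X s" for s
  proof -
    let ?s = "simplex_map 1 ?\<sigma> s"
    have s': "singular_simplex 1 (top_of_set (braid_complement n)) ?s"
      by (rule singular_simplex_simplex_map[OF s continuous_map_dA_section[OF n]])
    have "simplex_map 1 ?q ?s = simplex_map 1 (?q \<circ> ?\<sigma>) s" by (simp add: simplex_map_compose)
    also have "\<dots> = s" by (rule simplex_map_id_gen[OF s]) (simp add: dA_projection_section n)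
    finally have us: "u (simplex_map 1 ?q ?s) = u s" by simp
    have dl: "dlog (braid_form (i, j)) ?s = dlog (ratio i j) s" if "(i, j) \<in> pairs n" for i j
      unfolding dlog_simplex_map
    proof (rule dlog_cong[OF s])
      fix P assume "P \<in> topspace ?X"
      then show "braid_form (i, j) (?\<sigma> P) = ratio i j P"
        using that normal_rep_props(3)[OF _ n, of P i j]
        by (simp add: braid_form_def dA_section_def pad_apply pairs_def)
    qed
    have "u (simplex_map 1 ?q ?s) - (\<Sum>p\<in>pairs n. c p * dlog (braid_form p) ?s) =
        g (?s (edge_point 1)) - g (?s (edge_point 0))"
      by (rule cg[unfolded primitive_def, rule_format, OF s'])
    moreover have "(\<Sum>p\<in>pairs n. c p * dlog (braid_form p) ?s) =
        (\<Sum>(i, j)\<in>pairs n. c (i, j) * dlog (ratio i j) s)"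
      by (rule sum.cong) (auto simp: dl[unfolded One_nat_def])
    moreover have "?s (edge_point 0) = ?\<sigma> (s (edge_point 0))" "?s (edge_point 1) = ?\<sigma> (s (edge_point 1))"
      using edge_point_in_simplex[of 0] edge_point_in_simplex[of 1] by (simp_all add: simplex_map_def)
    ultimately show ?thesis by (simp only: us)
  qed
  then have "primitive ?X (\<lambda>s. u s - (\<Sum>(i, j)\<in>pairs n. c (i, j) * dlog (ratio i j) s)) (\<lambda>P. g (?\<sigma> P))"
    unfolding primitive_def by blast
  then show ?thesis by blast
qed

subsection \<open>The extended action\<close>

text \<open>Determinants of the homogeneous coordinates (1, 0) of infinity and (z i, 1) of the other
  points, scaled so that z 1 - z 2 = 1. Those involving infinity would be 1 or -1; their sign is
  dropped because \<open>dlog\<close> does not see constants.\<close>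

definition bracket :: "nat \<Rightarrow> nat \<Rightarrow> (nat \<Rightarrow> complex) set \<Rightarrow> complex" where
  "bracket i j P = (if i = 0 \<or> j = 0 then 1 else ratio i j P)"

text \<open>If the point labelled \<open>r 0\<close> is not at infinity, it is moved there by \<open>x \<mapsto> 1 / (x - z (r 0))\<close>.\<close>

definition relabel :: "(nat \<Rightarrow> nat) \<Rightarrow> (nat \<Rightarrow> complex) \<Rightarrow> nat \<Rightarrow> complex" where
  "relabel r z i = (if r 0 = 0 then z (r i) else if r i = 0 then 0 else 1 / (z (r i) - z (r 0)))"

lemma permute_moduli_class:
  assumes "inv_into UNIV q permutes {0..n}"
  shows "permute_points {0..n} q (moduli_class n x) =
    moduli_class n (restrict (x \<circ> inv_into UNIV q) {0..n})"
proof -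
  let ?r = "inv_into UNIV q"
  have "restrict (restrict (m \<circ> x) {0..n} \<circ> ?r) {0..n} =
      restrict (m \<circ> restrict (x \<circ> ?r) {0..n}) {0..n}" for m :: "complex option \<Rightarrow> complex option"
    using permutes_in_image[OF assms] by (auto simp: restrict_def fun_eq_iff)
  then show ?thesis
    unfolding permute_points_def moduli_class_def by (auto simp: image_def)
qed

lemma relabel_moebius:
  assumes r: "r permutes {0..n}" and z: "inj_on z {1..n}"
  shows "\<exists>m\<in>PGL2. restrict (m \<circ> restrict (add_infinity n z \<circ> r) {0..n}) {0..n} = add_infinity n (relabel r z)"
proof (cases "r 0 = 0")
  case True
  have "restrict (id \<circ> restrict (add_infinity n z \<circ> r) {0..n}) {0..n} = add_infinity n (relabel r z)"
  proof
    fix i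
    have "r i \<noteq> 0" if "i \<noteq> 0"
      using permutes_inj[OF r] True that by (metis injD)
    then show "restrict (id \<circ> restrict (add_infinity n z \<circ> r) {0..n}) {0..n} i = add_infinity n (relabel r z) i"
      using permutes_in_image[OF r, of i] True by (auto simp: add_infinity_def relabel_def)
  qed
  then show ?thesis using id_PGL2 by blast
next
  case False
  let ?m = "Defs.moebius 0 1 1 (- z (r 0))"
  have "?m \<in> PGL2" by (rule PGL2I) simp
  moreover have "restrict (?m \<circ> restrict (add_infinity n z \<circ> r) {0..n}) {0..n} = add_infinity n (relabel r z)"
  proof
    fix i
    show "restrict (?m \<circ> restrict (add_infinity n z \<circ> r) {0..n}) {0..n} i = add_infinity n (relabel r z) i"
    proof (cases "i \<in> {0..n}")
      case True
      have ri: "r i \<in> {0..n}" "r 0 \<in> {0..n}" using permutes_in_image[OF r] True by auto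
      have "z (r i) \<noteq> z (r 0)" if "i \<noteq> 0" "r i \<noteq> 0"
      proof
        assume "z (r i) = z (r 0)"
        then have "r i = r 0" using inj_onD[OF z, of "r i" "r 0"] that(2) ri \<open>r 0 \<noteq> 0\<close> by auto
        then show False using that(1) permutes_inj[OF r] by (metis injD)
      qed
      then show ?thesis using True ri \<open>r 0 \<noteq> 0\<close> by (auto simp: add_infinity_def relabel_def)
    next
      case False
      then show ?thesis by (simp add: add_infinity_def)
    qed
  qed
  ultimately show ?thesis by blast
qed

text \<open>The identity 1 / a - 1 / b = (b - a) / (a b) cleared of denominators, with a factor 1
  wherever infinity is involved, so that one formula covers all positions of infinity. The sign will
  disappear under \<open>dlog\<close>.\<close>

lemma relabel_diff:
  assumes "r permutes {0..n}" "inj_on z {1..n}" "i \<in> {1..n}" "j \<in> {1..n}"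
  shows "(relabel r z i - relabel r z j) *
      ((if r i = 0 \<or> r 0 = 0 then 1 else z (r i) - z (r 0)) * (if r j = 0 \<or> r 0 = 0 then 1 else z (r j) - z (r 0))) =
    (if r 0 = 0 \<or> r j = 0 then 1 else - 1) * (if r i = 0 \<or> r j = 0 then if i = j then 0 else 1 else z (r i) - z (r j))"
proof -
  have inj: "r k = r l \<longleftrightarrow> k = l" for k l using permutes_inj[OF assms(1)] by (auto dest: injD)
  have ne: "z (r k) - z (r 0) \<noteq> 0" if "k \<in> {1..n}" "r k \<noteq> 0" "r 0 \<noteq> 0" for k
  proof
    assume "z (r k) - z (r 0) = 0"
    moreover have "r k \<in> {1..n}" "r 0 \<in> {1..n}"
      using permutes_in_image[OF assms(1), of k] permutes_in_image[OF assms(1), of 0] that by auto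
    ultimately have "r k = r 0" using inj_onD[OF assms(2)] by simp
    then show False using inj that(1) by auto
  qed
  have "r i = 0 \<Longrightarrow> r j = 0 \<Longrightarrow> i = j" using inj by metis
  moreover have "r 0 = 0 \<Longrightarrow> r i \<noteq> 0 \<and> r j \<noteq> 0" using inj assms(3,4) by (metis atLeastAtMost_iff not_one_le_zero)
  moreover have "i = j \<Longrightarrow> z (r i) = z (r j)" by simp
  moreover have "(1 / a - 1 / b) * (a * b) = b - a" if "a \<noteq> 0" "b \<noteq> 0" for a b :: complex
    using that by (simp add: field_simps)
  ultimately show ?thesis
    using ne[OF assms(3)] ne[OF assms(4)] unfolding relabel_def
    by (cases "r 0 = 0"; cases "r i = 0"; cases "r j = 0") auto
qed

lemma inj_on_relabel:
  assumes r: "r permutes {0..n}" and z: "inj_on z {1..n}"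
  shows "inj_on (relabel r z) {1..n}"
proof (rule inj_onI, rule ccontr)
  fix i j assume ij: "i \<in> {1..n}" "j \<in> {1..n}" "relabel r z i = relabel r z j" "i \<noteq> j"
  have "r i \<noteq> r j" using permutes_inj[OF r] ij(4) by (auto dest: injD)
  moreover have "r i \<in> {0..n}" "r j \<in> {0..n}"
    using permutes_in_image[OF r] ij(1,2) by auto
  ultimately have "z (r i) \<noteq> z (r j)" if "r i \<noteq> 0" "r j \<noteq> 0"
    using inj_onD[OF z, of "r i" "r j"] that by auto
  then show False
    using relabel_diff[OF r z ij(1,2)] ij(3,4) by (auto split: if_splits)
qed

text \<open>The Moebius map that restores infinity does not change the moduli class, and
  \<open>to_moduli\<close> is injective; so the action, defined through an inverse of
  \<open>to_moduli\<close>, gets an explicit formula.\<close>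

lemma extended_action_affine_class:
  assumes q: "q permutes {0..n}" and z: "inj_on z {1..n}"
  shows "extended_action n q (affine_class n z) = affine_class n (relabel (inv_into UNIV q) z)"
proof -
  let ?r = "inv_into UNIV q" and ?w = "relabel (inv_into UNIV q) z"
  have r: "?r permutes {0..n}" by (rule permutes_inv[OF q])
  obtain m where m: "m \<in> PGL2"
      "restrict (m \<circ> restrict (add_infinity n z \<circ> ?r) {0..n}) {0..n} = add_infinity n ?w"
    using relabel_moebius[OF r z] by blast
  have "permute_points {0..n} q (to_moduli n (affine_class n z)) =
      moduli_class n (restrict (add_infinity n z \<circ> ?r) {0..n})"
    by (simp add: to_moduli_class permute_moduli_class[OF r])
  also have "\<dots> = moduli_class n (add_infinity n ?w)"
    unfolding m(2)[symmetric] by (rule moduli_class_step[OF m(1), symmetric])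
  also have "\<dots> = to_moduli n (affine_class n ?w)" by (simp add: to_moduli_class)
  finally show ?thesis
    unfolding extended_action_def
    using inv_into_f_f[OF bij_betw_imp_inj_on[OF bij_betw_to_moduli] affine_class_in_dA[OF inj_on_relabel[OF r z]]]
    by simp
qed

text \<open>A permutation fixing 0 leaves infinity in place and merely permutes the coordinates.
  This reduces the second isomorphism to the extended action.\<close>

lemma extended_action_restrict:
  assumes q: "q permutes {1..n}" and P: "P \<in> topspace (dA_complement n)"
  shows "permute_points {1..n} q P = extended_action n q P"
proof -
  obtain z where z: "inj_on z {1..n}" "P = affine_class n z" using in_topspace_dA[OF P] .
  let ?r = "inv_into UNIV q"
  have r: "?r permutes {1..n}" by (rule permutes_inv[OF q])
  have q0: "q permutes {0..n}" by (rule permutes_subset[OF q]) auto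
  have "?r 0 = 0" using permutes_not_in[OF r, of 0] by simp
  then have "extended_action n q P = affine_class n (z \<circ> ?r)"
    unfolding z(2) extended_action_affine_class[OF q0 z(1)] relabel_def[abs_def] by (simp add: comp_def)
  moreover have "permute_points {1..n} q P = affine_class n (z \<circ> ?r)"
  proof -
    have "restrict (restrict (\<lambda>i. a * z i + b) {1..n} \<circ> ?r) {1..n} =
        restrict (\<lambda>i. a * (z \<circ> ?r) i + b) {1..n}" for a b
      using permutes_in_image[OF r] by (auto simp: restrict_def fun_eq_iff)
    moreover have "g ` {f a b |a b. a \<noteq> 0} = {g (f a b) |a b. a \<noteq> 0}"
      for g :: "(nat \<Rightarrow> complex) \<Rightarrow> nat \<Rightarrow> complex" and f :: "complex \<Rightarrow> complex \<Rightarrow> nat \<Rightarrow> complex"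
      by blast
    ultimately show ?thesis unfolding z(2) permute_points_def affine_class_def by simp
  qed
  ultimately show ?thesis by simp
qed

lemma continuous_map_extended_action:
  assumes q: "q permutes {0..n}"
  shows "continuous_map (dA_complement n) (dA_complement n) (extended_action n q)"
proof (rule continuous_map_from_dA)
  let ?r = "inv_into UNIV q"
  have r: "?r permutes {0..n}" by (rule permutes_inv[OF q])
  let ?f = "\<lambda>z. restrict (relabel ?r z) {1..n}"
  have "continuous_on {z. inj_on z {1..n}} (\<lambda>z. relabel ?r z i)" if i: "i \<in> {1..n}" for i
  proof (cases "?r 0 = 0 \<or> ?r i = 0")
    case True
    then consider "?r 0 = 0" | "?r 0 \<noteq> 0" "?r i = 0" by auto
    then show ?thesis by cases (simp_all add: relabel_def continuous_on_coord_fun)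
  next
    case False
    have "?r i \<noteq> ?r 0" using permutes_inj[OF r] i by (auto dest: injD)
    moreover have "?r i \<in> {1..n}" "?r 0 \<in> {1..n}"
      using permutes_in_image[OF r, of i] permutes_in_image[OF r, of 0] i False by auto
    ultimately have "x (?r i) \<noteq> x (?r 0)" if "inj_on x {1..n}" for x :: "nat \<Rightarrow> complex"
      using inj_onD[OF that] by blast
    then have "continuous_on {z. inj_on z {1..n}} (\<lambda>z. 1 / (z (?r i) - z (?r 0)) :: complex)"
      by (intro continuous_intros) auto
    then show ?thesis using False unfolding relabel_def by simp
  qed
  then have "continuous_map (config_space n) (product_topology (\<lambda>_. euclidean) {1..n}) ?f"
    by (auto simp: continuous_map_componentwise intro!: continuous_map_config)
  moreover have "inj_on (?f z) {1..n}" if "z \<in> topspace (config_space n)" for z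
  proof -
    have "inj_on z {1..n}" using that by (simp add: topspace_config)
    then have "inj_on (relabel ?r z) {1..n}" by (rule inj_on_relabel[OF r])
    then show ?thesis by (simp only: inj_on_restrict_eq)
  qed
  ultimately have "continuous_map (config_space n) (config_space n) ?f"
    by (subst (2) config_space_def) (auto simp: continuous_map_in_subtopology)
  from continuous_map_compose[OF this continuous_map_affine_class]
  have "continuous_map (config_space n) (dA_complement n) (\<lambda>z. affine_class n (?f z))"
    by (simp add: comp_def)
  moreover have "affine_class n (?f z) = extended_action n q (affine_class n z)"
    if "z \<in> topspace (config_space n)" for z
    using that affine_class_eq[of 1 n "relabel ?r z" 0]
    by (simp add: topspace_config extended_action_affine_class[OF q])
  ultimately show "continuous_map (config_space n) (dA_complement n) (\<lambda>z. extended_action n q (affine_class n z))"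
    by (rule continuous_map_eq)
qed

section \<open>Brackets and their transformation law\<close>

lemma continuous_map_bracket:
  assumes "i \<in> {0..n}" "j \<in> {0..n}" "n \<ge> 2"
  shows "continuous_map (dA_complement n) euclidean (bracket i j)"
proof (cases "i = 0 \<or> j = 0")
  case True
  then show ?thesis by (auto simp: bracket_def[abs_def])
next
  case False
  then have "bracket i j = ratio i j" by (auto simp: bracket_def)
  then show ?thesis using False assms by (simp add: continuous_map_ratio)
qed

lemma bracket_nonzero:
  assumes "P \<in> topspace (dA_complement n)" "n \<ge> 2" "i \<in> {0..n}" "j \<in> {0..n}" "i \<noteq> j"
  shows "bracket i j P \<noteq> 0"
  using ratio_nonzero[OF assms(1,2), of i j] assms(3-5) by (simp add: bracket_def)

lemma dlog_bracket_commute: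
  assumes s: "singular_simplex 1 (dA_complement n) s"
    and "i \<in> {0..n}" "j \<in> {0..n}" "i \<noteq> j" "n \<ge> 2"
  shows "dlog (bracket i j) s = dlog (bracket j i) s"
proof -
  have "dlog (bracket i j) s = dlog (\<lambda>P. (if i = 0 \<or> j = 0 then 1 else - 1) * bracket j i P) s"
  proof (rule dlog_cong[OF s])
    fix P assume "P \<in> topspace (dA_complement n)"
    then show "bracket i j P = (if i = 0 \<or> j = 0 then 1 else - 1) * bracket j i P"
      using normal_rep_props(3)[of P n i j] normal_rep_props(3)[of P n j i] assms(2-5)
      by (simp add: bracket_def)
  qed
  also have "\<dots> = dlog (bracket j i) s"
    using assms bracket_nonzero continuous_map_bracket by (intro dlog_cmult[OF s]) auto
  finally show ?thesis .
qed

text \<open>The transformation laws of the differences (i, j) and (1, 2) divided by each other, then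
  cleared of denominators: a relation between products, which \<open>dlog\<close> turns into one
  between sums.\<close>

lemma ratio_extended_action:
  assumes q: "q permutes {0..n}" and n: "n \<ge> 2" and P: "P \<in> topspace (dA_complement n)"
    and ij: "i \<in> {1..n}" "j \<in> {1..n}" "i \<noteq> j"
  defines "r \<equiv> inv_into UNIV q"
  shows "ratio i j (extended_action n q P) * (bracket (r i) (r 0) P * (bracket (r j) (r 0) P * bracket (r 1) (r 2) P)) =
    ((if r 0 = 0 \<or> r j = 0 then 1 else - 1) * (if r 0 = 0 \<or> r 2 = 0 then 1 else - 1)) *
      (bracket (r i) (r j) P * (bracket (r 1) (r 0) P * bracket (r 2) (r 0) P))"
proof -
  have r: "r permutes {0..n}" unfolding r_def by (rule permutes_inv[OF q])
  let ?z = "normal_rep n P" and ?w = "relabel r (normal_rep n P)"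
  note z = normal_rep_props[OF P n]
  have inj: "r k = r l \<longleftrightarrow> k = l" for k l using permutes_inj[OF r] by (auto dest: injD)
  have br: "bracket (r k) (r l) P = (if r k = 0 \<or> r l = 0 then 1 else ?z (r k) - ?z (r l))"
    if "k \<in> {0..n}" "l \<in> {0..n}" for k l
    using z(3)[of "r k" "r l"] permutes_in_image[OF r, of k] permutes_in_image[OF r, of l] that
    by (simp add: bracket_def)
  define e where "e = (\<lambda>l. if r 0 = 0 \<or> r l = 0 then 1 else - 1 :: complex)"
  have diff: "(?w k - ?w l) * (bracket (r k) (r 0) P * bracket (r l) (r 0) P) = e l * bracket (r k) (r l) P"
    if "k \<in> {1..n}" "l \<in> {1..n}" "k \<noteq> l" for k l
    using relabel_diff[OF r z(2) that(1,2)] that by (simp add: br e_def)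
  have "inj_on ?w {1..n}" by (rule inj_on_relabel[OF r z(2)])
  then have ne: "?w 1 - ?w 2 \<noteq> 0" using n by (auto dest: inj_onD[of _ _ 1 2])
  have ee: "e 2 * e 2 = 1" by (simp add: e_def)
  have "extended_action n q P = affine_class n ?w"
    using extended_action_affine_class[OF q z(2)] z(1) by (simp add: r_def)
  then have R: "ratio i j (extended_action n q P) * (?w 1 - ?w 2) = ?w i - ?w j"
    using ratio_affine_class[OF ij(1,2) n, of ?w] ne by simp
  define X where "X = ratio i j (extended_action n q P)"
  define W where "W = ?w 1 - ?w 2"
  define A where "A = bracket (r i) (r 0) P"
  define B where "B = bracket (r j) (r 0) P"
  define C where "C = bracket (r 1) (r 2) P"
  define E where "E = bracket (r i) (r j) P"
  define F where "F = bracket (r 1) (r 0) P"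
  define G where "G = bracket (r 2) (r 0) P"
  have 1: "X * W * (A * B) = e j * E"
    using diff[OF ij] R by (simp add: X_def W_def A_def B_def E_def)
  have 2: "W * (F * G) = e 2 * C"
    using diff[of 1 2] n by (simp add: W_def F_def G_def C_def)
  have "(X * (A * (B * C))) * W = (X * W * (A * B)) * C" by (simp add: mult_ac)
  also have "\<dots> = e j * E * (e 2 * (e 2 * C))" using 1 ee by (simp add: mult_ac)
  also have "\<dots> = (e j * e 2 * (E * (F * G))) * W" unfolding 2[symmetric] by (simp add: mult_ac)
  finally have "X * (A * (B * C)) = e j * e 2 * (E * (F * G))" using ne by (simp add: W_def)
  then show ?thesis by (simp only: X_def A_def B_def C_def E_def F_def G_def e_def)
qed

text \<open>Besides permuting labels, the action contributes terms that depend on one index only,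
  and a constant \<open>t\<close> from the normalisation by the pair (1, 2). Vanishing vertex sums
  annihilate all of them.\<close>

lemma dlog_extended_action:
  assumes q: "q permutes {0..n}" and n: "n \<ge> 2" and s: "singular_simplex 1 (dA_complement n) s"
  defines "r \<equiv> inv_into UNIV q"
  shows "\<exists>t. \<forall>i\<in>{1..n}. \<forall>j\<in>{1..n}. i \<noteq> j \<longrightarrow>
    dlog (bracket i j) (simplex_map 1 (extended_action n q) s) =
      dlog (bracket (r i) (r j)) s - dlog (bracket (r i) (r 0)) s - dlog (bracket (r j) (r 0)) s + t"
proof -
  let ?X = "dA_complement n"
  have r: "r permutes {0..n}" unfolding r_def by (rule permutes_inv[OF q])
  have inj: "r k = r l \<longleftrightarrow> k = l" for k l using permutes_inj[OF r] by (auto dest: injD)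
  have rin: "r k \<in> {0..n}" if "k \<in> {0..n}" for k using permutes_in_image[OF r] that by blast
  have cont: "continuous_map ?X euclidean (bracket (r k) (r l))" if "k \<in> {0..n}" "l \<in> {0..n}" for k l
    using continuous_map_bracket[OF rin[OF that(1)] rin[OF that(2)] n] .
  have nz: "bracket (r k) (r l) P \<noteq> 0" if "k \<in> {0..n}" "l \<in> {0..n}" "k \<noteq> l" "P \<in> topspace ?X" for k l P
    using bracket_nonzero[OF that(4) n rin[OF that(1)] rin[OF that(2)]] inj that(3) by simp
  note ext = continuous_map_extended_action[OF q]
  let ?t = "dlog (bracket (r 1) (r 0)) s + dlog (bracket (r 2) (r 0)) s - dlog (bracket (r 1) (r 2)) s"
  have mult: "continuous_map ?X euclidean (\<lambda>P. f P * g P)"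
    if "continuous_map ?X euclidean f" "continuous_map ?X euclidean g" for f g :: "_ \<Rightarrow> complex"
  proof -
    have "continuous_map ?X (prod_topology euclidean euclidean) (\<lambda>P. (f P, g P))"
      using that by (simp only: continuous_map_paired)
    then have fg: "continuous_map ?X euclidean (\<lambda>P. (f P, g P))" by simp
    have "continuous_map euclidean euclidean (\<lambda>(x, y). x * y :: complex)"
      by (simp add: case_prod_unfold continuous_intros)
    from continuous_map_compose[OF fg this] show ?thesis by (simp add: comp_def)
  qed
  define unit where "unit = (\<lambda>f :: _ \<Rightarrow> complex. continuous_map ?X euclidean f \<and> (\<forall>P\<in>topspace ?X. f P \<noteq> 0))"
  have unit_mult: "unit (\<lambda>P. f P * g P)" if "unit f" "unit g" for f g
    using that mult by (simp add: unit_def)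
  have dlog_unit: "dlog (\<lambda>P. f P * g P) s = dlog f s + dlog g s" if "unit f" "unit g" for f g
    using that by (intro dlog_mult[OF s]) (auto simp: unit_def)
  have unit_br: "unit (bracket (r k) (r l))" if "k \<in> {0..n}" "l \<in> {0..n}" "k \<noteq> l" for k l
    using cont[OF that(1,2)] nz[OF that] by (simp add: unit_def)
  have "dlog (bracket i j) (simplex_map 1 (extended_action n q) s) =
      dlog (bracket (r i) (r j)) s - dlog (bracket (r i) (r 0)) s - dlog (bracket (r j) (r 0)) s + ?t"
    if ij: "i \<in> {1..n}" "j \<in> {1..n}" "i \<noteq> j" for i j
  proof -
    let ?f = "\<lambda>P. ratio i j (extended_action n q P)"
    have f: "continuous_map ?X euclidean ?f"
      using continuous_map_compose[OF ext continuous_map_ratio[OF ij(1,2) n]] by (simp add: comp_def)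
    have fnz: "?f P \<noteq> 0" if "P \<in> topspace ?X" for P
      using ratio_nonzero[OF _ n ij, of "extended_action n q P"] ext that by (auto simp: continuous_map_def)
    let ?e = "(if r 0 = 0 \<or> r j = 0 then 1 else - 1) * (if r 0 = 0 \<or> r 2 = 0 then 1 else - 1) :: complex"
    have in0: "i \<in> {0..n}" "j \<in> {0..n}" "0 \<in> {0..n}" "1 \<in> {0..n}" "2 \<in> {0..n}" using ij n by auto
    have ne: "i \<noteq> 0" "j \<noteq> 0" using ij by auto
    have u: "unit ?f" "unit (bracket (r i) (r 0))" "unit (bracket (r j) (r 0))" "unit (bracket (r 1) (r 2))"
        "unit (bracket (r i) (r j))" "unit (bracket (r 1) (r 0))" "unit (bracket (r 2) (r 0))"
      using f fnz by (simp add: unit_def) (use in0 ne ij(3) in \<open>auto intro!: unit_br\<close>)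
    have "dlog (\<lambda>P. ?f P * (bracket (r i) (r 0) P * (bracket (r j) (r 0) P * bracket (r 1) (r 2) P))) s =
        dlog (\<lambda>P. ?e * (bracket (r i) (r j) P * (bracket (r 1) (r 0) P * bracket (r 2) (r 0) P))) s"
      by (rule dlog_cong[OF s]) (use ratio_extended_action[OF q n _ ij] in \<open>simp add: r_def\<close>)
    moreover have "dlog (\<lambda>P. ?f P * (bracket (r i) (r 0) P * (bracket (r j) (r 0) P * bracket (r 1) (r 2) P))) s =
        dlog ?f s + (dlog (bracket (r i) (r 0)) s + (dlog (bracket (r j) (r 0)) s + dlog (bracket (r 1) (r 2)) s))"
      using u by (simp only: dlog_unit unit_mult)
    moreover have "dlog (\<lambda>P. ?e * (bracket (r i) (r j) P * (bracket (r 1) (r 0) P * bracket (r 2) (r 0) P))) s =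
        dlog (\<lambda>P. bracket (r i) (r j) P * (bracket (r 1) (r 0) P * bracket (r 2) (r 0) P)) s"
      using unit_mult[OF u(5) unit_mult[OF u(6,7)]] by (intro dlog_cmult[OF s]) (auto simp: unit_def)
    moreover have "dlog (\<lambda>P. bracket (r i) (r j) P * (bracket (r 1) (r 0) P * bracket (r 2) (r 0) P)) s =
        dlog (bracket (r i) (r j)) s + (dlog (bracket (r 1) (r 0)) s + dlog (bracket (r 2) (r 0)) s)"
      using u by (simp only: dlog_unit unit_mult)
    moreover have "dlog (bracket i j) (simplex_map 1 (extended_action n q) s) = dlog ?f s"
      unfolding dlog_simplex_map by (simp add: bracket_def ne)
    ultimately show ?thesis by (simp add: algebra_simps)
  qed
  then show ?thesis by blast
qed

text \<open>The kernel of the map from functions on edges to functions on vertices. Edges are sets,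
  which builds in symmetry; the diagonal term {i, i} of a vertex sum is a singleton, where
  \<open>a\<close> is 0.\<close>

definition edge_functions :: "nat set \<Rightarrow> (nat set \<Rightarrow> complex) set" where
  "edge_functions V = {a. (\<forall>e. a e \<noteq> 0 \<longrightarrow> e \<subseteq> V \<and> card e = 2) \<and> (\<forall>i\<in>V. (\<Sum>j\<in>V. a {i, j}) = 0)}"

text \<open>In terms of the homogeneous brackets of the marked points \<open>0, \<dots>, n\<close>, this is the differential
  \<open>\<Sum> a {i, j} dlog [i, j]\<close> over all edges; since the vertex sums of \<open>a\<close> vanish, it does not depend on the
  choice of homogeneous coordinates, which makes it equivariant.\<close>

definition edge_cochain :: "nat \<Rightarrow> (nat set \<Rightarrow> complex) \<Rightarrow> ((nat \<Rightarrow> real) \<Rightarrow> (nat \<Rightarrow> complex) set) \<Rightarrow> complex" where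
  "edge_cochain n a s = (if singular_simplex 1 (dA_complement n) s
     then (\<Sum>i\<in>{0..n}. \<Sum>j\<in>{0..n}. a {i, j} * dlog (bracket i j) s) / 2 else 0)"

lemma edge_functions_diag: "a \<in> edge_functions V \<Longrightarrow> a {i} = 0"
  by (auto simp: edge_functions_def)

theorem edge_cochain_extended_action:
  assumes q: "q permutes {0..n}" and n: "n \<ge> 2" and a: "a \<in> edge_functions {0..n}"
    and s: "singular_simplex 1 (dA_complement n) s"
  shows "edge_cochain n a (simplex_map 1 (extended_action n q) s) = edge_cochain n (\<lambda>e. a (q ` e)) s"
proof -
  define r where "r = inv_into UNIV q"
  let ?V = "{0..n}" and ?s = "simplex_map 1 (extended_action n q) s"
  define L where "L = (\<lambda>i j. dlog (bracket i j) s)"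
  define M where "M = (\<lambda>i j. dlog (bracket i j) ?s)"
  have r: "r permutes ?V" unfolding r_def by (rule permutes_inv[OF q])
  have s': "singular_simplex 1 (dA_complement n) ?s"
    by (rule singular_simplex_simplex_map[OF s continuous_map_extended_action[OF q]])
  obtain t where t: "\<And>i j. i \<in> {1..n} \<Longrightarrow> j \<in> {1..n} \<Longrightarrow> i \<noteq> j \<Longrightarrow>
      M i j = L (r i) (r j) - L (r i) (r 0) - L (r j) (r 0) + t"
    using dlog_extended_action[OF q n s] unfolding M_def L_def r_def by blast
  \<comment> \<open>The value - t at 0 is the one for which the formula for \<open>M\<close> also
    holds on edges at 0, where both sides are 0.\<close>
  define m where "m = (\<lambda>i. if i = 0 then - t else - L (r i) (r 0))"
  have "bracket 0 j = (\<lambda>P. 1)" "bracket j 0 = (\<lambda>P. 1)" for j by (simp_all add: bracket_def[abs_def])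
  then have M0: "M 0 j = 0" "M j 0 = 0" for j by (simp_all add: M_def dlog_const)
  have comm: "L (r 0) (r j) = L (r j) (r 0)" if "j \<in> {1..n}" for j
  proof -
    have "r 0 \<noteq> r j" using permutes_inj[OF r] that by (auto dest: injD)
    then show ?thesis unfolding L_def
      using that permutes_in_image[OF r] n by (intro dlog_bracket_commute[OF s]) auto
  qed
  have M: "M i j = L (r i) (r j) + m i + m j + t" if "i \<in> ?V" "j \<in> ?V" "i \<noteq> j" for i j
  proof (cases "i = 0 \<or> j = 0")
    case True
    then show ?thesis using that comm[of i] comm[of j] M0 by (auto simp: m_def)
  next
    case False
    then show ?thesis using that t[of i j] by (auto simp: m_def)
  qed
  have rows: "(\<Sum>j\<in>?V. a {i, j}) = 0" if "i \<in> ?V" for i using a that by (simp add: edge_functions_def)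
  have "(\<Sum>i\<in>?V. \<Sum>j\<in>?V. a {i, j} * M i j) = (\<Sum>i\<in>?V. \<Sum>j\<in>?V. a {i, j} * (L (r i) (r j) + m i + m j + t))"
    using M edge_functions_diag[OF a] by (intro sum.cong refl) (metis insert_absorb2 mult_zero_left)
  also have "\<dots> = (\<Sum>i\<in>?V. \<Sum>j\<in>?V. a {i, j} * L (r i) (r j)) + (\<Sum>i\<in>?V. m i * (\<Sum>j\<in>?V. a {i, j}))
      + (\<Sum>i\<in>?V. \<Sum>j\<in>?V. a {i, j} * m j) + t * (\<Sum>i\<in>?V. \<Sum>j\<in>?V. a {i, j})"
    by (simp add: distrib_left sum.distrib sum_distrib_left mult_ac)
  also have "(\<Sum>i\<in>?V. \<Sum>j\<in>?V. a {i, j} * m j) = (\<Sum>j\<in>?V. m j * (\<Sum>i\<in>?V. a {j, i}))"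
    by (subst sum.swap) (simp add: sum_distrib_left mult_ac insert_commute)
  finally have "(\<Sum>i\<in>?V. \<Sum>j\<in>?V. a {i, j} * M i j) = (\<Sum>i\<in>?V. \<Sum>j\<in>?V. a {i, j} * L (r i) (r j))"
    by (simp add: rows)
  \<comment> \<open>Reindexing by \<open>q\<close>, the inverse of \<open>r\<close>, moves the
    permutation from the differentials to the coefficients.\<close>
  also have "\<dots> = (\<Sum>k\<in>?V. \<Sum>j\<in>?V. a {q k, j} * L (r (q k)) (r j))"
    using sum.reindex_bij_betw[OF permutes_imp_bij[OF q],
        of "\<lambda>i. \<Sum>j\<in>?V. a {i, j} * L (r i) (r j)"] by simp
  also have "\<dots> = (\<Sum>k\<in>?V. \<Sum>l\<in>?V. a {q k, q l} * L (r (q k)) (r (q l)))"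
  proof (rule sum.cong[OF refl])
    fix k
    show "(\<Sum>j\<in>?V. a {q k, j} * L (r (q k)) (r j)) = (\<Sum>l\<in>?V. a {q k, q l} * L (r (q k)) (r (q l)))"
      using sum.reindex_bij_betw[OF permutes_imp_bij[OF q], of "\<lambda>j. a {q k, j} * L (r (q k)) (r j)"]
      by simp
  qed
  also have "\<dots> = (\<Sum>k\<in>?V. \<Sum>l\<in>?V. a (q ` {k, l}) * L k l)"
    using permutes_inverses(2)[OF q] by (simp add: r_def)
  finally show ?thesis using s s' by (simp add: edge_cochain_def M_def L_def)
qed

subsection \<open>The first cohomology module\<close>

text \<open>Staying closer to \<open>c\<close> than 0 is, the path keeps q / c in the right
  half-plane, where the principal logarithm is continuous.\<close>

lemma log_diff_loop:
  assumes q: "continuous_on {0..1} q" and near: "\<And>t. t \<in> {0..1} \<Longrightarrow> dist (q t) c < norm c" and "q 0 = q 1"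
  shows "log_diff q = 0"
proof -
  have c: "c \<noteq> 0" using near[of 0] by auto
  have re: "0 < Re (q t / c)" if "t \<in> {0..1}" for t
  proof -
    have "norm (q t / c - 1) = norm (q t - c) / norm c"
      using c by (simp add: norm_divide[symmetric] diff_divide_distrib)
    also have "\<dots> < 1" using near[OF that] c by (simp add: dist_norm)
    finally have "\<bar>Re (q t / c - 1)\<bar> < 1" using abs_Re_le_cmod[of "q t / c - 1"] by linarith
    then show ?thesis by simp
  qed
  have "log_diff q = (Ln (q 1 / c) + Ln c) - (Ln (q 0 / c) + Ln c)"
  proof (rule log_diff_eq[where l = "\<lambda>t. Ln (q t / c) + Ln c"])
    show "continuous_on {0..1} (\<lambda>t. Ln (q t / c) + Ln c)"
    proof (intro continuous_intros q)
      fix t :: real assume t: "t \<in> {0..1}"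
      show "q t / c \<notin> \<real>\<^sub>\<le>\<^sub>0" using re[OF t] by (auto simp: complex_nonpos_Reals_iff)
    qed (simp add: c)
    fix t :: real assume t: "t \<in> {0..1}"
    have "q t / c \<noteq> 0" using re[OF t] by auto
    then show "q t = exp (Ln (q t / c) + Ln c)" using c by (simp add: exp_add)
  qed
  then show ?thesis using assms(3) by simp
qed

text \<open>The \<open>k\<close>-th point runs once around the \<open>l\<close>-th one, the other points staying far away.\<close>

definition loop_config :: "nat \<Rightarrow> nat \<Rightarrow> real \<Rightarrow> nat \<Rightarrow> complex" where
  "loop_config k l t i = (if i = k then 3 * of_nat l + exp (2 * pi * \<i> * t) else 3 * of_nat i)"

lemma norm_exp_circle: "norm (exp (2 * pi * \<i> * complex_of_real t)) = 1"
  by (simp add: norm_exp_eq_Re)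

text \<open>The resting points are at least 3 apart, which exceeds the radius 1 of the loop.\<close>

lemma norm_three_diff:
  assumes "i \<noteq> (j::nat)" shows "3 \<le> norm (3 * complex_of_nat i - 3 * complex_of_nat j)"
proof -
  have "3 * complex_of_nat i - 3 * complex_of_nat j = of_int (3 * (int i - int j))" by simp
  also have "norm \<dots> = \<bar>real_of_int (3 * (int i - int j))\<bar>" by (simp only: norm_of_int)
  finally have "norm (3 * complex_of_nat i - 3 * complex_of_nat j) = of_int \<bar>3 * (int i - int j)\<bar>" by simp
  moreover have "3 \<le> \<bar>3 * (int i - int j)\<bar>" using assms by arith
  then have "real_of_int 3 \<le> of_int \<bar>3 * (int i - int j)\<bar>" by (simp only: of_int_le_iff)
  ultimately show ?thesis by simp
qed

text \<open>Only the difference of the points \<open>k\<close> and \<open>l\<close> winds around 0,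
  and it does so once; every other difference stays in a disc missing 0 or is constant.\<close>

lemma loop_config_log_diff:
  assumes "k \<noteq> l" "i \<noteq> j"
  shows "log_diff (\<lambda>t. loop_config k l t i - loop_config k l t j) =
    (if {i, j} = {k, l} then 2 * pi * \<i> else 0)"
proof -
  let ?e = "\<lambda>t::real. exp (2 * pi * \<i> * complex_of_real t)"
  consider "i = k" "j = l" | "i = l" "j = k" | "i = k" "j \<noteq> l" | "j = k" "i \<noteq> l" | "i \<noteq> k" "j \<noteq> k" by blast
  then show ?thesis
  proof cases
    case 1
    have "log_diff (\<lambda>t. loop_config k l t i - loop_config k l t j) = 2 * pi * \<i> * complex_of_real 1 - 2 * pi * \<i> * complex_of_real 0"
      by (rule log_diff_eq) (use 1 assms in \<open>auto simp: loop_config_def intro!: continuous_intros\<close>)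
    then show ?thesis using 1 by simp
  next
    case 2
    \<comment> \<open>Here the difference is minus the exponential, so its logarithm is shifted by
      pi i.\<close>
    have "log_diff (\<lambda>t. loop_config k l t i - loop_config k l t j) =
        (2 * pi * \<i> * complex_of_real 1 + pi * \<i>) - (2 * pi * \<i> * complex_of_real 0 + pi * \<i>)"
      by (rule log_diff_eq) (use 2 assms in \<open>auto simp: loop_config_def exp_add intro!: continuous_intros\<close>)
    then show ?thesis using 2 by (simp add: insert_commute)
  next
    case 3
    have "log_diff (\<lambda>t. loop_config k l t i - loop_config k l t j) = 0"
    proof (rule log_diff_loop)
      show "dist (loop_config k l t i - loop_config k l t j) (3 * of_nat l - 3 * of_nat j) < norm (3 * of_nat l - 3 * of_nat j :: complex)"
        for t
        using 3 assms norm_three_diff[of l j] norm_exp_circle[of t] by (simp add: loop_config_def dist_norm)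
    qed (use 3 assms in \<open>auto simp: loop_config_def intro!: continuous_intros\<close>)
    then show ?thesis using 3 assms by (auto simp: doubleton_eq_iff)
  next
    case 4
    have "log_diff (\<lambda>t. loop_config k l t i - loop_config k l t j) = 0"
    proof (rule log_diff_loop)
      show "dist (loop_config k l t i - loop_config k l t j) (3 * of_nat i - 3 * of_nat l) < norm (3 * of_nat i - 3 * of_nat l :: complex)"
        for t
        using 4 assms norm_three_diff[of i l] norm_exp_circle[of t] by (simp add: loop_config_def dist_norm)
    qed (use 4 assms in \<open>auto simp: loop_config_def intro!: continuous_intros\<close>)
    then show ?thesis using 4 assms by (auto simp: doubleton_eq_iff)
  next
    case 5
    have "3 * complex_of_nat i - 3 * of_nat j \<noteq> 0" using norm_three_diff[OF assms(2)] by auto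
    then show ?thesis using 5 log_diff_const by (auto simp: loop_config_def doubleton_eq_iff)
  qed
qed

lemma loop_config_nonzero:
  assumes "k \<noteq> l" "i \<noteq> j" shows "loop_config k l t i - loop_config k l t j \<noteq> 0"
proof
  assume 0: "loop_config k l t i - loop_config k l t j = 0"
  have *: False if "3 * complex_of_nat a - 3 * of_nat b = c" "a \<noteq> b" "norm c \<le> 1" for a b c
    using norm_three_diff[OF that(2)] that by simp
  have e: "norm (exp (2 * pi * \<i> * complex_of_real t)) \<le> 1" by (simp add: norm_exp_circle)
  consider "i = k" "j = l" | "i = l" "j = k" | "i = k" "j \<noteq> l" | "j = k" "i \<noteq> l" | "i \<noteq> k" "j \<noteq> k" by blast
  then show False
  proof cases
    case 3
    have "3 * complex_of_nat j - 3 * of_nat l = exp (2 * pi * \<i> * complex_of_real t)"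
      using 0 3 assms by (simp add: loop_config_def algebra_simps)
    then show ?thesis using *[OF _ 3(2) e] by blast
  next
    case 4
    have "3 * complex_of_nat i - 3 * of_nat l = exp (2 * pi * \<i> * complex_of_real t)"
      using 0 4 assms by (simp add: loop_config_def algebra_simps)
    then show ?thesis using *[OF _ 4(2) e] by blast
  qed (use 0 assms in \<open>auto simp: loop_config_def\<close>)
qed

text \<open>For a normalised ratio the increment is a difference of two winding terms; the second is
  that of the normalising pair (1, 2).\<close>

lemma loop_exists:
  assumes kl: "k \<noteq> l" and n: "n \<ge> 2"
  shows "\<exists>s. singular_simplex 1 (dA_complement n) s \<and> s (edge_point 0) = s (edge_point 1) \<and>
    (\<forall>i\<in>{1..n}. \<forall>j\<in>{1..n}. i \<noteq> j \<longrightarrow> dlog (bracket i j) s =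
       (if {i, j} = {k, l} then 2 * pi * \<i> else 0) - (if {1, 2} = {k, l} then 2 * pi * \<i> else 0))"
proof -
  let ?c = "\<lambda>t. affine_class n (restrict (loop_config k l t) {1..n})"
  have inj: "inj_on (loop_config k l t) {1..n}" for t
    using loop_config_nonzero[OF kl, of _ _ t] by (intro inj_onI) (metis right_minus_eq)
  have cont: "continuous_on {0..1} (\<lambda>t. loop_config k l t i)" for i
    unfolding loop_config_def by (cases "i = k") (auto intro!: continuous_intros)
  have "continuous_map (top_of_set {0..1}) (product_topology (\<lambda>_. euclidean) {1..n})
      (\<lambda>t. restrict (loop_config k l t) {1..n})"
    using cont by (auto simp: continuous_map_componentwise)
  then have "continuous_map (top_of_set {0..1}) (config_space n) (\<lambda>t. restrict (loop_config k l t) {1..n})"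
    using inj unfolding config_space_def
    by (auto simp: continuous_map_in_subtopology inj_on_restrict_eq simp del: One_nat_def)
  from continuous_map_compose[OF this continuous_map_affine_class]
  have c: "continuous_map (top_of_set {0..1}) (dA_complement n) ?c" by (simp add: comp_def)
  let ?s = "restrict (\<lambda>x. ?c (x 1)) (standard_simplex 1)"
  have s: "singular_simplex 1 (dA_complement n) ?s" by (rule singular_simplex_of_path[OF c])
  have val: "?s (edge_point t) = ?c t" if "t \<in> {0..1}" for t using edge_point_in_simplex[OF that] by simp
  have "loop_config k l 0 = loop_config k l 1" by (auto simp: loop_config_def)
  then have "?s (edge_point 0) = ?s (edge_point 1)" using val[of 0] val[of 1] by simp
  moreover have "dlog (bracket i j) ?s =
       (if {i, j} = {k, l} then 2 * pi * \<i> else 0) - (if {1, 2} = {k, l} then 2 * pi * \<i> else 0)"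
    if ij: "i \<in> {1..n}" "j \<in> {1..n}" "i \<noteq> j" for i j
  proof -
    let ?d = "\<lambda>i j t. loop_config k l t i - loop_config k l t j"
    let ?r = "\<lambda>t. ratio i j (?c t)"
    have r: "?r t * ?d 1 2 t = ?d i j t" for t
      using ratio_affine_class[OF ij(1,2) n, of "restrict (loop_config k l t) {1..n}"]
        loop_config_nonzero[OF kl, of 1 2 t] ij n by simp
    have "continuous_on {0..1} ?r"
      using continuous_map_compose[OF c continuous_map_ratio[OF ij(1,2) n]] by (simp add: comp_def)
    moreover have "?r t \<noteq> 0" for t
      using r[of t] loop_config_nonzero[OF kl ij(3), of t] by auto
    moreover have "continuous_on {0..1} (?d 1 2)" by (intro continuous_intros cont)
    moreover have "?d 1 2 t \<noteq> 0" for t using loop_config_nonzero[OF kl, of 1 2 t] by simp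
    ultimately have "log_diff (\<lambda>t. ?r t * ?d 1 2 t) = log_diff ?r + log_diff (?d 1 2)"
      by (intro log_diff_mult)
    then have "log_diff ?r = log_diff (?d i j) - log_diff (?d 1 2)" unfolding r by simp
    moreover have "dlog (bracket i j) ?s = log_diff ?r"
      unfolding dlog_def by (rule log_diff_cong) (use val ij in \<open>auto simp: bracket_def\<close>)
    ultimately show ?thesis
      using loop_config_log_diff[OF kl ij(3)] loop_config_log_diff[OF kl, of 1 2] by simp
  qed
  ultimately show ?thesis using s by blast
qed

text \<open>The vertex sum at i turns each inner row into - a {i, 0}, and these add up to 0 by the
  vertex sum at 0. On loops this cancels the contribution of the normalising pair (1, 2).\<close>

lemma edge_functions_inner_sum:
  assumes a: "a \<in> edge_functions {0..n}"
  shows "(\<Sum>i\<in>{1..n}. \<Sum>j\<in>{1..n}. a {i, j}) = 0"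
proof -
  have V: "{0..n} = insert 0 {1..n}" by auto
  have row: "a {i, 0} + (\<Sum>j\<in>{1..n}. a {i, j}) = 0" if "i \<in> {0..n}" for i
  proof -
    have "(\<Sum>j\<in>{0..n}. a {i, j}) = 0" using a that by (simp add: edge_functions_def)
    then show ?thesis unfolding V by simp
  qed
  have "(\<Sum>i\<in>{1..n}. a {i, 0}) = 0"
    using row[of 0] edge_functions_diag[OF a, of 0] by (simp add: insert_commute)
  moreover have "(\<Sum>i\<in>{1..n}. \<Sum>j\<in>{1..n}. a {i, j}) = (\<Sum>i\<in>{1..n}. - a {i, 0})"
    by (intro sum.cong refl) (use row in \<open>auto simp: add_eq_0_iff\<close>)
  ultimately show ?thesis by (simp add: sum_negf)
qed

lemma sum_bracket_zero:
  fixes f :: "nat \<Rightarrow> nat \<Rightarrow> complex"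
  assumes "\<And>j. f 0 j = 0" "\<And>i. f i 0 = 0"
  shows "(\<Sum>i\<in>{0..n}. \<Sum>j\<in>{0..n}. f i j) = (\<Sum>i\<in>{1..n}. \<Sum>j\<in>{1..n}. f i j)"
proof -
  have V: "{0..n} = insert 0 {1..n}" by auto
  show ?thesis unfolding V using assms by simp
qed

lemma dlog_bracket_0 [simp]: "dlog (bracket 0 j) s = 0" "dlog (bracket j 0) s = 0"
proof -
  have "bracket 0 j = (\<lambda>P. 1)" "bracket j 0 = (\<lambda>P. 1)" by (simp_all add: bracket_def[abs_def])
  then show "dlog (bracket 0 j) s = 0" "dlog (bracket j 0) s = 0" by (simp_all add: dlog_const)
qed

lemma sum_double_delta:
  fixes v :: complex
  assumes "finite R" "x \<in> R" "y \<in> R"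
  shows "(\<Sum>i\<in>R. \<Sum>j\<in>R. if i = x then if j = y then v else 0 else 0) = v"
proof -
  have "(\<Sum>j\<in>R. if i = x then if j = y then v else 0 else 0) = (if i = x then v else 0)" for i
    using assms(1,3) by (cases "i = x") simp_all
  then show ?thesis using assms(1,2) by (simp only: sum.delta if_True)
qed

text \<open>An exact cochain vanishes on closed edges. On the loop of \<open>k\<close> around
  \<open>l\<close> the value is 2 pi i a {k, l}, so \<open>a\<close> vanishes on the edges within
  \<open>{1..n}\<close>; the vertex sums then kill the edges at 0.\<close>

lemma edge_cochain_exact_imp_zero:
  assumes a: "a \<in> edge_functions {0..n}" and n: "n \<ge> 2"
    and g: "primitive (dA_complement n) (edge_cochain n a) g"
  shows "a = (\<lambda>e. 0)"
proof -
  have inner: "a {k, l} = 0" if kl: "k \<in> {1..n}" "l \<in> {1..n}" "k \<noteq> l" for k l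
  proof -
    obtain s where s: "singular_simplex 1 (dA_complement n) s" "s (edge_point 0) = s (edge_point 1)"
      and dl: "\<And>i j. i \<in> {1..n} \<Longrightarrow> j \<in> {1..n} \<Longrightarrow> i \<noteq> j \<Longrightarrow> dlog (bracket i j) s =
        (if {i, j} = {k, l} then 2 * pi * \<i> else 0) - (if {1, 2} = {k, l} then 2 * pi * \<i> else 0)"
      using loop_exists[OF kl(3) n] by blast
    define \<kappa> where "\<kappa> = (if {1, 2} = {k, l} then 2 * pi * \<i> else 0)"
    have "edge_cochain n a s = 0" using g s unfolding primitive_def by simp
    then have "0 = (\<Sum>i\<in>{0..n}. \<Sum>j\<in>{0..n}. a {i, j} * dlog (bracket i j) s)"
      using s(1) by (simp add: edge_cochain_def)
    also have "\<dots> = (\<Sum>i\<in>{1..n}. \<Sum>j\<in>{1..n}. a {i, j} * dlog (bracket i j) s)"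
      by (rule sum_bracket_zero) simp_all
    also have "\<dots> = (\<Sum>i\<in>{1..n}. \<Sum>j\<in>{1..n}. (if i = k then if j = l then a {k, l} * (2 * pi * \<i>) else 0 else 0)
        + (if i = l then if j = k then a {k, l} * (2 * pi * \<i>) else 0 else 0) - \<kappa> * a {i, j})"
    proof (intro sum.cong refl)
      fix i j assume ij: "i \<in> {1..n}" "j \<in> {1..n}"
      show "a {i, j} * dlog (bracket i j) s =
        (if i = k then if j = l then a {k, l} * (2 * pi * \<i>) else 0 else 0)
        + (if i = l then if j = k then a {k, l} * (2 * pi * \<i>) else 0 else 0) - \<kappa> * a {i, j}"
      proof (cases "i = j")
        case True
        then show ?thesis using edge_functions_diag[OF a, of j] kl by auto
      next
        case False
        have d: "dlog (bracket i j) s = (if {i, j} = {k, l} then 2 * pi * \<i> else 0) - \<kappa>"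
          unfolding \<kappa>_def by (rule dl[OF ij False])
        show ?thesis unfolding d using kl(3) False by (auto simp: doubleton_eq_iff insert_commute algebra_simps)
      qed
    qed
    also have "\<dots> = 2 * (a {k, l} * (2 * pi * \<i>)) - \<kappa> * (\<Sum>i\<in>{1..n}. \<Sum>j\<in>{1..n}. a {i, j})"
      unfolding sum.distrib sum_subtractf sum_double_delta[OF finite_atLeastAtMost kl(1,2)]
        sum_double_delta[OF finite_atLeastAtMost kl(2,1)]
      by (simp add: sum_distrib_left)
    finally show ?thesis by (simp add: edge_functions_inner_sum[OF a] del: One_nat_def)
  qed
  have V: "{0..n} = insert 0 {1..n}" by auto
  have outer: "a {k, 0} = 0" if k: "k \<in> {1..n}" for k
  proof -
    have "(\<Sum>j\<in>{0..n}. a {k, j}) = 0" using a k by (simp add: edge_functions_def)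
    then have "a {k, 0} + (\<Sum>j\<in>{1..n}. a {k, j}) = 0" unfolding V by simp
    moreover have "(\<Sum>j\<in>{1..n}. a {k, j}) = 0"
    proof (rule sum.neutral, rule ballI)
      fix j assume "j \<in> {1..n}"
      then show "a {k, j} = 0" using inner[OF k] edge_functions_diag[OF a] by (cases "j = k") auto
    qed
    ultimately show ?thesis by simp
  qed
  have "a e = 0" for e
  proof (rule ccontr)
    assume "a e \<noteq> 0"
    then have "e \<subseteq> {0..n}" "card e = 2" using a by (auto simp: edge_functions_def)
    then obtain i j where ij: "e = {i, j}" "i \<noteq> j" "i \<in> {0..n}" "j \<in> {0..n}"
      by (auto simp: card_2_iff)
    then show False
      using \<open>a e \<noteq> 0\<close> inner[of i j] outer[of i] outer[of j]
      by (cases "i = 0"; cases "j = 0") (auto simp: insert_commute)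
  qed
  then show ?thesis by blast
qed

section \<open>Every class comes from an edge function\<close>

lemma sum_symmetric_pairs:
  assumes "\<And>i j. f i j = f j i" "\<And>i. f i i = (0::complex)"
  shows "(\<Sum>i\<in>{1..n}. \<Sum>j\<in>{1..n}. f i j) = 2 * (\<Sum>(i, j)\<in>pairs n. f i j)"
proof -
  let ?Q = "(\<lambda>(i, j). (j, i)) ` pairs n" and ?R = "(\<lambda>i. (i, i)) ` {1..n}"
  have "{1..n} \<times> {1..n} = pairs n \<union> ?Q \<union> ?R"
  proof (rule equalityI; rule subsetI)
    fix p assume "p \<in> {1..n} \<times> {1..n}"
    then show "p \<in> pairs n \<union> ?Q \<union> ?R"
      by (cases "fst p" "snd p" rule: linorder_cases) (auto simp: pairs_def image_iff)
  next
    fix p assume "p \<in> pairs n \<union> ?Q \<union> ?R"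
    then show "p \<in> {1..n} \<times> {1..n}" by (auto simp: pairs_def)
  qed
  then have "(\<Sum>i\<in>{1..n}. \<Sum>j\<in>{1..n}. f i j) = (\<Sum>(i, j)\<in>pairs n \<union> ?Q \<union> ?R. f i j)"
    by (simp add: sum.cartesian_product)
  also have "\<dots> = (\<Sum>(i, j)\<in>pairs n. f i j) + (\<Sum>(i, j)\<in>?Q. f i j) + (\<Sum>(i, j)\<in>?R. f i j)"
  proof -
    have fin: "finite (pairs n)" "finite ?Q" "finite ?R" using finite_pairs[of n] by simp_all
    have disj: "pairs n \<inter> ?Q = {}" "(pairs n \<union> ?Q) \<inter> ?R = {}" by (auto simp: pairs_def)
    show ?thesis
      using sum.union_disjoint[OF finite_UnI[OF fin(1,2)] fin(3) disj(2), of "\<lambda>(i, j). f i j"]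
        sum.union_disjoint[OF fin(1,2) disj(1), of "\<lambda>(i, j). f i j"] by simp
  qed
  also have "(\<Sum>(i, j)\<in>?Q. f i j) = (\<Sum>(i, j)\<in>pairs n. f i j)"
    by (subst sum.reindex) (auto simp: inj_on_def assms(1) case_prod_unfold)
  also have "(\<Sum>(i, j)\<in>?R. f i j) = 0"
    by (rule sum.neutral) (auto simp: assms(2))
  finally show ?thesis by simp
qed

text \<open>The vertex sums at i >= 1 force the values on the edges at 0; the remaining vertex sum,
  at 0, is the assumption on the total.\<close>

lemma edge_function_extension:
  assumes sym: "\<And>i j. C i j = C j i" and diag: "\<And>i. C i i = (0::complex)"
    and total: "(\<Sum>i\<in>{1..n}. \<Sum>j\<in>{1..n}. C i j) = 0"
  shows "\<exists>a\<in>edge_functions {0..n}. \<forall>i\<in>{1..n}. \<forall>j\<in>{1..n}. a {i, j} = C i j"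
proof -
  \<comment> \<open>\<open>Min\<close> and \<open>Max\<close> read an ordered pair off an edge; the
    order is harmless by symmetry of \<open>C\<close>.\<close>
  define a where "a = (\<lambda>e. if e \<subseteq> {0..n} \<and> card e = 2
    then if Min e = 0 then - (\<Sum>k\<in>{1..n}. C (Max e) k) else C (Min e) (Max e) else 0)"
  have inner: "a {i, j} = C i j" if "i \<in> {1..n}" "j \<in> {1..n}" for i j
  proof (cases i j rule: linorder_cases)
    case less
    then show ?thesis using that by (auto simp: a_def)
  next
    case equal
    then show ?thesis using diag by (simp add: a_def)
  next
    case greater
    then show ?thesis using that sym by (auto simp: a_def)
  qed
  have outer: "a {i, 0} = - (\<Sum>k\<in>{1..n}. C i k)" "a {0, i} = - (\<Sum>k\<in>{1..n}. C i k)" if "i \<in> {1..n}" for i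
    using that by (auto simp: a_def)
  have V: "{0..n} = insert 0 {1..n}" by auto
  have "(\<Sum>j\<in>{0..n}. a {i, j}) = 0" if "i \<in> {0..n}" for i
  proof (cases "i = 0")
    case True
    have "a {0, 0} = 0" by (simp add: a_def)
    then have "(\<Sum>j\<in>{0..n}. a {i, j}) = (\<Sum>j\<in>{1..n}. a {0, j})" unfolding V True by simp
    also have "\<dots> = (\<Sum>j\<in>{1..n}. - (\<Sum>k\<in>{1..n}. C j k))" by (rule sum.cong) (auto simp: outer)
    finally show ?thesis using total by (simp add: sum_negf)
  next
    case False
    then have i: "i \<in> {1..n}" using that by auto
    have "(\<Sum>j\<in>{1..n}. a {i, j}) = (\<Sum>j\<in>{1..n}. C i j)" by (rule sum.cong) (auto simp: inner[OF i])
    then show ?thesis unfolding V using outer(1)[OF i] by simp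
  qed
  moreover have "e \<subseteq> {0..n} \<and> card e = 2" if "a e \<noteq> 0" for e
  proof (rule ccontr)
    assume no: "\<not> (e \<subseteq> {0..n} \<and> card e = 2)"
    have "a e = 0" unfolding a_def if_not_P[OF no] ..
    with that show False ..
  qed
  ultimately have "a \<in> edge_functions {0..n}" unfolding edge_functions_def by blast
  then show ?thesis using inner by blast
qed

lemma cocycle_cohomologous_edge_cochain:
  assumes u: "cocycle1 (dA_complement n) u" and n: "n \<ge> 2"
  shows "\<exists>a\<in>edge_functions {0..n}. \<exists>g. primitive (dA_complement n) (\<lambda>s. u s - edge_cochain n a s) g"
proof -
  let ?X = "dA_complement n"
  obtain c g where cg: "primitive ?X (\<lambda>s. u s - (\<Sum>(i, j)\<in>pairs n. c (i, j) * dlog (ratio i j) s)) g"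
    using cocycle_on_dA[OF u n] by blast
  have p12: "(1, 2) \<in> pairs n" using n by (auto simp: pairs_def)
  \<comment> \<open>\<open>ratio 1 2\<close> is constantly 1 and has \<open>dlog\<close> 0, so the
    coefficient at (1, 2) is free; it is chosen to make the coefficients add up to 0.\<close>
  define c' where "c' = c((1, 2) := c (1, 2) - (\<Sum>p\<in>pairs n. c p))"
  have c'_sum: "(\<Sum>p\<in>pairs n. c' p * h p) = (\<Sum>p\<in>pairs n. c p * h p) - (\<Sum>p\<in>pairs n. c p) * h (1, 2)" for h
    using p12 finite_pairs[of n]
    by (simp add: sum.remove[OF finite_pairs p12] c'_def algebra_simps)
  define C where "C = (\<lambda>i j. if i < j then c' (i, j) else if j < i then c' (j, i) else 0)"
  have sym: "C i j = C j i" and diag: "C i i = 0" for i j by (auto simp: C_def)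
  have "(\<Sum>i\<in>{1..n}. \<Sum>j\<in>{1..n}. C i j) = 2 * (\<Sum>(i, j)\<in>pairs n. C i j)"
    by (rule sum_symmetric_pairs[OF sym diag])
  also have "(\<Sum>(i, j)\<in>pairs n. C i j) = (\<Sum>p\<in>pairs n. c' p * 1)"
    by (rule sum.cong) (auto simp: C_def pairs_def)
  also have "\<dots> = 0" unfolding c'_sum by simp
  finally have total: "(\<Sum>i\<in>{1..n}. \<Sum>j\<in>{1..n}. C i j) = 0" by simp
  obtain a where a: "a \<in> edge_functions {0..n}" "\<And>i j. i \<in> {1..n} \<Longrightarrow> j \<in> {1..n} \<Longrightarrow> a {i, j} = C i j"
    using edge_function_extension[OF sym diag total] by blast
  have "edge_cochain n a s = (\<Sum>(i, j)\<in>pairs n. c (i, j) * dlog (ratio i j) s)"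
    if s: "singular_simplex 1 ?X s" for s
  proof -
    define f where "f = (\<lambda>i j. if i \<in> {1..n} \<and> j \<in> {1..n} then C i j * dlog (bracket i j) s else 0)"
    have f_sym: "f i j = f j i" for i j
      using dlog_bracket_commute[OF s, of i j] n sym[of i j] diag by (cases "i = j") (auto simp: f_def)
    have "(\<Sum>i\<in>{0..n}. \<Sum>j\<in>{0..n}. a {i, j} * dlog (bracket i j) s) =
        (\<Sum>i\<in>{1..n}. \<Sum>j\<in>{1..n}. a {i, j} * dlog (bracket i j) s)"
      by (rule sum_bracket_zero) simp_all
    also have "\<dots> = (\<Sum>i\<in>{1..n}. \<Sum>j\<in>{1..n}. f i j)"
      by (intro sum.cong refl) (simp add: f_def a(2))
    also have "\<dots> = 2 * (\<Sum>(i, j)\<in>pairs n. f i j)"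
      by (rule sum_symmetric_pairs) (rule f_sym, simp add: f_def diag)
    also have "(\<Sum>(i, j)\<in>pairs n. f i j) = (\<Sum>p\<in>pairs n. c' p * dlog (ratio (fst p) (snd p)) s)"
    proof (rule sum.cong[OF refl], clarify)
      fix i j assume p: "(i, j) \<in> pairs n"
      then have "bracket i j = ratio i j" by (auto simp: pairs_def bracket_def)
      then show "f i j = c' (i, j) * dlog (ratio (fst (i, j)) (snd (i, j))) s"
        using p by (auto simp: f_def C_def pairs_def)
    qed
    also have "\<dots> = (\<Sum>p\<in>pairs n. c p * dlog (ratio (fst p) (snd p)) s)"
    proof -
      have "dlog (ratio 1 2) s = dlog (\<lambda>P. 1) s"
      proof (rule dlog_cong[OF s])
        fix P assume P: "P \<in> topspace ?X"
        then obtain z where z: "inj_on z {1..n}" "P = affine_class n z" using in_topspace_dA by blast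
        then have "z 1 \<noteq> z 2" using n by (auto dest: inj_onD[of z _ 1 2])
        then show "ratio 1 2 P = 1" using ratio_affine_class[of 1 n 2 z] n z(2) by simp
      qed
      then have "dlog (ratio 1 2) s = 0" by (simp add: dlog_const)
      then show ?thesis unfolding c'_sum by simp
    qed
    finally show ?thesis using s by (simp add: edge_cochain_def case_prod_unfold)
  qed
  then have "primitive ?X (\<lambda>s. u s - edge_cochain n a s) g"
    using cg unfolding primitive_def by simp
  then show ?thesis using a(1) by blast
qed

section \<open>Cosets and their operations in degree one\<close>

lemma coboundaries_1:
  "coboundaries 1 X = {b. (\<forall>s. \<not> singular_simplex 1 X s \<longrightarrow> b s = 0) \<and> (\<exists>g. primitive X b g)}"
proof -
  have face: "singular_face 1 0 s = restrict (\<lambda>x. s (edge_point 1)) (standard_simplex 0)"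
    "singular_face 1 1 s = restrict (\<lambda>x. s (edge_point 0)) (standard_simplex 0)" for s :: "(nat \<Rightarrow> real) \<Rightarrow> 'a"
    by (auto simp: singular_face_def standard_simplex_0 simplical_face_def restrict_def fun_eq_iff
        intro!: arg_cong[of _ _ s])
  have cob: "coboundary 0 X v = (\<lambda>s. if singular_simplex 1 X s
      then v (restrict (\<lambda>x. s (edge_point 1)) (standard_simplex 0)) -
        v (restrict (\<lambda>x. s (edge_point 0)) (standard_simplex 0)) else 0)" for v
    by (rule ext) (simp add: coboundary_def face[unfolded One_nat_def])
  show ?thesis
  proof (rule equalityI; rule subsetI)
    fix b assume "b \<in> coboundaries 1 X"
    then obtain v where "b = coboundary 0 X v" by (auto simp: coboundaries_def)
    then show "b \<in> {b. (\<forall>s. \<not> singular_simplex 1 X s \<longrightarrow> b s = 0) \<and> (\<exists>g. primitive X b g)}"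
      unfolding cob by (auto simp: primitive_def
          intro!: exI[of _ "\<lambda>x. v (restrict (\<lambda>_. x) (standard_simplex 0))"])
  next
    fix b assume "b \<in> {b. (\<forall>s. \<not> singular_simplex 1 X s \<longrightarrow> b s = 0) \<and> (\<exists>g. primitive X b g)}"
    then obtain g where b: "\<And>s. \<not> singular_simplex 1 X s \<Longrightarrow> b s = 0" and g: "primitive X b g" by blast
    define v where "v = (\<lambda>p. if singular_simplex 0 X p then g (p (\<lambda>i. if i = 0 then 1 else 0)) else 0)"
    have val: "v (restrict (\<lambda>_. x) (standard_simplex 0)) = g x" if "x \<in> topspace X" for x
      using that by (simp add: v_def singular_simplex_def standard_simplex_0)
    have "b s = coboundary 0 X v s" for s
    proof (cases "singular_simplex 1 X s")
      case True
      have "s (edge_point 0) \<in> topspace X" "s (edge_point 1) \<in> topspace X"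
        using singular_simplex_in_topspace[OF True] by (simp_all del: edge_point_simps)
      then show ?thesis using True g val unfolding cob primitive_def by simp
    next
      case False
      then show ?thesis using b unfolding cob by simp
    qed
    moreover have "v \<in> cochains 0 X" by (simp add: cochains_def v_def)
    ultimately show "b \<in> coboundaries 1 X" unfolding coboundaries_def by auto
  qed
qed

lemma cocycles_1:
  "cocycles 1 X = {u. (\<forall>s. \<not> singular_simplex 1 X s \<longrightarrow> u s = 0) \<and> cocycle1 X u}"
proof -
  have "coboundary 1 X u = (\<lambda>s. 0) \<longleftrightarrow> cocycle1 X u" for u
  proof -
    have "coboundary 1 X u = (\<lambda>s. if singular_simplex 2 X s
        then u (singular_face 2 0 s) - u (singular_face 2 1 s) + u (singular_face 2 2 s) else 0)"
    proof -
      have "(\<Sum>i\<le>2. f i) = f 0 + f 1 + f 2" for f :: "nat \<Rightarrow> complex"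
        by (simp add: eval_nat_numeral)
      then show ?thesis unfolding coboundary_def Suc_1 by (simp add: fun_eq_iff)
    qed
    then show ?thesis by (auto simp: cocycle1_def fun_eq_iff)
  qed
  then show ?thesis by (auto simp: cocycles_def cochains_def)
qed

lemma coboundaries_combine:
  assumes "b \<in> coboundaries 1 X" "b' \<in> coboundaries 1 X"
  shows "(\<lambda>s. c * b s + c' * b' s) \<in> coboundaries 1 X"
proof -
  obtain g h where "primitive X b g" "primitive X b' h" using assms unfolding coboundaries_1 by blast
  then have "primitive X (\<lambda>s. c * b s + c' * b' s) (\<lambda>x. c * g x + c' * h x)"
    by (simp add: primitive_def right_diff_distrib del: edge_point_simps)
  then show ?thesis using assms unfolding coboundaries_1 by auto
qed

lemma coboundaries_zero: "(\<lambda>s. 0) \<in> coboundaries 1 X"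
  unfolding coboundaries_1 primitive_def by auto

lemma cohomology_class_eq_iff:
  "cohomology_class 1 X u = cohomology_class 1 X v \<longleftrightarrow> (\<lambda>s. u s - v s) \<in> coboundaries 1 X"
proof
  assume "cohomology_class 1 X u = cohomology_class 1 X v"
  moreover have "u \<in> cohomology_class 1 X u"
    unfolding cohomology_class_def using coboundaries_zero by force
  ultimately obtain b where "u = (\<lambda>s. v s + b s)" "b \<in> coboundaries 1 X"
    unfolding cohomology_class_def by blast
  then show "(\<lambda>s. u s - v s) \<in> coboundaries 1 X" by simp
next
  assume uv: "(\<lambda>s. u s - v s) \<in> coboundaries 1 X"
  have "cohomology_class 1 X v \<subseteq> cohomology_class 1 X u"
    if d: "(\<lambda>s. u s - v s) \<in> coboundaries 1 X" for u v
  proof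
    fix w assume "w \<in> cohomology_class 1 X v"
    then obtain b where w: "w = (\<lambda>s. v s + b s)" "b \<in> coboundaries 1 X"
      unfolding cohomology_class_def by blast
    have "(\<lambda>s. 1 * b s + (- 1) * (u s - v s)) \<in> coboundaries 1 X"
      by (rule coboundaries_combine[OF w(2) d])
    moreover have "w = (\<lambda>s. u s + (1 * b s + (- 1) * (u s - v s)))" by (simp add: w(1) fun_eq_iff)
    ultimately show "w \<in> cohomology_class 1 X u"
      unfolding cohomology_class_def
      by (intro CollectI exI[of _ "\<lambda>s. 1 * b s + (- 1) * (u s - v s)"] conjI)
  qed
  note sub = this
  have "(\<lambda>s. (- 1) * (u s - v s) + 0 * (u s - v s)) \<in> coboundaries 1 X"
    by (rule coboundaries_combine[OF uv uv])
  then have "(\<lambda>s. v s - u s) \<in> coboundaries 1 X" by simp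
  then show "cohomology_class 1 X u = cohomology_class 1 X v" using sub uv by blast
qed

lemma cohomology_class_nonempty: "u \<in> cohomology_class 1 X u"
  unfolding cohomology_class_def using coboundaries_zero by force

lemma cohomology_class_member:
  assumes "w \<in> cohomology_class 1 X u" shows "(\<lambda>s. w s - u s) \<in> coboundaries 1 X"
  using assms unfolding cohomology_class_def by auto

text \<open>Operations on cosets are unions over representatives; such a union collapses to one
  coset as soon as the result does not depend on the representative.\<close>

lemma UN_same:
  assumes "x0 \<in> U" "\<And>x. x \<in> U \<Longrightarrow> F x = C" shows "(\<Union>x\<in>U. F x) = C"
proof -
  have "(\<Union>x\<in>U. F x) = (\<Union>x\<in>U. C)" using assms(2) by simp
  then show ?thesis using assms(1) by blast
qed

lemma cohomology_add:
  "add (cohomology_module 1 X g) (cohomology_class 1 X u) (cohomology_class 1 X v) =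
     cohomology_class 1 X (\<lambda>s. u s + v s)"
proof -
  have "cohomology_class 1 X (\<lambda>s. u' s + v' s) = cohomology_class 1 X (\<lambda>s. u s + v s)"
    if "u' \<in> cohomology_class 1 X u" "v' \<in> cohomology_class 1 X v" for u' v'
    using coboundaries_combine[OF cohomology_class_member[OF that(1)] cohomology_class_member[OF that(2)], of 1 1]
    unfolding cohomology_class_eq_iff by (simp add: algebra_simps)
  then have "(\<Union>v'\<in>cohomology_class 1 X v. cohomology_class 1 X (\<lambda>s. u' s + v' s)) = cohomology_class 1 X (\<lambda>s. u s + v s)"
    if "u' \<in> cohomology_class 1 X u" for u' using that by (simp only: UN_same[OF cohomology_class_nonempty])
  then have "(\<Union>u'\<in>cohomology_class 1 X u. \<Union>v'\<in>cohomology_class 1 X v. cohomology_class 1 X (\<lambda>s. u' s + v' s)) =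
      cohomology_class 1 X (\<lambda>s. u s + v s)" by (rule UN_same[OF cohomology_class_nonempty])
  then show ?thesis by (simp add: cohomology_module_def)
qed

lemma cohomology_smult:
  "c \<odot>\<^bsub>cohomology_module 1 X g\<^esub> cohomology_class 1 X u = cohomology_class 1 X (\<lambda>s. c * u s)"
proof -
  have "cohomology_class 1 X (\<lambda>s. c * u' s) = cohomology_class 1 X (\<lambda>s. c * u s)"
    if "u' \<in> cohomology_class 1 X u" for u'
    using coboundaries_combine[OF cohomology_class_member[OF that] cohomology_class_member[OF that], of c 0]
    unfolding cohomology_class_eq_iff by (simp add: algebra_simps)
  then have "(\<Union>u'\<in>cohomology_class 1 X u. cohomology_class 1 X (\<lambda>s. c * u' s)) =
      cohomology_class 1 X (\<lambda>s. c * u s)" by (rule UN_same[OF cohomology_class_nonempty])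
  then show ?thesis by (simp add: cohomology_module_def)
qed

lemma cohomology_act:
  assumes "continuous_map X X (g (inv_into UNIV p))"
  shows "act (cohomology_module 1 X g) p (cohomology_class 1 X u) =
    cohomology_class 1 X (cochain_pullback 1 X (g (inv_into UNIV p)) u)"
proof -
  let ?f = "g (inv_into UNIV p)"
  have "cohomology_class 1 X (cochain_pullback 1 X ?f u') = cohomology_class 1 X (cochain_pullback 1 X ?f u)"
    if u': "u' \<in> cohomology_class 1 X u" for u'
  proof -
    obtain h where h: "primitive X (\<lambda>s. u' s - u s) h"
      using cohomology_class_member[OF u'] unfolding coboundaries_1 by blast
    have "primitive X (\<lambda>s. cochain_pullback 1 X ?f u' s - cochain_pullback 1 X ?f u s) (\<lambda>x. h (?f x))"
      unfolding primitive_def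
    proof (intro allI impI)
      fix s assume s: "singular_simplex 1 X s"
      have "u' (simplex_map 1 ?f s) - u (simplex_map 1 ?f s) =
          h (simplex_map 1 ?f s (edge_point 1)) - h (simplex_map 1 ?f s (edge_point 0))"
        using h singular_simplex_simplex_map[OF s assms] unfolding primitive_def by blast
      then show "cochain_pullback 1 X ?f u' s - cochain_pullback 1 X ?f u s =
          h (?f (s (edge_point 1))) - h (?f (s (edge_point 0)))"
        using s edge_point_in_simplex[of 0] edge_point_in_simplex[of 1]
        by (simp add: cochain_pullback_def simplex_map_def)
    qed
    then show ?thesis
      unfolding cohomology_class_eq_iff coboundaries_1 by (auto simp: cochain_pullback_def)
  qed
  then have "(\<Union>u'\<in>cohomology_class 1 X u. cohomology_class 1 X (cochain_pullback 1 X ?f u')) =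
      cohomology_class 1 X (cochain_pullback 1 X ?f u)" by (rule UN_same[OF cohomology_class_nonempty])
  then show ?thesis by (simp add: cohomology_module_def)
qed

section \<open>The edge module and its map to cohomology\<close>

text \<open>No module axioms are demanded of \<open>M\<close> or \<open>N\<close>, so that the
  axioms can be carried from one to the other along \<open>f\<close>. The clause on zeros serves the
  same purpose: it fixes the zero of \<open>N\<close> before \<open>N\<close> is known to be a
  group.\<close>

definition module_iso ::
    "nat set \<Rightarrow> 'v perm_module \<Rightarrow> 'w perm_module \<Rightarrow> ('v \<Rightarrow> 'w) \<Rightarrow> bool" where
  "module_iso A M N f \<longleftrightarrow> bij_betw f (carrier M) (carrier N) \<and> f \<zero>\<^bsub>M\<^esub> = \<zero>\<^bsub>N\<^esub> \<and>
     (\<forall>x\<in>carrier M. \<forall>y\<in>carrier M. f (x \<oplus>\<^bsub>M\<^esub> y) = f x \<oplus>\<^bsub>N\<^esub> f y) \<and>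
     (\<forall>c. \<forall>x\<in>carrier M. f (c \<odot>\<^bsub>M\<^esub> x) = c \<odot>\<^bsub>N\<^esub> f x) \<and>
     (\<forall>p. p permutes A \<longrightarrow> (\<forall>x\<in>carrier M. f (act M p x) = act N p (f x)))"

definition set_module :: "(nat set \<Rightarrow> complex) set \<Rightarrow> (nat set \<Rightarrow> complex) perm_module" where
  "set_module W =
     \<lparr>carrier = W, monoid.mult = undefined, one = undefined,
      zero = (\<lambda>e. 0), add = (\<lambda>f g e. f e + g e), module.smult = (\<lambda>c f e. c * f e),
      act = (\<lambda>p f e. f (inv_into UNIV p ` e))\<rparr>"

abbreviation edge_module :: "nat set \<Rightarrow> (nat set \<Rightarrow> complex) perm_module" where
  "edge_module V \<equiv> set_module (edge_functions V)"

lemma edge_functions_add: "a \<in> edge_functions V \<Longrightarrow> b \<in> edge_functions V \<Longrightarrow> (\<lambda>e. a e + b e) \<in> edge_functions V"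
proof -
  assume a: "a \<in> edge_functions V" and b: "b \<in> edge_functions V"
  have "e \<subseteq> V \<and> card e = 2" if "a e + b e \<noteq> 0" for e
  proof -
    have "a e \<noteq> 0 \<or> b e \<noteq> 0" using that by auto
    then show ?thesis using a b unfolding edge_functions_def by blast
  qed
  moreover have "(\<Sum>j\<in>V. a {i, j} + b {i, j}) = 0" if "i \<in> V" for i
    using a b that unfolding edge_functions_def by (simp add: sum.distrib)
  ultimately show ?thesis unfolding edge_functions_def by blast
qed

lemma edge_functions_smult: "a \<in> edge_functions V \<Longrightarrow> (\<lambda>e. c * a e) \<in> edge_functions V"
  unfolding edge_functions_def by (auto simp flip: sum_distrib_left)

lemma edge_functions_zero: "(\<lambda>e. 0) \<in> edge_functions V"
  by (simp add: edge_functions_def)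

lemma edge_functions_permute:
  assumes q: "q permutes V" and a: "a \<in> edge_functions V"
  shows "(\<lambda>e. a (q ` e)) \<in> edge_functions V"
proof -
  have "e \<subseteq> V \<and> card e = 2" if "a (q ` e) \<noteq> 0" for e
  proof -
    have qe: "q ` e \<subseteq> V" "card (q ` e) = 2" using a that by (auto simp: edge_functions_def)
    have "inj_on q e" using permutes_inj[OF q] inj_on_subset by blast
    then have "card e = 2" using qe(2) card_image by metis
    moreover have "e \<subseteq> V" using qe(1) permutes_in_image[OF q] by blast
    ultimately show ?thesis by blast
  qed
  moreover have "(\<Sum>j\<in>V. a (q ` {i, j})) = 0" if "i \<in> V" for i
  proof -
    have "(\<Sum>j\<in>V. a (q ` {i, j})) = (\<Sum>j\<in>V. a {q i, j})"
      using sum.reindex_bij_betw[OF permutes_imp_bij[OF q], of "\<lambda>j. a {q i, j}"] by simp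
    then show ?thesis using a permutes_in_image[OF q] that by (simp add: edge_functions_def)
  qed
  ultimately show ?thesis unfolding edge_functions_def by blast
qed

lemma cocycle1_cong:
  assumes "cocycle1 X u" "\<And>s. singular_simplex 1 X s \<Longrightarrow> u s = v s" shows "cocycle1 X v"
  unfolding cocycle1_def
proof (intro allI impI)
  fix s assume s: "singular_simplex 2 X s"
  have "u (singular_face 2 k s) = v (singular_face 2 k s)" if "k \<le> 2" for k
    by (rule assms(2)[OF singular_simplex_face2[OF s that]])
  note eq = this[of 0] this[of 1] this[of 2]
  have "u (singular_face 2 0 s) - u (singular_face 2 1 s) + u (singular_face 2 2 s) = 0"
    using assms(1) s unfolding cocycle1_def by blast
  then show "v (singular_face 2 0 s) - v (singular_face 2 1 s) + v (singular_face 2 2 s) = 0"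
    using eq by simp
qed

lemma cocycle1_combination:
  assumes "finite I" "\<And>i. i \<in> I \<Longrightarrow> cocycle1 X (v i)"
  shows "cocycle1 X (\<lambda>s. \<Sum>i\<in>I. c i * v i s)"
  using assms
proof (induction I rule: finite_induct)
  case empty
  then show ?case by (simp add: cocycle1_def)
next
  case (insert k I)
  then have "cocycle1 X (\<lambda>s. (\<Sum>i\<in>I. c i * v i s) - (- c k) * v k s)"
    by (intro cocycle1_diff) auto
  then show ?case using insert by (simp add: add.commute)
qed

lemma cocycle1_edge_cochain:
  assumes n: "n \<ge> 2" and a: "a \<in> edge_functions {0..n}"
  shows "cocycle1 (dA_complement n) (edge_cochain n a)"
proof -
  let ?X = "dA_complement n" and ?V = "{0..n} \<times> {0..n}"
  define v where "v = (\<lambda>(i, j). if i = j then (\<lambda>s. 0) else dlog (bracket i j))"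
  have "cocycle1 ?X (v p)" if "p \<in> ?V" for p
  proof (cases "fst p = snd p")
    case True
    then show ?thesis by (simp add: v_def cocycle1_def case_prod_unfold)
  next
    case False
    then have "cocycle1 ?X (dlog (bracket (fst p) (snd p)))"
      using that n by (intro cocycle1_dlog continuous_map_bracket bracket_nonzero) auto
    then show ?thesis using False by (simp add: v_def case_prod_unfold)
  qed
  then have "cocycle1 ?X (\<lambda>s. \<Sum>p\<in>?V. a {fst p, snd p} / 2 * v p s)"
    by (intro cocycle1_combination) auto
  then show ?thesis
  proof (rule cocycle1_cong)
    fix s assume s: "singular_simplex 1 ?X s"
    have "(\<Sum>p\<in>?V. a {fst p, snd p} / 2 * v p s) = (\<Sum>(i, j)\<in>?V. a {i, j} * dlog (bracket i j) s / 2)"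
      by (rule sum.cong) (auto simp: v_def edge_functions_diag[OF a])
    also have "\<dots> = (\<Sum>i\<in>{0..n}. \<Sum>j\<in>{0..n}. a {i, j} * dlog (bracket i j) s) / 2"
      by (simp add: sum.cartesian_product[symmetric] sum_divide_distrib)
    finally show "(\<Sum>p\<in>?V. a {fst p, snd p} / 2 * v p s) = edge_cochain n a s"
      using s by (simp add: edge_cochain_def)
  qed
qed

lemma edge_cochain_add: "edge_cochain n (\<lambda>e. a e + b e) = (\<lambda>s. edge_cochain n a s + edge_cochain n b s)"
  by (rule ext) (simp add: edge_cochain_def distrib_right sum.distrib add_divide_distrib)

lemma edge_cochain_smult: "edge_cochain n (\<lambda>e. c * a e) = (\<lambda>s. c * edge_cochain n a s)"
  by (rule ext) (simp add: edge_cochain_def sum_distrib_left mult.assoc)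

text \<open>\<open>A\<close> and \<open>g\<close> are left open so that one proof serves both the
  full group with the extended action and the stabilizer of 0 with the permutation of
  coordinates.\<close>

theorem edge_module_cohomology:
  assumes n: "n \<ge> 2"
    and g: "\<And>p. p permutes A \<Longrightarrow> p permutes {0..n}"
      "\<And>p P. p permutes A \<Longrightarrow> P \<in> topspace (dA_complement n) \<Longrightarrow> g p P = extended_action n p P"
  shows "module_iso A (edge_module {0..n}) (cohomology_module 1 (dA_complement n) g)
    (\<lambda>a. cohomology_class 1 (dA_complement n) (edge_cochain n a))"
proof -
  let ?X = "dA_complement n" and ?E = "edge_functions {0..n}"
  let ?f = "\<lambda>a. cohomology_class 1 ?X (edge_cochain n a)"
  have outside: "edge_cochain n a s = 0" if "\<not> singular_simplex 1 ?X s" for a s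
    using that by (simp add: edge_cochain_def)
  have cocycle: "edge_cochain n a \<in> cocycles 1 ?X" if "a \<in> ?E" for a
    using cocycle1_edge_cochain[OF n that] outside unfolding cocycles_1 by blast
  have "inj_on ?f ?E"
  proof (rule inj_onI)
    fix a b assume ab: "a \<in> ?E" "b \<in> ?E" "?f a = ?f b"
    let ?d = "\<lambda>e. a e + (- 1) * b e"
    have d: "?d \<in> ?E" by (intro edge_functions_add edge_functions_smult ab)
    obtain h where "primitive ?X (\<lambda>s. edge_cochain n a s - edge_cochain n b s) h"
      using ab(3) unfolding cohomology_class_eq_iff coboundaries_1 by blast
    moreover have "edge_cochain n ?d = (\<lambda>s. edge_cochain n a s - edge_cochain n b s)"
      unfolding edge_cochain_add edge_cochain_smult by simp
    ultimately have "?d = (\<lambda>e. 0)" using edge_cochain_exact_imp_zero[OF d n] by simp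
    then show "a = b" by (simp add: fun_eq_iff)
  qed
  moreover have "?f ` ?E = cohomology_class 1 ?X ` cocycles 1 ?X"
  proof (rule equalityI; rule subsetI)
    fix U assume "U \<in> ?f ` ?E"
    then show "U \<in> cohomology_class 1 ?X ` cocycles 1 ?X" using cocycle by blast
  next
    fix U assume "U \<in> cohomology_class 1 ?X ` cocycles 1 ?X"
    then obtain u where u: "u \<in> cocycles 1 ?X" "U = cohomology_class 1 ?X u" by blast
    then obtain a h where a: "a \<in> ?E" "primitive ?X (\<lambda>s. u s - edge_cochain n a s) h"
      using cocycle_cohomologous_edge_cochain[OF _ n, of u] unfolding cocycles_1 by blast
    have "U = ?f a"
      using u a(2) outside unfolding u(2) cohomology_class_eq_iff coboundaries_1 cocycles_1 by auto
    then show "U \<in> ?f ` ?E" using a(1) by blast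
  qed
  ultimately have "bij_betw ?f (carrier (edge_module {0..n})) (carrier (cohomology_module 1 ?X g))"
    by (simp add: bij_betw_def set_module_def cohomology_module_def)
  moreover have "?f \<zero>\<^bsub>edge_module {0..n}\<^esub> = \<zero>\<^bsub>cohomology_module 1 ?X g\<^esub>"
  proof -
    have "edge_cochain n (\<lambda>e. 0) = (\<lambda>s. 0)" by (simp add: edge_cochain_def fun_eq_iff)
    then show ?thesis by (simp add: set_module_def cohomology_module_def)
  qed
  moreover have "?f (act (edge_module {0..n}) p a) = act (cohomology_module 1 ?X g) p (?f a)"
    if p: "p permutes A" and a: "a \<in> ?E" for p a
  proof -
    \<comment> \<open>Both actions of \<open>p\<close> are substitutions by its inverse, so
      equivariance is the transformation law of edge cochains for \<open>?q\<close>.\<close>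
    let ?q = "inv_into UNIV p"
    have q: "?q permutes A" by (rule permutes_inv[OF p])
    note q0 = g(1)[OF q]
    have cont: "continuous_map ?X ?X (g ?q)"
      by (rule continuous_map_eq[OF continuous_map_extended_action[OF q0]]) (simp add: g(2)[OF q])
    have "cochain_pullback 1 ?X (g ?q) (edge_cochain n a) = edge_cochain n (\<lambda>e. a (?q ` e))"
    proof
      fix s
      show "cochain_pullback 1 ?X (g ?q) (edge_cochain n a) s = edge_cochain n (\<lambda>e. a (?q ` e)) s"
      proof (cases "singular_simplex 1 ?X s")
        case True
        have "simplex_map 1 (g ?q) s = simplex_map 1 (extended_action n ?q) s"
          by (rule simplex_map_eq[OF True]) (rule g(2)[OF q])
        then show ?thesis
          using edge_cochain_extended_action[OF q0 n a True] True by (simp add: cochain_pullback_def)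
      next
        case False
        then show ?thesis by (simp add: cochain_pullback_def outside)
      qed
    qed
    then show ?thesis
      using cohomology_act[of ?X g p, OF cont] by (simp add: set_module_def)
  qed
  ultimately show ?thesis
    unfolding module_iso_def
    by (simp add: cohomology_add cohomology_smult edge_cochain_add edge_cochain_smult set_module_def
        del: One_nat_def)
qed

subsection \<open>Transport of module structures\<close>

lemma cring_complex: "cring complex_ring"
proof (rule cringI)
  show "abelian_group complex_ring"
  proof (rule abelian_groupI)
    fix x assume "x \<in> carrier complex_ring"
    show "\<exists>y\<in>carrier complex_ring. y \<oplus>\<^bsub>complex_ring\<^esub> x = \<zero>\<^bsub>complex_ring\<^esub>"
      by (rule bexI[of _ "- x"]) (simp_all add: complex_ring_def)
  qed (simp_all add: complex_ring_def)
  show "comm_monoid complex_ring"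
    by (rule comm_monoidI) (simp_all add: complex_ring_def)
qed (simp add: complex_ring_def distrib_right)

lemma sym_module_edge_module:
  assumes A: "\<And>p. p permutes A \<Longrightarrow> p permutes V"
  shows "sym_module A (edge_module V)"
proof -
  have E: "carrier (edge_module V) = edge_functions V" by (simp add: set_module_def)
  have "abelian_group (edge_module V)"
  proof (rule abelian_groupI)
    fix x assume x: "x \<in> carrier (edge_module V)"
    show "\<exists>y\<in>carrier (edge_module V). y \<oplus>\<^bsub>edge_module V\<^esub> x = \<zero>\<^bsub>edge_module V\<^esub>"
      by (rule bexI[of _ "\<lambda>e. (- 1) * x e"])
        (use x edge_functions_smult[of x V "- 1"] in \<open>simp_all add: set_module_def\<close>)
  qed (auto simp: set_module_def edge_functions_add edge_functions_zero add_ac)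
  moreover have "module_axioms complex_ring (edge_module V)"
    by (rule module_axioms.intro)
      (simp_all add: set_module_def complex_ring_def edge_functions_smult algebra_simps)
  ultimately have "Module.module complex_ring (edge_module V)"
    by (simp add: Module.module_def cring_complex)
  then show ?thesis
  proof (rule sym_module.intro, unfold_locales)
    fix p q x
    assume p: "p permutes A" and x: "x \<in> carrier (edge_module V)"
    show "act (edge_module V) p x \<in> carrier (edge_module V)"
      using edge_functions_permute[OF permutes_inv[OF A[OF p]]] x by (simp add: set_module_def)
    assume q: "q permutes A"
    show "act (edge_module V) (p \<circ> q) x = act (edge_module V) p (act (edge_module V) q x)"
      using o_inv_distrib[of p q] permutes_bij[OF p] permutes_bij[OF q]
      by (simp add: set_module_def image_comp)
  qed (simp_all add: set_module_def)
qed

text \<open>The axioms are easy for functions on edges; the cohomology module, whose elements are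
  cosets, and the Specht modules inherit them.\<close>

lemma sym_module_transport:
  assumes M: "sym_module A M" and f: "module_iso A M N f"
  shows "sym_module A N"
proof -
  interpret M: sym_module A M by (rule M)
  have surj: "carrier N = f ` carrier M" using f by (simp add: module_iso_def bij_betw_def)
  have zero: "\<zero>\<^bsub>N\<^esub> = f \<zero>\<^bsub>M\<^esub>" using f by (simp add: module_iso_def)
  have add: "f x \<oplus>\<^bsub>N\<^esub> f y = f (x \<oplus>\<^bsub>M\<^esub> y)" if "x \<in> carrier M" "y \<in> carrier M" for x y
    using f that by (simp add: module_iso_def)
  have smult: "c \<odot>\<^bsub>N\<^esub> f x = f (c \<odot>\<^bsub>M\<^esub> x)" if "x \<in> carrier M" for c x
    using f that by (simp add: module_iso_def)
  have act: "act N p (f x) = f (act M p x)" if "p permutes A" "x \<in> carrier M" for p x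
    using f that by (simp add: module_iso_def)
  have UN: "c \<in> carrier complex_ring" for c by (simp add: complex_ring_def)
  have "abelian_group N"
  proof (rule abelian_groupI)
    fix x assume "x \<in> carrier N"
    then obtain a where a: "a \<in> carrier M" "x = f a" unfolding surj by blast
    have "f (\<ominus>\<^bsub>M\<^esub> a) \<oplus>\<^bsub>N\<^esub> x = \<zero>\<^bsub>N\<^esub>"
      using a by (simp add: add zero M.l_neg)
    then show "\<exists>y\<in>carrier N. y \<oplus>\<^bsub>N\<^esub> x = \<zero>\<^bsub>N\<^esub>" unfolding surj using a(1) by blast
  qed (auto simp: surj zero add M.a_ac)
  moreover have "module_axioms complex_ring N"
    by (rule module_axioms.intro)
      (auto simp: surj add smult UN M.smult_closed M.smult_l_distr M.smult_r_distr M.smult_assoc1 M.smult_one)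
  ultimately have "Module.module complex_ring N"
    by (simp add: Module.module_def cring_complex)
  then show ?thesis
  proof (rule sym_module.intro, unfold_locales)
    fix p q x y c
    assume p: "p permutes A" and x: "x \<in> carrier N"
    then obtain a where a: "a \<in> carrier M" "x = f a" unfolding surj by blast
    show "act N p x \<in> carrier N"
      using a p M.act_closed by (simp add: act surj)
    show "act N p (c \<odot>\<^bsub>N\<^esub> x) = c \<odot>\<^bsub>N\<^esub> act N p x"
      using a p by (simp add: act smult UN M.act_closed M.act_smult)
    show "act N (p \<circ> q) x = act N p (act N q x)" if "q permutes A"
      using a p that by (simp add: act permutes_compose M.act_closed M.act_comp)
    assume "y \<in> carrier N"
    then obtain b where b: "b \<in> carrier M" "y = f b" unfolding surj by blast
    show "act N p (x \<oplus>\<^bsub>N\<^esub> y) = act N p x \<oplus>\<^bsub>N\<^esub> act N p y"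
      using a b p by (simp add: act add M.act_closed M.act_add)
  next
    fix x assume "x \<in> carrier N"
    then show "act N id x = x" unfolding surj using permutes_id by (auto simp: act M.act_id)
  qed
qed

text \<open>Back along \<open>f\<close> and forth along \<open>g\<close>. For both isomorphisms of
  the main result the common source \<open>K\<close> is the edge module on
  \<open>{0..n}\<close>.\<close>

theorem sym_module_iso_span:
  assumes K: "sym_module A K" and f: "module_iso A K M f" and g: "module_iso A K N g"
  shows "sym_module_iso A M N"
proof -
  interpret K: sym_module A K by (rule K)
  let ?h = "g \<circ> inv_into (carrier K) f"
  have bij: "bij_betw f (carrier K) (carrier M)" "bij_betw g (carrier K) (carrier N)"
    using f g by (simp_all add: module_iso_def)
  have h: "?h (f x) = g x" if "x \<in> carrier K" for x
    using inv_into_f_f[OF bij_betw_imp_inj_on[OF bij(1)] that] by simp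
  have surj: "carrier M = f ` carrier K" using bij(1) by (simp add: bij_betw_def)
  have UN: "c \<in> carrier complex_ring" for c by (simp add: complex_ring_def)
  have "bij_betw ?h (carrier M) (carrier N)"
    by (rule bij_betw_trans[OF bij_betw_inv_into[OF bij(1)] bij(2)])
  moreover have "?h (x \<oplus>\<^bsub>M\<^esub> y) = ?h x \<oplus>\<^bsub>N\<^esub> ?h y" if xy: "x \<in> carrier M" "y \<in> carrier M" for x y
  proof -
    obtain a where a: "x = f a" "a \<in> carrier K" using xy(1)[unfolded surj] by (rule imageE)
    obtain b where b: "y = f b" "b \<in> carrier K" using xy(2)[unfolded surj] by (rule imageE)
    note ab = a(2) b(2) a(1) b(1)
    have "x \<oplus>\<^bsub>M\<^esub> y = f (a \<oplus>\<^bsub>K\<^esub> b)" using f ab by (simp add: module_iso_def)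
    moreover have "g (a \<oplus>\<^bsub>K\<^esub> b) = g a \<oplus>\<^bsub>N\<^esub> g b" using g ab by (simp add: module_iso_def)
    ultimately show ?thesis using ab h K.a_closed by (simp del: comp_apply)
  qed
  moreover have "?h (c \<odot>\<^bsub>M\<^esub> x) = c \<odot>\<^bsub>N\<^esub> ?h x" if x: "x \<in> carrier M" for c x
  proof -
    obtain a where a: "x = f a" "a \<in> carrier K" using x[unfolded surj] by (rule imageE)
    have "c \<odot>\<^bsub>M\<^esub> x = f (c \<odot>\<^bsub>K\<^esub> a)" using f a by (simp add: module_iso_def)
    moreover have "g (c \<odot>\<^bsub>K\<^esub> a) = c \<odot>\<^bsub>N\<^esub> g a" using g a by (simp add: module_iso_def)
    ultimately show ?thesis using a h K.smult_closed[OF UN] by (simp del: comp_apply)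
  qed
  moreover have "?h (act M p x) = act N p (?h x)" if px: "p permutes A" "x \<in> carrier M" for p x
  proof -
    obtain a where a: "x = f a" "a \<in> carrier K" using px(2)[unfolded surj] by (rule imageE)
    have "act M p x = f (act K p a)" using f a px(1) by (simp add: module_iso_def)
    moreover have "g (act K p a) = act N p (g a)" using g a px(1) by (simp add: module_iso_def)
    ultimately show ?thesis using a h K.act_closed[OF px(1)] by (simp del: comp_apply)
  qed
  ultimately show ?thesis
    unfolding sym_module_iso_def using sym_module_transport[OF K f] sym_module_transport[OF K g] by blast
qed

subsection \<open>Specht modules of two-row shapes\<close>

definition two_rows :: "nat set \<Rightarrow> nat set \<Rightarrow> nat \<Rightarrow> nat set" where
  "two_rows V e i = (if i = 0 then V - e else if i = 1 then e else {})"

definition has_two_rows :: "nat set \<Rightarrow> (nat \<Rightarrow> nat set) \<Rightarrow> bool" where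
  "has_two_rows V T \<longleftrightarrow> T = two_rows V (T 1)"

text \<open>A two-row tabloid is determined by its second row, so functions of sets become functions
  of tabloids; sequences not of two-row form get the value 0.\<close>

definition on_tabloids :: "nat set \<Rightarrow> (nat set \<Rightarrow> complex) \<Rightarrow> (nat \<Rightarrow> nat set) \<Rightarrow> complex" where
  "on_tabloids V a T = (if has_two_rows V T then a (T 1) else 0)"

definition point_functions :: "nat set \<Rightarrow> (nat set \<Rightarrow> complex) set" where
  "point_functions V = {a. (\<forall>e. a e \<noteq> 0 \<longrightarrow> e \<subseteq> V \<and> card e = 1) \<and> (\<Sum>i\<in>V. a {i}) = 0}"

definition span_of :: "('t \<Rightarrow> 'b \<Rightarrow> complex) \<Rightarrow> 't set \<Rightarrow> ('b \<Rightarrow> complex) set" where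
  "span_of P X = {\<lambda>T. \<Sum>t\<in>F. c t * P t T |F c. finite F \<and> F \<subseteq> X}"

lemma two_rows_1 [simp]: "two_rows V e 1 = e" "two_rows V e (Suc 0) = e"
  by (simp_all add: two_rows_def)

lemma span_of_base: "t \<in> X \<Longrightarrow> P t \<in> span_of P X"
  unfolding span_of_def
  by (rule CollectI, rule exI[of _ "{t}"], rule exI[of _ "\<lambda>_. 1"]) simp

lemma span_of_zero: "(\<lambda>T. 0) \<in> span_of P X"
  unfolding span_of_def by (rule CollectI, rule exI[of _ "{}"]) simp

lemma span_of_smult: "f \<in> span_of P X \<Longrightarrow> (\<lambda>T. c * f T) \<in> span_of P X"
proof -
  assume "f \<in> span_of P X"
  then obtain F d where f: "f = (\<lambda>T. \<Sum>t\<in>F. d t * P t T)" "finite F" "F \<subseteq> X"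
    unfolding span_of_def by blast
  have "(\<lambda>T. c * f T) = (\<lambda>T. \<Sum>t\<in>F. (c * d t) * P t T)"
    by (simp add: f(1) sum_distrib_left mult.assoc)
  then show ?thesis unfolding span_of_def using f(2,3) by (intro CollectI exI[of _ F] exI[of _ "\<lambda>t. c * d t"]) simp
qed

lemma span_of_add:
  assumes "f \<in> span_of P X" "g \<in> span_of P X" shows "(\<lambda>T. f T + g T) \<in> span_of P X"
proof -
  obtain F c where f: "f = (\<lambda>T. \<Sum>t\<in>F. c t * P t T)" "finite F" "F \<subseteq> X"
    using assms(1) unfolding span_of_def by blast
  obtain G d where g: "g = (\<lambda>T. \<Sum>t\<in>G. d t * P t T)" "finite G" "G \<subseteq> X"
    using assms(2) unfolding span_of_def by blast
  define h where "h = (\<lambda>t. (if t \<in> F then c t else 0) + (if t \<in> G then d t else 0))"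
  have "f T + g T = (\<Sum>t\<in>F \<union> G. h t * P t T)" for T
  proof -
    have "f T = (\<Sum>t\<in>F \<union> G. (if t \<in> F then c t else 0) * P t T)"
      unfolding f(1) using f(2) g(2) by (intro sum.mono_neutral_cong_left) auto
    moreover have "g T = (\<Sum>t\<in>F \<union> G. (if t \<in> G then d t else 0) * P t T)"
      unfolding g(1) using f(2) g(2) by (intro sum.mono_neutral_cong_left) auto
    ultimately show ?thesis by (simp add: h_def distrib_right sum.distrib)
  qed
  then show ?thesis unfolding span_of_def using f(2,3) g(2,3)
    by (intro CollectI exI[of _ "F \<union> G"] exI[of _ h]) auto
qed

lemma span_of_sum:
  assumes "finite I" "\<And>i. i \<in> I \<Longrightarrow> f i \<in> span_of P X"
  shows "(\<lambda>T. \<Sum>i\<in>I. c i * f i T) \<in> span_of P X"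
  using assms
proof (induction I rule: finite_induct)
  case empty
  then show ?case by (simp add: span_of_zero)
next
  case (insert k I)
  then have "(\<lambda>T. c k * f k T + (\<Sum>i\<in>I. c i * f i T)) \<in> span_of P X"
    by (intro span_of_add span_of_smult) auto
  then show ?case using insert by simp
qed

lemma span_of_subset:
  assumes "\<And>t. t \<in> X \<Longrightarrow> P t \<in> W" "(\<lambda>T. 0) \<in> W"
    and "\<And>c f g. f \<in> W \<Longrightarrow> g \<in> W \<Longrightarrow> (\<lambda>T. c * f T + g T) \<in> W"
  shows "span_of P X \<subseteq> W"
proof
  fix f assume "f \<in> span_of P X"
  then obtain F c where f: "f = (\<lambda>T. \<Sum>t\<in>F. c t * P t T)" "finite F" "F \<subseteq> X"
    unfolding span_of_def by blast
  have "(\<lambda>T. \<Sum>t\<in>F. c t * P t T) \<in> W"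
    using f(2,3)
  proof (induction F rule: finite_induct)
    case empty
    then show ?case using assms(2) by simp
  next
    case (insert k F)
    then have "(\<lambda>T. c k * P k T + (\<Sum>t\<in>F. c t * P t T)) \<in> W"
      by (intro assms(1,3)) auto
    then show ?case using insert by simp
  qed
  then show "f \<in> W" by (simp add: f(1))
qed

section \<open>Polytabloids of two-row shapes\<close>

lemma tabloid_two_rows:
  assumes t: "t \<in> tableaux [k, m] V"
  shows "tabloid [k, m] t = two_rows V (t ` {c \<in> cells [k, m]. fst c = 1})"
proof
  fix i
  have inj: "inj_on t (cells [k, m])" and V: "V = t ` cells [k, m]"
    using t by (auto simp: tableaux_def bij_betw_def)
  have "{c \<in> cells [k, m]. fst c = 0} = cells [k, m] - {c \<in> cells [k, m]. fst c = 1}"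
    by (auto simp: cells_def less_Suc_eq)
  then have "t ` {c \<in> cells [k, m]. fst c = 0} = V - t ` {c \<in> cells [k, m]. fst c = 1}"
    unfolding V using inj_on_image_set_diff[OF inj, of "cells [k, m]" "{c \<in> cells [k, m]. fst c = 1}"] by auto
  moreover have "{c \<in> cells [k, m]. fst c = i} = {}" if "i \<noteq> 0" "i \<noteq> 1"
    using that by (auto simp: cells_def)
  ultimately show "tabloid [k, m] t i = two_rows V (t ` {c \<in> cells [k, m]. fst c = 1}) i"
    by (simp add: tabloid_def two_rows_def)
qed

lemma tableaux_permute: "t \<in> tableaux la V \<Longrightarrow> p permutes V \<Longrightarrow> p \<circ> t \<in> tableaux la V"
  unfolding tableaux_def using permutes_imp_bij bij_betw_trans by blast

lemma tabloid_permute: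
  assumes "t \<in> tableaux [k, m] V" "p permutes V"
  shows "tabloid [k, m] (p \<circ> t) = two_rows V (p ` t ` {c \<in> cells [k, m]. fst c = 1})"
  using tabloid_two_rows[OF tableaux_permute[OF assms]] by (simp add: image_comp)

lemma cells_1: "cells [k, Suc 0] = insert (1, 0) ({0} \<times> {..<k})"
  by (auto simp: cells_def less_Suc_eq)

lemma cells_2: "cells [k, 2] = insert (1, 0) (insert (1, 1) ({0} \<times> {..<k}))"
  by (auto simp: cells_def less_Suc_eq numeral_2_eq_2)

definition ind :: "nat set \<Rightarrow> nat set \<Rightarrow> complex" where
  "ind e e' = (if e' = e then 1 else 0)"

text \<open>Belongs to a tableau with \<open>a\<close> above \<open>b\<close> and \<open>c\<close>
  above \<open>d\<close> in its first two columns: the edges are the second rows after swaps within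
  the columns, with the signs of the swaps.\<close>

definition quad :: "nat \<Rightarrow> nat \<Rightarrow> nat \<Rightarrow> nat \<Rightarrow> nat set \<Rightarrow> complex" where
  "quad a b c d e = ind {b, d} e - ind {a, d} e - ind {b, c} e + ind {a, c} e"

lemma on_tabloids_ind: "on_tabloids V (ind e) T = (if T = two_rows V e then 1 else 0)"
proof (cases "has_two_rows V T \<and> T 1 = e")
  case True
  then have "T = two_rows V e" unfolding has_two_rows_def by metis
  then show ?thesis using True by (simp add: on_tabloids_def ind_def)
next
  case False
  then have "T \<noteq> two_rows V e" by (auto simp: has_two_rows_def)
  then show ?thesis using False by (auto simp: on_tabloids_def ind_def)
qed

lemma on_tabloids_add: "on_tabloids V (\<lambda>e. a e + b e) = (\<lambda>T. on_tabloids V a T + on_tabloids V b T)"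
  by (simp add: on_tabloids_def fun_eq_iff)

lemma on_tabloids_diff: "on_tabloids V (\<lambda>e. a e - b e) = (\<lambda>T. on_tabloids V a T - on_tabloids V b T)"
  by (simp add: on_tabloids_def fun_eq_iff)

lemma on_tabloids_smult: "on_tabloids V (\<lambda>e. c * a e) = (\<lambda>T. c * on_tabloids V a T)"
  by (simp add: on_tabloids_def fun_eq_iff)

lemma on_tabloids_sum: "on_tabloids V (\<lambda>e. \<Sum>i\<in>I. f i e) = (\<lambda>T. \<Sum>i\<in>I. on_tabloids V (f i) T)"
  by (simp add: on_tabloids_def fun_eq_iff)

lemma on_tabloids_inject: "on_tabloids V a = on_tabloids V b \<Longrightarrow> a = b"
proof
  fix e assume "on_tabloids V a = on_tabloids V b"
  then have "on_tabloids V a (two_rows V e) = on_tabloids V b (two_rows V e)" by simp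
  then show "a e = b e" by (simp add: on_tabloids_def has_two_rows_def)
qed

lemma on_tabloids_permute:
  assumes r: "r permutes V"
  shows "on_tabloids V (\<lambda>e. a (r ` e)) T = on_tabloids V a (\<lambda>i. r ` T i)"
proof -
  have inj: "inj r" by (rule permutes_inj[OF r])
  have "has_two_rows V (\<lambda>i. r ` T i) \<longleftrightarrow> has_two_rows V T"
  proof -
    have "r ` two_rows V e i = two_rows V (r ` e) i" for e i
      using permutes_image[OF r] image_set_diff[OF inj, of V e] by (simp add: two_rows_def)
    then have "(\<lambda>i. r ` T i) = two_rows V (r ` T 1) \<longleftrightarrow> (\<forall>i. r ` T i = r ` two_rows V (T 1) i)"
      by (simp add: fun_eq_iff)
    also have "\<dots> \<longleftrightarrow> (\<forall>i. T i = two_rows V (T 1) i)" by (simp only: inj_image_eq_iff[OF inj])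
    finally show ?thesis by (simp only: has_two_rows_def fun_eq_iff)
  qed
  then show ?thesis by (simp add: on_tabloids_def)
qed

text \<open>Only the first column has two cells, so the column group consists of the identity and
  the swap of its entries.\<close>

lemma polytabloid_1:
  assumes t: "t \<in> tableaux [k, 1] V" and k: "k \<ge> 1"
  shows "polytabloid [k, 1] V t = on_tabloids V (\<lambda>e. ind {t (1, 0)} e - ind {t (0, 0)} e)"
proof -
  define a b where "a = t (0, 0)" and "b = t (1, 0)"
  have inj: "inj_on t (cells [k, 1])" and V: "V = t ` cells [k, 1]"
    using t by (auto simp: tableaux_def bij_betw_def)
  have cells: "(0, 0) \<in> cells [k, 1]" "(1, 0) \<in> cells [k, 1]" using k by (auto simp: cells_def)
  have ab: "a \<noteq> b" "a \<in> V" "b \<in> V"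
    using inj_onD[OF inj _ cells] cells unfolding a_def b_def V by auto
  let ?s = "Transposition.transpose a b"
  have s: "?s permutes V" by (rule permutes_swap_id[OF ab(2,3)])
  have "column_group [k, 1] V t = {id, ?s}"
  proof (rule equalityI; rule subsetI)
    fix p assume "p \<in> column_group [k, 1] V t"
    then have p: "p permutes V"
      and col: "\<And>c. c \<in> cells [k, 1] \<Longrightarrow> \<exists>c'\<in>cells [k, 1]. snd c' = snd c \<and> p (t c) = t c'"
      unfolding column_group_def by blast+
    have col0: "p a \<in> {a, b}" "p b \<in> {a, b}"
      using col[OF cells(1)] col[OF cells(2)] by (auto simp: a_def b_def cells_1)
    have rest: "p x = x" if "x \<noteq> a" "x \<noteq> b" for x
    proof (cases "x \<in> V")
      case True
      then obtain c where c: "c \<in> cells [k, 1]" "x = t c" unfolding V by blast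
      then obtain c' where c': "c' \<in> cells [k, 1]" "snd c' = snd c" "p x = t c'" using col by blast
      have "c \<noteq> (0, 0)" "c \<noteq> (1, 0)" using c that by (auto simp: a_def b_def)
      then have "c' = c" using c(1) c'(1,2) by (auto simp: cells_1)
      then show ?thesis using c c' by simp
    next
      case False
      then show ?thesis using permutes_not_in[OF p] by blast
    qed
    have pinj: "p a \<noteq> p b" using permutes_inj[OF p] ab(1) by (auto dest: injD)
    show "p \<in> {id, ?s}"
    proof (cases "p a = a")
      case True
      then have "p = id" using col0 pinj rest by (auto simp: fun_eq_iff) metis
      then show ?thesis by simp
    next
      case False
      then have "p a = b" "p b = a" using col0 pinj by auto
      then have "p = ?s" using rest by (auto simp: fun_eq_iff Transposition.transpose_def)
      then show ?thesis by simp
    qed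
  next
    fix p assume p: "p \<in> {id, ?s}"
    then have "p permutes V" using s permutes_id by auto
    moreover have "\<exists>c'\<in>cells [k, 1]. snd c' = snd c \<and> p (t c) = t c'" if c: "c \<in> cells [k, 1]" for c
    proof (cases "t c = a \<or> t c = b")
      case True
      then have "snd c = 0" using inj_onD[OF inj _ c] cells by (auto simp: a_def b_def)
      moreover have "p (t c) = a \<or> p (t c) = b" using True p by auto
      ultimately show ?thesis using cells unfolding a_def b_def by (metis snd_conv)
    next
      case False
      then have "p (t c) = t c" using p by (auto simp: Transposition.transpose_def)
      then show ?thesis using c by blast
    qed
    ultimately show "p \<in> column_group [k, 1] V t" unfolding column_group_def by blast
  qed
  moreover have "id \<noteq> ?s" using ab(1) by (auto simp: fun_eq_iff Transposition.transpose_def)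
  moreover have row: "t ` {c \<in> cells [k, 1]. fst c = 1} = {b}"
  proof -
    have "{c \<in> cells [k, 1]. fst c = 1} = {(1, 0)}" by (auto simp: cells_1)
    then show ?thesis by (simp add: b_def)
  qed
  moreover have "sign ?s = - 1" using ab(1) by (simp add: sign_swap_id)
  moreover have "tabloid [k, 1] (id \<circ> t) = two_rows V {b}"
    unfolding tabloid_permute[OF t permutes_id] row by simp
  moreover have "tabloid [k, 1] (?s \<circ> t) = two_rows V {a}"
    unfolding tabloid_permute[OF t s] row by simp
  ultimately show ?thesis
    unfolding on_tabloids_diff on_tabloids_ind polytabloid_def a_def[symmetric] b_def[symmetric]
    by (simp add: fun_eq_iff sign_id)
qed

text \<open>Only the first two columns have two cells, so the column group consists of the four
  products of two disjoint swaps.\<close>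

lemma polytabloid_2:
  assumes t: "t \<in> tableaux [k, 2] V" and k: "k \<ge> 2"
  shows "polytabloid [k, 2] V t = on_tabloids V (quad (t (0, 0)) (t (1, 0)) (t (0, 1)) (t (1, 1)))"
proof -
  define a b c d where "a = t (0, 0)" and "b = t (1, 0)" and "c = t (0, 1)" and "d = t (1, 1)"
  note defs = a_def b_def c_def d_def
  have inj: "inj_on t (cells [k, 2])" and V: "V = t ` cells [k, 2]"
    using t by (auto simp: tableaux_def bij_betw_def)
  have cells: "(0, 0) \<in> cells [k, 2]" "(1, 0) \<in> cells [k, 2]" "(0, 1) \<in> cells [k, 2]" "(1, 1) \<in> cells [k, 2]"
    using k by (auto simp: cells_def)
  have inV: "a \<in> V" "b \<in> V" "c \<in> V" "d \<in> V" using cells unfolding defs V by blast+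
  have dist: "a \<noteq> b" "a \<noteq> c" "a \<noteq> d" "b \<noteq> c" "b \<noteq> d" "c \<noteq> d"
    unfolding defs using cells by (auto simp: inj_on_eq_iff[OF inj])
  let ?s = "Transposition.transpose a b" and ?r = "Transposition.transpose c d"
  have s: "?s permutes V" and r: "?r permutes V"
    using permutes_swap_id[OF inV(1,2)] permutes_swap_id[OF inV(3,4)] .
  have sr: "?s \<circ> ?r permutes V" by (rule permutes_compose[OF r s])
  have tr: "?s a = b" "?s b = a" "?s c = c" "?s d = d" "?r a = a" "?r b = b" "?r c = d" "?r d = c"
    using dist by (auto simp: Transposition.transpose_def)
  have grp: "column_group [k, 2] V t = {id, ?s, ?r, ?s \<circ> ?r}"
  proof (rule equalityI; rule subsetI)
    fix p assume "p \<in> column_group [k, 2] V t"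
    then have p: "p permutes V"
      and col: "\<And>x. x \<in> cells [k, 2] \<Longrightarrow> \<exists>x'\<in>cells [k, 2]. snd x' = snd x \<and> p (t x) = t x'"
      unfolding column_group_def by blast+
    have col0: "p a \<in> {a, b}" "p b \<in> {a, b}"
      using col[OF cells(1)] col[OF cells(2)] by (auto simp: defs cells_2)
    have col1: "p c \<in> {c, d}" "p d \<in> {c, d}"
      using col[OF cells(3)] col[OF cells(4)] by (auto simp: defs cells_2)
    have rest: "p x = x" if "x \<notin> {a, b, c, d}" for x
    proof (cases "x \<in> V")
      case True
      then obtain y where y: "y \<in> cells [k, 2]" "x = t y" unfolding V by blast
      then obtain y' where y': "y' \<in> cells [k, 2]" "snd y' = snd y" "p x = t y'" using col by blast
      have "y \<notin> {(0, 0), (1, 0), (0, 1), (1, 1)}" using y that by (auto simp: defs)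
      then have "y' = y" using y(1) y'(1,2) by (auto simp: cells_2)
      then show ?thesis using y y' by simp
    next
      case False
      then show ?thesis using permutes_not_in[OF p] by blast
    qed
    have pinj: "p a \<noteq> p b" "p c \<noteq> p d" using permutes_inj[OF p] dist by (auto dest: injD)
    have eqI: "p = q" if "p a = q a" "p b = q b" "p c = q c" "p d = q d" "\<And>x. x \<notin> {a, b, c, d} \<Longrightarrow> q x = x" for q
    proof
      fix x show "p x = q x" using that rest by (cases "x \<in> {a, b, c, d}") auto
    qed
    have out: "?s x = x" "?r x = x" if "x \<notin> {a, b, c, d}" for x
      using that by (auto simp: Transposition.transpose_def)
    consider "p a = a" "p b = b" "p c = c" "p d = d" | "p a = b" "p b = a" "p c = c" "p d = d"
      | "p a = a" "p b = b" "p c = d" "p d = c" | "p a = b" "p b = a" "p c = d" "p d = c"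
      using col0 col1 pinj by auto
    then show "p \<in> {id, ?s, ?r, ?s \<circ> ?r}"
    proof cases
      case 1
      then have "p = id" by (intro eqI) auto
      then show ?thesis by simp
    next
      case 2
      then have "p = ?s" using tr out by (intro eqI) auto
      then show ?thesis by simp
    next
      case 3
      then have "p = ?r" using tr out by (intro eqI) auto
      then show ?thesis by simp
    next
      case 4
      then have "p = ?s \<circ> ?r" using tr out by (intro eqI) auto
      then show ?thesis by simp
    qed
  next
    fix p assume p: "p \<in> {id, ?s, ?r, ?s \<circ> ?r}"
    then have "p permutes V" using s r sr permutes_id by auto
    moreover have "\<exists>x'\<in>cells [k, 2]. snd x' = snd x \<and> p (t x) = t x'" if x: "x \<in> cells [k, 2]" for x
    proof -
      consider "x \<in> {(0, 0), (1, 0)}" | "x \<in> {(0, 1), (1, 1)}" | "t x \<notin> {a, b, c, d}"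
        using inj_onD[OF inj _ x] cells unfolding defs by blast
      then show ?thesis
      proof cases
        case 1
        then have "t x = a \<or> t x = b" "snd x = 0" by (auto simp: defs)
        moreover from this(1) have "p (t x) = a \<or> p (t x) = b" using p tr by auto
        ultimately show ?thesis using cells(1,2) unfolding a_def b_def by (metis snd_conv)
      next
        case 2
        then have "t x = c \<or> t x = d" "snd x = 1" by (auto simp: defs)
        moreover from this(1) have "p (t x) = c \<or> p (t x) = d" using p tr by auto
        ultimately show ?thesis using cells(3,4) unfolding c_def d_def by (metis snd_conv)
      next
        case 3
        then have "p (t x) = t x" using p by (auto simp: Transposition.transpose_def)
        then show ?thesis using x by blast
      qed
    qed
    ultimately show "p \<in> column_group [k, 2] V t" unfolding column_group_def by blast
  qed
  have "id \<noteq> ?s" "id \<noteq> ?r" "id \<noteq> ?s \<circ> ?r" "?s \<noteq> ?r" "?s \<noteq> ?s \<circ> ?r" "?r \<noteq> ?s \<circ> ?r"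
    using tr dist by (metis comp_apply id_apply)+
  then have sum4: "(\<Sum>p\<in>{id, ?s, ?r, ?s \<circ> ?r}. G p) = G id + G ?s + G ?r + G (?s \<circ> ?r)"
    for G :: "(nat \<Rightarrow> nat) \<Rightarrow> complex"
    by (simp del: o_apply add: add.assoc)
  have signs: "sign ?s = - 1" "sign ?r = - 1" using dist by (simp_all add: sign_swap_id)
  have signs': "sign (?s \<circ> ?r) = 1"
    using sign_compose[of ?s ?r] signs by (simp add: permutation_swap_id)
  have row: "t ` {x \<in> cells [k, 2]. fst x = 1} = {b, d}"
  proof -
    have "{x \<in> cells [k, 2]. fst x = 1} = {(1, 0), (1, 1)}" by (auto simp: cells_2)
    then show ?thesis by (simp add: defs)
  qed
  have tabs: "tabloid [k, 2] (id \<circ> t) = two_rows V {b, d}" "tabloid [k, 2] (?s \<circ> t) = two_rows V {a, d}"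
    "tabloid [k, 2] (?r \<circ> t) = two_rows V {b, c}" "tabloid [k, 2] ((?s \<circ> ?r) \<circ> t) = two_rows V {a, c}"
    unfolding tabloid_permute[OF t permutes_id] tabloid_permute[OF t s] tabloid_permute[OF t r]
      tabloid_permute[OF t sr] row by (simp_all add: tr)
  show ?thesis
    unfolding quad_def[abs_def] on_tabloids_diff on_tabloids_add on_tabloids_ind polytabloid_def defs[symmetric]
      grp sum4 tabs signs signs' sign_id
    by (rule ext) (simp only: of_int_1 of_int_minus if_distrib[of uminus] minus_zero diff_conv_add_uminus)
qed

text \<open>An injective filling of some cells is completed by any bijection from the other cells to
  the entries left over.\<close>

lemma tableau_exists:
  assumes V: "finite V" "card V = card (cells la)" and C: "finite (cells la)" "C0 \<subseteq> cells la"
    and f: "inj_on f C0" "f ` C0 \<subseteq> V"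
  shows "\<exists>t\<in>tableaux la V. \<forall>x\<in>C0. t x = f x"
proof -
  have "card (cells la - C0) = card (V - f ` C0)"
    using V C f by (simp add: card_Diff_subset finite_subset card_image)
  then obtain h where h: "bij_betw h (cells la - C0) (V - f ` C0)"
    using finite_same_card_bij[of "cells la - C0" "V - f ` C0"] V C by auto
  let ?t = "\<lambda>x. if x \<in> C0 then f x else h x"
  have "bij_betw ?t (C0 \<union> (cells la - C0)) (f ` C0 \<union> (V - f ` C0))"
  proof (rule bij_betw_combine)
    have "bij_betw f C0 (f ` C0)" using f(1) by (rule inj_on_imp_bij_betw)
    then show "bij_betw ?t C0 (f ` C0)" by (rule bij_betw_cong[THEN iffD1, rotated]) simp
    show "bij_betw ?t (cells la - C0) (V - f ` C0)"
      using h by (rule bij_betw_cong[THEN iffD1, rotated]) simp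
  qed auto
  moreover have "C0 \<union> (cells la - C0) = cells la" "f ` C0 \<union> (V - f ` C0) = V" using C(2) f(2) by auto
  ultimately show ?thesis unfolding tableaux_def by (intro bexI[of _ ?t]) auto
qed

lemma polytabloid_1_span:
  assumes V: "finite V" "card V = Suc k" "k \<ge> 1" and ab: "a \<in> V" "b \<in> V" "a \<noteq> b"
  shows "on_tabloids V (\<lambda>e. ind {b} e - ind {a} e) \<in> span_of (polytabloid [k, 1] V) (tableaux [k, 1] V)"
proof -
  let ?f = "\<lambda>x. if x = (0, 0) then a else b"
  have "card (cells [k, 1]) = Suc k" "finite (cells [k, 1])" by (auto simp: cells_1 card_cartesian_product)
  then obtain t where t: "t \<in> tableaux [k, 1] V" "\<forall>x\<in>{(0, 0), (1, 0)}. t x = ?f x"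
    using tableau_exists[of V "[k, 1]" "{(0, 0), (1, 0)}" ?f] V ab by (auto simp: cells_def)
  then have "polytabloid [k, 1] V t = on_tabloids V (\<lambda>e. ind {b} e - ind {a} e)"
    using polytabloid_1[OF t(1) V(3)] by simp
  then show ?thesis using span_of_base[of t "tableaux [k, 1] V" "polytabloid [k, 1] V"] t(1) by simp
qed

lemma polytabloid_2_span:
  assumes V: "finite V" "card V = k + 2" "k \<ge> 2" and abcd: "{a, b, c, d} \<subseteq> V" "distinct [a, b, c, d]"
  shows "on_tabloids V (quad a b c d) \<in> span_of (polytabloid [k, 2] V) (tableaux [k, 2] V)"
proof -
  let ?f = "\<lambda>x. if x = (0, 0) then a else if x = (1, 0) then b else if x = (0, 1) then c else d"
  let ?C = "{(0, 0), (1, 0), (0, 1), (1, 1)} :: (nat \<times> nat) set"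
  have fin: "card V = card (cells [k, 2])" "finite (cells [k, 2])"
    using V(2) by (auto simp: cells_2 card_cartesian_product)
  have sub: "?C \<subseteq> cells [k, 2]" using V(3) by (auto simp: cells_def)
  have inj: "inj_on ?f ?C" using abcd(2) by (auto simp: inj_on_def)
  have img: "?f ` ?C \<subseteq> V" using abcd(1) by auto
  obtain t where t: "t \<in> tableaux [k, 2] V" "\<forall>x\<in>?C. t x = ?f x"
    using tableau_exists[OF V(1) fin sub inj img] by (rule bexE)
  then have "t (0, 0) = a" "t (1, 0) = b" "t (0, 1) = c" "t (1, 1) = d" by auto
  then have "polytabloid [k, 2] V t = on_tabloids V (quad a b c d)"
    using polytabloid_2[OF t(1) V(3)] by (simp only:)
  then show ?thesis using span_of_base[of t "tableaux [k, 2] V" "polytabloid [k, 2] V"] t(1) by simp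
qed

section \<open>The spans of the polytabloids\<close>

lemma tableau_entry_in: "t \<in> tableaux la V \<Longrightarrow> x \<in> cells la \<Longrightarrow> t x \<in> V"
  unfolding tableaux_def by (simp add: bij_betw_apply)

lemma tableau_entry_eq_iff:
  "t \<in> tableaux la V \<Longrightarrow> x \<in> cells la \<Longrightarrow> y \<in> cells la \<Longrightarrow> t x = t y \<longleftrightarrow> x = y"
  unfolding tableaux_def bij_betw_def by (auto dest: inj_onD)

lemma point_functions_combine:
  assumes "f \<in> point_functions V" "g \<in> point_functions V"
  shows "(\<lambda>e. c * f e + g e) \<in> point_functions V"
proof -
  have "e \<subseteq> V \<and> card e = 1" if "c * f e + g e \<noteq> 0" for e
  proof -
    have "f e \<noteq> 0 \<or> g e \<noteq> 0" using that by auto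
    then show ?thesis using assms unfolding point_functions_def by blast
  qed
  moreover have "(\<Sum>i\<in>V. c * f {i} + g {i}) = 0"
    using assms by (simp add: point_functions_def sum.distrib sum_distrib_left[symmetric])
  ultimately show ?thesis unfolding point_functions_def by blast
qed

lemma point_functions_zero: "(\<lambda>e. 0) \<in> point_functions V"
  by (simp add: point_functions_def)

lemma edge_functions_combine:
  "f \<in> edge_functions V \<Longrightarrow> g \<in> edge_functions V \<Longrightarrow> (\<lambda>e. c * f e + g e) \<in> edge_functions V"
  by (intro edge_functions_add edge_functions_smult)

lemma edge_functions_sum:
  assumes "finite I" "\<And>i. i \<in> I \<Longrightarrow> g i \<in> edge_functions V"
  shows "(\<lambda>e. \<Sum>i\<in>I. c i * g i e) \<in> edge_functions V"
  using assms
proof (induction I rule: finite_induct)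
  case empty
  then show ?case by (simp add: edge_functions_zero)
next
  case (insert i I)
  then have "(\<lambda>e. c i * g i e + (\<Sum>i\<in>I. c i * g i e)) \<in> edge_functions V"
    by (intro edge_functions_combine) auto
  then show ?case using insert by simp
qed

lemma point_pair_in:
  assumes "finite V" "a \<in> V" "b \<in> V"
  shows "(\<lambda>e. ind {b} e - ind {a} e) \<in> point_functions V"
proof -
  have "(\<Sum>i\<in>V. ind {b} {i} - ind {a} {i}) = 0"
    using assms by (simp add: ind_def sum_subtractf)
  moreover have "e \<subseteq> V \<and> card e = 1" if ne: "ind {b} e - ind {a} e \<noteq> 0" for e
  proof -
    have "e = {b} \<or> e = {a}" by (rule ccontr) (use ne in \<open>simp add: ind_def\<close>)
    then show ?thesis using assms by auto
  qed
  ultimately show ?thesis unfolding point_functions_def by blast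
qed

lemma sum_ind_pair:
  assumes "finite V" "x \<in> V" "y \<in> V" "x \<noteq> y"
  shows "(\<Sum>j\<in>V. ind {x, y} {i, j}) = (if i = x \<or> i = y then 1 else 0)"
proof -
  have "ind {x, y} {i, j} = (if j = y then if i = x then 1 else 0 else 0) + (if j = x then if i = y then 1 else 0 else 0)"
    for j using assms(4) by (auto simp: ind_def doubleton_eq_iff)
  then show ?thesis using assms by (simp add: sum.distrib)
qed

lemma quad_in:
  assumes V: "finite V" "{a, b, c, d} \<subseteq> V" "distinct [a, b, c, d]"
  shows "quad a b c d \<in> edge_functions V"
proof -
  have "(\<Sum>j\<in>V. quad a b c d {i, j}) = 0" for i
  proof -
    have "(\<Sum>j\<in>V. quad a b c d {i, j}) = (\<Sum>j\<in>V. ind {b, d} {i, j}) - (\<Sum>j\<in>V. ind {a, d} {i, j})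
        - (\<Sum>j\<in>V. ind {b, c} {i, j}) + (\<Sum>j\<in>V. ind {a, c} {i, j})"
      unfolding quad_def by (simp only: sum.distrib sum_subtractf)
    also have "\<dots> = (if i = b \<or> i = d then 1 else 0) - (if i = a \<or> i = d then 1 else 0)
        - (if i = b \<or> i = c then 1 else 0) + (if i = a \<or> i = c then 1 else 0)"
      using V by (simp add: sum_ind_pair)
    also have "\<dots> = 0" using V(3) by auto
    finally show ?thesis .
  qed
  moreover have "e \<subseteq> V \<and> card e = 2" if ne: "quad a b c d e \<noteq> 0" for e
  proof -
    have "e = {b, d} \<or> e = {a, d} \<or> e = {b, c} \<or> e = {a, c}"
      by (rule ccontr) (use ne in \<open>simp add: quad_def ind_def\<close>)
    then show ?thesis using V(2,3) by auto
  qed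
  ultimately show ?thesis unfolding edge_functions_def by blast
qed

theorem span_point_functions:
  assumes V: "finite V" "card V = Suc k" "k \<ge> 1"
  shows "span_of (polytabloid [k, 1] V) (tableaux [k, 1] V) = on_tabloids V ` point_functions V"
proof
  show "span_of (polytabloid [k, 1] V) (tableaux [k, 1] V) \<subseteq> on_tabloids V ` point_functions V"
  proof (rule span_of_subset)
    fix t assume t: "t \<in> tableaux [k, 1] V"
    have cells: "(0, 0) \<in> cells [k, 1]" "(1, 0) \<in> cells [k, 1]" using V(3) by (auto simp: cells_def)
    show "polytabloid [k, 1] V t \<in> on_tabloids V ` point_functions V"
      unfolding polytabloid_1[OF t V(3)]
      by (intro imageI point_pair_in[OF V(1)] tableau_entry_in[OF t] cells)
  next
    show "(\<lambda>T. 0) \<in> on_tabloids V ` point_functions V"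
      by (rule image_eqI[OF _ point_functions_zero]) (simp add: on_tabloids_def fun_eq_iff)
  next
    fix c f g assume "f \<in> on_tabloids V ` point_functions V" "g \<in> on_tabloids V ` point_functions V"
    then obtain a b where "f = on_tabloids V a" "a \<in> point_functions V" "g = on_tabloids V b" "b \<in> point_functions V"
      by blast
    then show "(\<lambda>T. c * f T + g T) \<in> on_tabloids V ` point_functions V"
      using point_functions_combine by (intro image_eqI[of _ _ "\<lambda>e. c * a e + b e"])
        (simp_all add: on_tabloids_add on_tabloids_smult)
  qed
  show "on_tabloids V ` point_functions V \<subseteq> span_of (polytabloid [k, 1] V) (tableaux [k, 1] V)"
  proof (rule image_subsetI)
    fix f assume f: "f \<in> point_functions V"
    obtain x where x: "x \<in> V" using V by fastforce
    \<comment> \<open>Expansion in differences against one point \<open>x\<close>; the coefficient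
      at \<open>x\<close> itself comes out right because the values of \<open>f\<close> add up to
      0.\<close>
    let ?g = "\<lambda>e. \<Sum>i\<in>V - {x}. f {i} * (ind {i} e - ind {x} e)"
    have "f e = ?g e" for e
    proof -
      consider i where "i \<in> V" "i \<noteq> x" "e = {i}" | "e = {x}" | "\<And>i. i \<in> V \<Longrightarrow> e \<noteq> {i}" using x by blast
      then show ?thesis
      proof cases
        case 1
        then have "?g e = (\<Sum>j\<in>V - {x}. if j = i then f {j} else 0)"
          by (intro sum.cong) (auto simp: ind_def)
        then show ?thesis using 1 V(1) by simp
      next
        case 2
        then have "?g e = (\<Sum>j\<in>V - {x}. - f {j})"
          by (intro sum.cong) (auto simp: ind_def)
        then have "?g e = - (\<Sum>j\<in>V - {x}. f {j})" by (simp add: sum_negf)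
        moreover have "f {x} + (\<Sum>j\<in>V - {x}. f {j}) = 0"
          using f sum.remove[OF V(1) x, of "\<lambda>j. f {j}"] by (simp add: point_functions_def)
        ultimately show ?thesis using 2 by (simp add: add_eq_0_iff2)
      next
        case 3
        then have "f e = 0" using f unfolding point_functions_def by (auto simp: card_1_singleton_iff)
        moreover have "?g e = 0" using 3 x by (intro sum.neutral) (auto simp: ind_def)
        ultimately show ?thesis by simp
      qed
    qed
    then have "f = ?g" by (rule ext)
    then have "on_tabloids V f = on_tabloids V ?g" by (rule arg_cong)
    also have "\<dots> = (\<lambda>T. \<Sum>i\<in>V - {x}. f {i} * on_tabloids V (\<lambda>e. ind {i} e - ind {x} e) T)"
      by (simp only: on_tabloids_sum on_tabloids_smult)
    also have "\<dots> \<in> span_of (polytabloid [k, 1] V) (tableaux [k, 1] V)"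
      by (rule span_of_sum) (use V(1) polytabloid_1_span[OF V x] in auto)
    finally show "on_tabloids V f \<in> span_of (polytabloid [k, 1] V) (tableaux [k, 1] V)" .
  qed
qed

text \<open>The vertex sum at k outside {x, y} reduces to f {k, x} + f {k, y} = 0, so by
  \<open>star\<close> only the triangle x, y, k0 can carry nonzero values. Its vertex sums say that
  any two of its edges cancel, and on a cycle of odd length this forces 0.\<close>

lemma edge_function_determined:
  assumes V: "finite V" and f: "f \<in> edge_functions V" and xy: "x \<in> V" "y \<in> V" "x \<noteq> y"
    and k0: "k0 \<in> V - {x, y}"
    and far: "\<And>p q. p \<in> V - {x, y} \<Longrightarrow> q \<in> V - {x, y} \<Longrightarrow> f {p, q} = 0"
    and star: "\<And>k. k \<in> V - {x, y, k0} \<Longrightarrow> f {x, k} = 0"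
  shows "f = (\<lambda>e. 0)"
proof -
  have split: "f {k, x} + f {k, y} + (\<Sum>j\<in>V - {x, y}. f {k, j}) = 0" if "k \<in> V" for k
  proof -
    have "V = insert x (insert y (V - {x, y}))" using xy by auto
    then have "(\<Sum>j\<in>V. f {k, j}) = (\<Sum>j\<in>insert x (insert y (V - {x, y})). f {k, j})" by simp
    also have "\<dots> = f {k, x} + f {k, y} + (\<Sum>j\<in>V - {x, y}. f {k, j})" using V xy by (simp add: add.assoc)
    finally show ?thesis using f that by (simp add: edge_functions_def)
  qed
  have rim: "f {k, x} + f {k, y} = 0" if "k \<in> V - {x, y}" for k
    using split[of k] far[OF that] that by simp
  have y_star: "f {y, k} = 0" if "k \<in> V - {x, y, k0}" for k
    using rim[of k] star[OF that] that by (simp add: insert_commute)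
  have only_k0: "(\<Sum>j\<in>V - {x, y}. f {z, j}) = f {z, k0}" if "\<And>k. k \<in> V - {x, y, k0} \<Longrightarrow> f {z, k} = 0" for z
  proof -
    have "(\<Sum>j\<in>V - {x, y} - {k0}. f {z, j}) = 0" by (rule sum.neutral) (use that in auto)
    then show ?thesis using sum.remove[of "V - {x, y}" k0 "\<lambda>j. f {z, j}"] V k0 by simp
  qed
  have diag: "f {i} = 0" for i using edge_functions_diag[OF f] .
  have "f {x, y} + f {x, k0} = 0" "f {x, y} + f {y, k0} = 0"
    using split[OF xy(1)] split[OF xy(2)] only_k0[OF star] only_k0[OF y_star] diag
    by (simp_all add: insert_commute)
  moreover have "f {x, k0} + f {y, k0} = 0" using rim[OF k0] by (simp add: insert_commute)
  moreover have "2 * f {x, y} = (f {x, y} + f {x, k0}) + (f {x, y} + f {y, k0}) - (f {x, k0} + f {y, k0})" by simp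
  ultimately have "2 * f {x, y} = 0" by (simp only:) simp
  then have z: "f {x, y} = 0" "f {x, k0} = 0" "f {y, k0} = 0"
    using \<open>f {x, y} + f {x, k0} = 0\<close> \<open>f {x, y} + f {y, k0} = 0\<close> by auto
  have "f e = 0" for e
  proof (rule ccontr)
    assume fe: "f e \<noteq> 0"
    then have "e \<subseteq> V" "card e = 2" using f by (auto simp: edge_functions_def)
    then obtain i j where ij: "e = {i, j}" "i \<noteq> j" "i \<in> V" "j \<in> V" by (auto simp: card_2_iff)
    have "f {x, k} = 0" "f {y, k} = 0" if k: "k \<in> V" for k
    proof -
      consider "k = x" | "k = y" | "k = k0" | "k \<in> V - {x, y, k0}" using k by blast
      then show "f {x, k} = 0" "f {y, k} = 0"
        by (cases; use star y_star z diag in \<open>simp add: insert_commute\<close>)+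
    qed
    note touching = this
    have "f {i, j} = 0"
    proof (cases "i \<in> {x, y} \<or> j \<in> {x, y}")
      case True
      then show ?thesis using touching[OF ij(3)] touching[OF ij(4)] by (auto simp: insert_commute)
    next
      case False
      then show ?thesis using far[of i j] ij(3,4) by blast
    qed
    then show False using fe ij(1) by simp
  qed
  then show ?thesis by blast
qed

text \<open>Elimination in two rounds. \<open>quad x p y q\<close> has {p, q} as its only edge
  disjoint from {x, y}; subtracting multiples of these clears all such edges.
  \<open>quad y x k0 k\<close> has no edge disjoint from {x, y} and coefficient 1 at {x, k}, so the
  second round clears the edges {x, k} with k different from k0 and preserves the first. The rest is
  0 by \<open>edge_function_determined\<close>.\<close>

theorem span_edge_functions:
  assumes V: "finite V" "card V = k + 2" "k \<ge> 2"
  shows "span_of (polytabloid [k, 2] V) (tableaux [k, 2] V) = on_tabloids V ` edge_functions V"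
proof
  let ?S = "span_of (polytabloid [k, 2] V) (tableaux [k, 2] V)"
  show "?S \<subseteq> on_tabloids V ` edge_functions V"
  proof (rule span_of_subset)
    fix t assume t: "t \<in> tableaux [k, 2] V"
    have cells: "(0, 0) \<in> cells [k, 2]" "(1, 0) \<in> cells [k, 2]" "(0, 1) \<in> cells [k, 2]" "(1, 1) \<in> cells [k, 2]"
      using V(3) by (auto simp: cells_def)
    have "{t (0, 0), t (1, 0), t (0, 1), t (1, 1)} \<subseteq> V" using tableau_entry_in[OF t] cells by blast
    moreover have "distinct [t (0, 0), t (1, 0), t (0, 1), t (1, 1)]"
      using cells by (simp add: tableau_entry_eq_iff[OF t])
    ultimately show "polytabloid [k, 2] V t \<in> on_tabloids V ` edge_functions V"
      unfolding polytabloid_2[OF t V(3)] by (intro imageI quad_in[OF V(1)])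
  next
    show "(\<lambda>T. 0) \<in> on_tabloids V ` edge_functions V"
      by (rule image_eqI[OF _ edge_functions_zero]) (simp add: on_tabloids_def fun_eq_iff)
  next
    fix c f g assume "f \<in> on_tabloids V ` edge_functions V" "g \<in> on_tabloids V ` edge_functions V"
    then obtain a b where "f = on_tabloids V a" "a \<in> edge_functions V" "g = on_tabloids V b" "b \<in> edge_functions V"
      by blast
    then show "(\<lambda>T. c * f T + g T) \<in> on_tabloids V ` edge_functions V"
      using edge_functions_combine by (intro image_eqI[of _ _ "\<lambda>e. c * a e + b e"])
        (simp_all add: on_tabloids_add on_tabloids_smult)
  qed
  show "on_tabloids V ` edge_functions V \<subseteq> ?S"
  proof (rule image_subsetI)
    fix f assume f: "f \<in> edge_functions V"
    have "3 \<le> card V" using V by simp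
    then obtain W where W: "W \<subseteq> V" "card W = 3" "finite W" by (rule obtain_subset_with_card_n)
    obtain x y k0 where xyk: "W = {x, y, k0}" "x \<noteq> y" "y \<noteq> k0" "x \<noteq> k0"
      using W(2) by (auto simp: card_3_iff)
    then have xy: "x \<in> V" "y \<in> V" "x \<noteq> y" and k0: "k0 \<in> V - {x, y}" using W(1) by auto
    let ?R = "V - {x, y}"
    \<comment> \<open>A dummy value 0 on the diagonal lets the sum run over the full
      product.\<close>
    define Q where "Q = (\<lambda>p. if fst p = snd p then (\<lambda>e. 0) else quad x (fst p) y (snd p))"
    have finR: "finite ?R" using V(1) by simp
    have Q: "Q p \<in> edge_functions V \<and> on_tabloids V (Q p) \<in> ?S" if p: "p \<in> ?R \<times> ?R" for p
    proof (cases "fst p = snd p")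
      case True
      have "on_tabloids V (\<lambda>e. 0) = (\<lambda>T. 0)" by (simp add: on_tabloids_def fun_eq_iff)
      then show ?thesis using True span_of_zero edge_functions_zero by (simp add: Q_def)
    next
      case False
      have "{x, fst p, y, snd p} \<subseteq> V" "distinct [x, fst p, y, snd p]" using p xy False by auto
      then show ?thesis using quad_in[OF V(1)] polytabloid_2_span[OF V] False by (simp add: Q_def)
    qed
    have Q': "quad y x k0 k \<in> edge_functions V \<and> on_tabloids V (quad y x k0 k) \<in> ?S" if kk: "k \<in> ?R - {k0}" for k
    proof -
      have yx: "{y, x, k0, k} \<subseteq> V" "distinct [y, x, k0, k]" using kk xy k0 by auto
      show ?thesis by (intro conjI quad_in[OF V(1) yx] polytabloid_2_span[OF V yx])
    qed
    \<comment> \<open>Each edge {p, q} occurs in both orders, hence the division by 2.\<close>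
    define h where "h = (\<lambda>e. \<Sum>p\<in>?R \<times> ?R. (f {fst p, snd p} / 2) * Q p e)"
    define f1 where "f1 = (\<lambda>e. (- 1) * h e + f e)"
    define h' where "h' = (\<lambda>e. \<Sum>k\<in>?R - {k0}. f1 {x, k} * quad y x k0 k e)"
    define f2 where "f2 = (\<lambda>e. (- 1) * h' e + f1 e)"
    have hE: "h \<in> edge_functions V"
      unfolding h_def by (rule edge_functions_sum) (use Q finR in auto)
    have f1E: "f1 \<in> edge_functions V" unfolding f1_def by (rule edge_functions_combine[OF hE f])
    have h'E: "h' \<in> edge_functions V"
      unfolding h'_def by (rule edge_functions_sum) (use Q' finR in auto)
    have f2E: "f2 \<in> edge_functions V" unfolding f2_def by (rule edge_functions_combine[OF h'E f1E])
    have f1_far: "f1 {p, q} = 0" if pq: "p \<in> ?R" "q \<in> ?R" for p q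
    proof (cases "p = q")
      case True
      then show ?thesis using edge_functions_diag[OF f1E] by simp
    next
      case False
      have "h {p, q} = (\<Sum>i\<in>?R. \<Sum>j\<in>?R. f {i, j} / 2 * Q (i, j) {p, q})"
        by (simp add: h_def sum.cartesian_product case_prod_unfold)
      also have "\<dots> = (\<Sum>i\<in>?R. \<Sum>j\<in>?R. (if i = p then if j = q then f {p, q} / 2 else 0 else 0)
          + (if i = q then if j = p then f {p, q} / 2 else 0 else 0))"
      proof (intro sum.cong refl)
        fix i j assume ij: "i \<in> ?R" "j \<in> ?R"
        have "Q (i, j) {p, q} = (if i = j then 0 else ind {i, j} {p, q})"
          using pq ij by (auto simp: Q_def quad_def ind_def doubleton_eq_iff)
        then show "f {i, j} / 2 * Q (i, j) {p, q} = (if i = p then if j = q then f {p, q} / 2 else 0 else 0)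
          + (if i = q then if j = p then f {p, q} / 2 else 0 else 0)"
          using False by (auto simp: ind_def doubleton_eq_iff insert_commute)
      qed
      also have "\<dots> = f {p, q}"
        unfolding sum.distrib sum_double_delta[OF finR pq] sum_double_delta[OF finR pq(2,1)] by simp
      finally show ?thesis by (simp add: f1_def)
    qed
    have "f2 = (\<lambda>e. 0)"
    proof (rule edge_function_determined[OF V(1) f2E xy k0])
      fix p q assume pq: "p \<in> ?R" "q \<in> ?R"
      have "h' {p, q} = 0"
        unfolding h'_def using pq k0 by (intro sum.neutral) (auto simp: quad_def ind_def doubleton_eq_iff)
      then show "f2 {p, q} = 0" using f1_far[OF pq] by (simp add: f2_def)
    next
      fix l assume l: "l \<in> V - {x, y, k0}"
      have "h' {x, l} = (\<Sum>m\<in>?R - {k0}. if m = l then f1 {x, l} else 0)"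
        unfolding h'_def using l k0 xy
        by (intro sum.cong refl) (auto simp: quad_def ind_def doubleton_eq_iff)
      also have "\<dots> = f1 {x, l}" using l finR by simp
      finally show "f2 {x, l} = 0" by (simp add: f2_def)
    qed
    then have f2_0: "f2 e = 0" for e by simp
    have "f e = h e + h' e" for e
      using f2_0[of e] by (simp add: f2_def f1_def algebra_simps)
    then have "f = (\<lambda>e. h e + h' e)" by (rule ext)
    then have "on_tabloids V f = on_tabloids V (\<lambda>e. h e + h' e)" by (rule arg_cong)
    then have "on_tabloids V f = (\<lambda>T. on_tabloids V h T + on_tabloids V h' T)"
      by (simp only: on_tabloids_add)
    moreover have "on_tabloids V h \<in> ?S"
      unfolding h_def on_tabloids_sum on_tabloids_smult by (rule span_of_sum) (use Q finR in auto)
    moreover have "on_tabloids V h' \<in> ?S"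
      unfolding h'_def on_tabloids_sum on_tabloids_smult by (rule span_of_sum) (use Q' finR in auto)
    ultimately show "on_tabloids V f \<in> ?S" using span_of_add by simp
  qed
qed

section \<open>Isomorphisms with Specht modules\<close>

lemma module_iso_on_tabloids:
  assumes "\<And>p. p permutes A \<Longrightarrow> p permutes V"
  shows "module_iso A (set_module W) (tabloid_module (on_tabloids V ` W)) (on_tabloids V)"
proof -
  have "bij_betw (on_tabloids V) W (on_tabloids V ` W)"
    using on_tabloids_inject by (intro inj_on_imp_bij_betw inj_onI) blast
  moreover have "on_tabloids V (\<lambda>e. 0) = (\<lambda>T. 0)" by (simp add: on_tabloids_def fun_eq_iff)
  moreover have "on_tabloids V (\<lambda>e. a (inv_into UNIV p ` e)) = (\<lambda>T. on_tabloids V a (\<lambda>i. inv_into UNIV p ` T i))"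
    if "p permutes A" for p a
    using on_tabloids_permute[OF assms[OF permutes_inv[OF that]], of a] by (simp add: fun_eq_iff)
  ultimately show ?thesis
    by (simp add: module_iso_def set_module_def tabloid_module_def on_tabloids_add on_tabloids_smult)
qed

lemma specht_2:
  assumes "finite V" "card V = k + 2" "k \<ge> 2"
  shows "specht [k, 2] V = tabloid_module (on_tabloids V ` edge_functions V)"
  using span_edge_functions[OF assms] by (simp add: specht_def span_of_def)

lemma specht_1:
  assumes "finite V" "card V = Suc k" "k \<ge> 1"
  shows "specht [k, 1] V = tabloid_module (on_tabloids V ` point_functions V)"
  using span_point_functions[OF assms] by (simp add: specht_def span_of_def)

text \<open>On three vertices the vertex sums leave nothing but 0, so the convention for n = 3 is an
  instance of the general description.\<close>

lemma zero_module_edge_functions: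
  assumes V: "finite V" "card V = 3"
  shows "zero_module = tabloid_module (on_tabloids V ` edge_functions V)"
proof -
  obtain x y z where xyz: "V = {x, y, z}" "x \<noteq> y" "y \<noteq> z" "x \<noteq> z" using V(2) by (auto simp: card_3_iff)
  have "f = (\<lambda>e. 0)" if f: "f \<in> edge_functions V" for f
    using V(1) f xyz(1-4) edge_functions_diag[OF f]
    by (intro edge_function_determined[OF V(1) f, of x y z]) auto
  then have "edge_functions V = {\<lambda>e. 0}" using edge_functions_zero by blast
  moreover have "on_tabloids V (\<lambda>e. 0) = (\<lambda>T. 0)" by (simp add: on_tabloids_def fun_eq_iff)
  ultimately show ?thesis by (simp add: zero_module_def)
qed

lemma module_iso_trans:
  assumes f: "module_iso A L M f" and g: "module_iso A M N g"
  shows "module_iso A L N (\<lambda>x. g (f x))"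
proof -
  have mem: "f x \<in> carrier M" if "x \<in> carrier L" for x
    using f that by (auto simp: module_iso_def bij_betw_def)
  have "bij_betw (g \<circ> f) (carrier L) (carrier N)"
    using f g bij_betw_trans unfolding module_iso_def by blast
  then show ?thesis using f g mem by (simp add: module_iso_def comp_def)
qed

lemma module_iso_direct_sum:
  assumes f: "module_iso A M M' f" and g: "module_iso A N N' g"
  shows "module_iso A (direct_sum M N) (direct_sum M' N') (map_prod f g)"
proof -
  have "bij_betw (map_prod f g) (carrier M \<times> carrier N) (carrier M' \<times> carrier N')"
    using f g by (intro bij_betw_map_prod) (simp_all add: module_iso_def)
  then show ?thesis using f g by (auto simp: module_iso_def direct_sum_def)
qed

subsection \<open>Restriction to the stabilizer of the point at infinity\<close>

text \<open>For permutations fixing 0 the edge {0, i} behaves like the vertex i; recording it on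
  singletons yields the standard representation.\<close>

definition spoke_part :: "nat \<Rightarrow> (nat set \<Rightarrow> complex) \<Rightarrow> nat set \<Rightarrow> complex" where
  "spoke_part n a e = (if e \<subseteq> {1..n} \<and> card e = 1 then a (insert 0 e) else 0)"

text \<open>The correction makes the vertex sums over \<open>{1..n}\<close> vanish.\<close>

definition rim_part :: "nat \<Rightarrow> (nat set \<Rightarrow> complex) \<Rightarrow> nat set \<Rightarrow> complex" where
  "rim_part n a e = (if e \<subseteq> {1..n} \<and> card e = 2
     then a e + (\<Sum>i\<in>e. a {0, i}) / (of_nat n - 2) else 0)"

text \<open>The origin of the constant n - 2: h i occurs in n - 1 terms, and the other values h j
  add up to - h i.\<close>

lemma sum_off_diagonal:
  fixes h :: "nat \<Rightarrow> complex"
  assumes h: "(\<Sum>j\<in>{1..n}. h j) = 0" and i: "i \<in> {1..n}"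
  shows "(\<Sum>j\<in>{1..n}. if j = i then 0 else h i + h j) = (of_nat n - 2) * h i"
proof -
  have "(\<Sum>j\<in>{1..n}. if j = i then 0 else h i + h j) = (\<Sum>j\<in>{1..n}. (h i + h j) - (if j = i then 2 * h i else 0))"
    by (rule sum.cong) auto
  also have "\<dots> = of_nat n * h i - 2 * h i" using h i by (simp add: sum.distrib sum_subtractf)
  finally show ?thesis by (simp add: algebra_simps)
qed

lemma spokes_sum:
  assumes "a \<in> edge_functions {0..n}" shows "(\<Sum>i\<in>{1..n}. a {0, i}) = 0"
proof -
  have V: "{0..n} = insert 0 {1..n}" by auto
  have "(\<Sum>i\<in>{0..n}. a {0, i}) = 0" using assms by (simp add: edge_functions_def)
  then show ?thesis unfolding V using edge_functions_diag[OF assms] by simp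
qed

lemma spoke_part_in:
  assumes "a \<in> edge_functions {0..n}" shows "spoke_part n a \<in> point_functions {1..n}"
proof -
  have "(\<Sum>i\<in>{1..n}. spoke_part n a {i}) = (\<Sum>i\<in>{1..n}. a {0, i})"
    by (rule sum.cong) (auto simp: spoke_part_def)
  moreover have "e \<subseteq> {1..n} \<and> card e = 1" if "spoke_part n a e \<noteq> 0" for e
    using that unfolding spoke_part_def by argo
  ultimately show ?thesis using spokes_sum[OF assms] unfolding point_functions_def by simp
qed

lemma of_nat_minus_2_nonzero:
  assumes "n \<ge> 3" shows "of_nat n - 2 \<noteq> (0 :: complex)"
proof
  assume "of_nat n - 2 = (0 :: complex)"
  then have "of_nat n = (of_nat 2 :: complex)" by simp
  then have "n = 2" by (simp only: of_nat_eq_iff)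
  then show False using assms by simp
qed

lemma rim_part_in:
  assumes a: "a \<in> edge_functions {0..n}" and n: "n \<ge> 3"
  shows "rim_part n a \<in> edge_functions {1..n}"
proof -
  let ?c = "of_nat n - 2 :: complex"
  have c: "?c \<noteq> 0" by (rule of_nat_minus_2_nonzero[OF n])
  have V: "{0..n} = insert 0 {1..n}" by auto
  have "(\<Sum>j\<in>{1..n}. rim_part n a {i, j}) = 0" if i: "i \<in> {1..n}" for i
  proof -
    have "(\<Sum>j\<in>{1..n}. rim_part n a {i, j}) =
        (\<Sum>j\<in>{1..n}. a {i, j} + (if j = i then 0 else a {0, i} + a {0, j}) / ?c)"
    proof (rule sum.cong[OF refl])
      fix j assume j: "j \<in> {1..n}"
      show "rim_part n a {i, j} = a {i, j} + (if j = i then 0 else a {0, i} + a {0, j}) / ?c"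
        using i j edge_functions_diag[OF a] by (auto simp: rim_part_def)
    qed
    also have "\<dots> = (\<Sum>j\<in>{1..n}. a {i, j}) + a {0, i}"
      using sum_off_diagonal[OF spokes_sum[OF a] i] c by (simp add: sum.distrib flip: sum_divide_distrib)
    also have "\<dots> = (\<Sum>j\<in>{0..n}. a {i, j})" unfolding V by (simp add: insert_commute)
    also have "\<dots> = 0" using a i by (simp add: edge_functions_def)
    finally show ?thesis .
  qed
  moreover have "e \<subseteq> {1..n} \<and> card e = 2" if "rim_part n a e \<noteq> 0" for e
    using that unfolding rim_part_def by argo
  ultimately show ?thesis unfolding edge_functions_def by blast
qed

lemma spoke_rim_inject:
  assumes ab: "a \<in> edge_functions {0..n}" "b \<in> edge_functions {0..n}"
    and eq: "spoke_part n a = spoke_part n b" "rim_part n a = rim_part n b"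
  shows "a = b"
proof
  fix e
  have spoke: "a {0, i} = b {0, i}" if "i \<in> {1..n}" for i
    using fun_cong[OF eq(1), of "{i}"] that by (simp add: spoke_part_def)
  have rim: "a e = b e" if e: "e \<subseteq> {1..n}" "card e = 2" for e
  proof -
    have "(\<Sum>i\<in>e. a {0, i}) = (\<Sum>i\<in>e. b {0, i})" by (rule sum.cong) (use e spoke in auto)
    then show ?thesis using fun_cong[OF eq(2), of e] e by (simp add: rim_part_def)
  qed
  show "a e = b e"
  proof (cases "e \<subseteq> {0..n} \<and> card e = 2")
    case True
    show ?thesis
    proof (cases "0 \<in> e")
      case z: True
      then obtain i where "e = {0, i}" "i \<noteq> 0" using True by (auto simp: card_2_iff insert_commute)
      then show ?thesis using spoke[of i] True by auto
    next
      case False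
      then have "e \<subseteq> {1..n}" using True by (auto simp: subset_iff) (metis not_gr_zero Suc_leI)
      then show ?thesis using rim True by blast
    qed
  next
    case False
    then have "a e = 0" "b e = 0" using ab unfolding edge_functions_def by blast+
    then show ?thesis by simp
  qed
qed

lemma spoke_rim_surject:
  assumes b: "b \<in> point_functions {1..n}" and g: "g \<in> edge_functions {1..n}" and n: "n \<ge> 3"
  shows "\<exists>a\<in>edge_functions {0..n}. spoke_part n a = b \<and> rim_part n a = g"
proof -
  let ?c = "of_nat n - 2 :: complex"
  have c: "?c \<noteq> 0" by (rule of_nat_minus_2_nonzero[OF n])
  have V: "{0..n} = insert 0 {1..n}" by auto
  have b_sum: "(\<Sum>i\<in>{1..n}. b {i}) = 0" using b by (simp add: point_functions_def)
  \<comment> \<open>The inverse construction: the spokes are read off \<open>b\<close>, and the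
    correction they cause in \<open>rim_part\<close> is subtracted from \<open>g\<close>
    beforehand.\<close>
  define a where "a = (\<lambda>e. if e \<subseteq> {0..n} \<and> card e = 2
    then if 0 \<in> e then b (e - {0}) else g e - (\<Sum>i\<in>e. b {i}) / ?c else 0)"
  have a0: "a {0, i} = b {i}" "a {i, 0} = b {i}" if "i \<in> {1..n}" for i
    using that by (auto simp: a_def insert_commute)
  have arim: "a {i, j} = g {i, j} - (if j = i then 0 else b {i} + b {j}) / ?c"
    if "i \<in> {1..n}" "j \<in> {1..n}" for i j
    using that edge_functions_diag[OF g] by (auto simp: a_def)
  have "(\<Sum>j\<in>{0..n}. a {i, j}) = 0" if "i \<in> {0..n}" for i
  proof (cases "i = 0")
    case True
    have "a {0, 0} = 0" by (simp add: a_def)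
    moreover have "(\<Sum>j\<in>{1..n}. a {0, j}) = (\<Sum>j\<in>{1..n}. b {j})" by (rule sum.cong) (auto simp: a0)
    ultimately show ?thesis unfolding V True using b_sum by simp
  next
    case False
    then have i: "i \<in> {1..n}" using that by auto
    have "(\<Sum>j\<in>{1..n}. a {i, j}) = (\<Sum>j\<in>{1..n}. g {i, j} - (if j = i then 0 else b {i} + b {j}) / ?c)"
      by (rule sum.cong) (auto simp: arim[OF i])
    also have "\<dots> = (\<Sum>j\<in>{1..n}. g {i, j}) - b {i}"
      using sum_off_diagonal[OF b_sum i] c by (simp add: sum_subtractf flip: sum_divide_distrib)
    also have "\<dots> = - b {i}" using g i by (simp add: edge_functions_def)
    finally show ?thesis unfolding V using a0(2)[OF i] by simp
  qed
  moreover have "e \<subseteq> {0..n} \<and> card e = 2" if "a e \<noteq> 0" for e using that unfolding a_def by argo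
  ultimately have "a \<in> edge_functions {0..n}" unfolding edge_functions_def by blast
  moreover have "spoke_part n a = b"
  proof
    fix e show "spoke_part n a e = b e"
    proof (cases "e \<subseteq> {1..n} \<and> card e = 1")
      case True
      then obtain i where "e = {i}" "i \<in> {1..n}" by (auto simp: card_1_singleton_iff)
      then show ?thesis using a0 by (simp add: spoke_part_def)
    next
      case False
      then have "b e = 0" using b unfolding point_functions_def by blast
      then show ?thesis unfolding spoke_part_def if_not_P[OF False] by simp
    qed
  qed
  moreover have "rim_part n a = g"
  proof
    fix e show "rim_part n a e = g e"
    proof (cases "e \<subseteq> {1..n} \<and> card e = 2")
      case True
      then obtain i j where "e = {i, j}" "i \<noteq> j" "i \<in> {1..n}" "j \<in> {1..n}" by (auto simp: card_2_iff)
      then show ?thesis using a0 arim[of i j] by (simp add: rim_part_def)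
    next
      case False
      then have "g e = 0" using g unfolding edge_functions_def by blast
      then show ?thesis unfolding rim_part_def if_not_P[OF False] by simp
    qed
  qed
  ultimately show ?thesis by blast
qed

theorem edge_module_restrict:
  assumes n: "n \<ge> 3"
  shows "module_iso {1..n} (edge_module {0..n})
    (direct_sum (set_module (point_functions {1..n})) (edge_module {1..n}))
    (\<lambda>a. (spoke_part n a, rim_part n a))"
proof -
  have "bij_betw (\<lambda>a. (spoke_part n a, rim_part n a)) (edge_functions {0..n})
      (point_functions {1..n} \<times> edge_functions {1..n})"
  proof (rule bij_betw_imageI)
    show "inj_on (\<lambda>a. (spoke_part n a, rim_part n a)) (edge_functions {0..n})"
      by (rule inj_onI) (use spoke_rim_inject in blast)
    show "(\<lambda>a. (spoke_part n a, rim_part n a)) ` edge_functions {0..n} =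
        point_functions {1..n} \<times> edge_functions {1..n}"
    proof (rule equalityI; rule subsetI)
      fix x assume "x \<in> (\<lambda>a. (spoke_part n a, rim_part n a)) ` edge_functions {0..n}"
      then show "x \<in> point_functions {1..n} \<times> edge_functions {1..n}"
        using spoke_part_in rim_part_in[OF _ n] by blast
    next
      fix x assume "x \<in> point_functions {1..n} \<times> edge_functions {1..n}"
      then show "x \<in> (\<lambda>a. (spoke_part n a, rim_part n a)) ` edge_functions {0..n}"
        using spoke_rim_surject[OF _ _ n] by (cases x) (simp add: image_iff, metis)
    qed
  qed
  moreover have "spoke_part n (\<lambda>e. a (r ` e)) = (\<lambda>e. spoke_part n a (r ` e))"
    "rim_part n (\<lambda>e. a (r ` e)) = (\<lambda>e. rim_part n a (r ` e))" if r: "r permutes {1..n}" for r a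
  proof -
    \<comment> \<open>Because \<open>r\<close> fixes 0, it maps spokes to spokes and respects the
      correction term; this is where the restriction to the stabilizer enters.\<close>
    have r0: "r 0 = 0" using permutes_not_in[OF r] by simp
    have inj: "inj r" by (rule permutes_inj[OF r])
    have sub: "r ` e \<subseteq> {1..n} \<longleftrightarrow> e \<subseteq> {1..n}" for e using permutes_in_image[OF r] by blast
    have card: "card (r ` e) = card e" for e by (rule card_image) (rule inj_on_subset[OF inj subset_UNIV])
    have sum: "(\<Sum>i\<in>r ` e. a {0, i}) = (\<Sum>i\<in>e. a {0, r i})" for e
      by (subst sum.reindex) (auto intro: inj_on_subset[OF inj])
    show "spoke_part n (\<lambda>e. a (r ` e)) = (\<lambda>e. spoke_part n a (r ` e))"
      by (simp add: spoke_part_def fun_eq_iff sub card r0 del: One_nat_def)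
    show "rim_part n (\<lambda>e. a (r ` e)) = (\<lambda>e. rim_part n a (r ` e))"
      by (simp add: rim_part_def fun_eq_iff sub card sum r0 del: One_nat_def)
  qed
  then have "spoke_part n (\<lambda>e. a (inv_into UNIV p ` e)) = (\<lambda>e. spoke_part n a (inv_into UNIV p ` e))"
    "rim_part n (\<lambda>e. a (inv_into UNIV p ` e)) = (\<lambda>e. rim_part n a (inv_into UNIV p ` e))"
    if "p permutes {1..n}" for p a using permutes_inv[OF that] by blast+
  ultimately show ?thesis
    by (simp add: module_iso_def set_module_def direct_sum_def)
      (auto simp: spoke_part_def rim_part_def fun_eq_iff sum.distrib sum_distrib_left add_divide_distrib distrib_left)
qed

theorem proposition11:
  fixes n :: nat
  assumes "n \<ge> 3"
  shows "sym_module_iso {0..n}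
           (cohomology_module 1 (dA_complement n) (extended_action n))
           (specht [n - 1, 2] {0..n})
       \<and> sym_module_iso {1..n}
           (cohomology_module 1 (dA_complement n) (permute_points {1..n}))
           (direct_sum (specht [n - 1, 1] {1..n})
             (if n = 3 then zero_module else specht [n - 2, 2] {1..n}))"
proof
  have n2: "n \<ge> 2" using assms by simp
  have "specht [n - 1, 2] {0..n} = tabloid_module (on_tabloids {0..n} ` edge_functions {0..n})"
    using assms by (intro specht_2) auto
  then show "sym_module_iso {0..n} (cohomology_module 1 (dA_complement n) (extended_action n))
      (specht [n - 1, 2] {0..n})"
    using sym_module_iso_span[OF sym_module_edge_module edge_module_cohomology[OF n2] module_iso_on_tabloids]
    by simp
  have sub: "p permutes {0..n}" if "p permutes {1..n}" for p
    by (rule permutes_subset[OF that]) auto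
  have points: "specht [n - 1, 1] {1..n} = tabloid_module (on_tabloids {1..n} ` point_functions {1..n})"
    using assms by (intro specht_1) auto
  \<comment> \<open>Both branches, n = 3 and n > 3, are the edge module on \<open>{1..n}\<close>, so
    the rest is uniform.\<close>
  have edges: "(if n = 3 then zero_module else specht [n - 2, 2] {1..n}) =
      tabloid_module (on_tabloids {1..n} ` edge_functions {1..n})"
    using assms specht_2[of "{1..n}" "n - 2"] zero_module_edge_functions[of "{1..n}"] by auto
  have "module_iso {1..n} (edge_module {0..n})
      (direct_sum (specht [n - 1, 1] {1..n}) (if n = 3 then zero_module else specht [n - 2, 2] {1..n}))
      (\<lambda>a. map_prod (on_tabloids {1..n}) (on_tabloids {1..n}) (spoke_part n a, rim_part n a))"
    unfolding points edges
    by (rule module_iso_trans[OF edge_module_restrict[OF assms]])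
      (intro module_iso_direct_sum module_iso_on_tabloids)
  moreover have "module_iso {1..n} (edge_module {0..n})
      (cohomology_module 1 (dA_complement n) (permute_points {1..n}))
      (\<lambda>a. cohomology_class 1 (dA_complement n) (edge_cochain n a))"
    by (rule edge_module_cohomology[OF n2 sub extended_action_restrict])
  ultimately show "sym_module_iso {1..n} (cohomology_module 1 (dA_complement n) (permute_points {1..n}))
      (direct_sum (specht [n - 1, 1] {1..n}) (if n = 3 then zero_module else specht [n - 2, 2] {1..n}))"
    using sym_module_iso_span[OF sym_module_edge_module[OF sub]] by blast
qed

end
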